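(* (a) Let $\lambda=(n-m,m)$ be a composition of $n$ with $1\leq m\leq n-1$, let $\mathfrak s$ be a row standard $\lambda$-tableau, $J=J(\mathfrak s)$, and let $A\in V_J$ be such that $e_A$ is a verge; put $\mathfrak p=\mathrm{supp}(A)$. Then $\mathbb C\mathcal O_A^J=e_A\mathbb CU$ is an irreducible $\mathbb CU$-module, and it is isomorphic to the unique irreducible constituent of $[A]\mathbb CU=\mathbb C\mathcal O_A$ corresponding to the trivial representation of $U_{\hat{\mathcal R}^-}$ extended to $U_{\hat{\mathcal R}}$ by the linear character $\theta_A$ of $\prod_{(i,j)\in\mathfrak p}X_{ij}$, that is, to $[A]\epsilon_A\mathbb CU\cong \mathrm{Ind}_{U_{\hat{\mathcal R}}}^{U}\mathbb C\epsilon_A$. (b) Conversely, let $\mathfrak p\subseteq\Phi^-$ be a completely hook disconnected main condition set and let $A\in M_n(q)$ with $\mathrm{supp}(A)=\mathfrak p$. Then the irreducible constituent $[A]\epsilon_A\mathbb CU$ of $\mathbb C\mathcal O_A$ described in (a) is isomorphic to $\mathbb C\mathcal O_A^{J}$, where $\lambda=(n-|\mathfrak p|,|\mathfrak p|)$ and $J=J(\mathfrak s)$ for the row standard $\lambda$-tableau $\mathfrak s$ whose second row is $\{i : (i,j)\in\mathfrak p \text{ for some } j\}$.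
   Context: Throughout, $q$ is a power of a prime, $\mathbb F_q$ is the field with $q$ elements, $n\in\mathbb N$, $M_n(q)$ is the algebra of $n\times n$-matrices over $\mathbb F_q$, $E$ the identity matrix, $e_{ij}$ the matrix units, $\Phi^-=\{(i,j): 1\leq j<i\leq n\}$, $x_{ij}(\alpha)=E+\alpha e_{ij}$, $X_{ij}=\{x_{ij}(\alpha):\alpha\in\mathbb F_q\}$, and $U=U_n(q)$ is the group of lower unitriangular matrices in $GL_n(q)$. For $A\in M_n(q)$, $\mathrm{supp}(A)=\{(i,j): A_{ij}\neq 0\}$. For $S\subseteq\Phi^-$ let $V_S=\{A\in M_n(q): \mathrm{supp}(A)\subseteq S\}$; $S$ is closed if $(i,j),(j,k)\in S$ implies $(i,k)\in S$, and then $U_S=\{E+A: A\in V_S\}$ is a subgroup of $U$. Fix a nontrivial linear character $\theta:(\mathbb F_q,+)\to\mathbb C^*$; for $A,B\in V_S$ put $\chi_A(B)=\theta(\sum_{(i,j)\in S}A_{ij}B_{ij})$. A bar over a complex number denotes complex conjugation. Main condition sets. A main condition set is a subset $\mathfrak p=\{(i_1,j_1),\dots,(i_k,j_k)\}\subseteq\Phi^-$ with $i_1,\dots,i_k$ pairwise different and $j_1,\dots,j_k$ pairwise different. It is completely hook disconnected if moreover $\{i_1,\dots,i_k\}\cap\{j_1,\dots,j_k\}=\emptyset$. Lidempotents of $U$. For $A\in V=V_{\Phi^-}$ let $[A]=q^{-|\Phi^-|}\sum_{u\in U}\overline{\chi_A(u-E)}\,u\in\mathbb CU$ (identifying $\mathbb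 C(V,+)$ with $\mathbb CU$ via $u-E\leftrightarrow u$). $U$ permutes the elements $[A]$ by right multiplication up to nonzero scalars; $\mathcal O_A$ is the orbit of $[A]$, i.e. the set of all $[B]$ such that $[A]u$ is a scalar multiple of $[B]$ for some $u\in U$, and $\mathbb C\mathcal O_A=[A]\mathbb CU$ is its span. Let $A\in V_{\Phi^-}$ be such that $\mathrm{supp}(A)=\mathfrak p=\{(i_1,j_1),\dots,(i_k,j_k)\}$ is a completely hook disconnected main condition set (that is, $i_1,\dots,i_k,j_1,\dots,j_k$ are $2k$ pairwise different indices). Define $\mathcal R=\{(r,s)\in\Phi^-: s\notin\{j_1,\dots,j_k\}\}\cup\{(r,j_\nu): 1\leq\nu\leq k,\ i_\nu\leq r\leq n\}$, $\hat{\mathcal R}=\mathcal R\cup\{(b,j)\in\Phi^-: \text{there are } (i,j),(r,b)\in\mathfrak p \text{ with } j<b<i<r\}$, and $\hat{\mathcal R}^-=\hat{\mathcal R}\setminus\mathfrak p$. These sets are closed, $U_{\hat{\mathcal R}^-}\trianglelefteq U_{\hat{\mathcal R}}$ and $U_{\hat{\mathcal R}}/U_{\hat{\mathcal R}^-}\cong X_{i_1j_1}\times\dots\times X_{i_kj_k}$. The linear character $\theta_A$ of $\prod_\nu X_{i_\nu j_\nu}$ sends $x_{i_\nu j_\nu}(\alpha)$ to $\theta(\alpha A_{i_\nu j_\nu})$. Let $\psi_A$ be the linear character of $U_{\hat{\mathcal R}}$ which is trivial on $U_{\hat{\mathcal R}^-}$ and induces $\theta_A$ on the quotient, and let $\epsilon_A=|U_{\hat{\mathcal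 R}}|^{-1}\sum_{u}\psi_A(u^{-1})u\in\mathbb CU_{\hat{\mathcal R}}$ be the primitive idempotent such that $\mathbb C\epsilon_A$ affords $\psi_A$. The irreducible constituent (of multiplicity one) of $\mathbb C\mathcal O_A$ corresponding to the trivial representation of $U_{\hat{\mathcal R}^-}$ extended by $\theta_A$ is $[A]\epsilon_A\mathbb CU$. Two part compositions. Let $\lambda=(n-m,m)$, $0\leq m\leq n-1$. A row standard $\lambda$-tableau $\mathfrak s$ is an arrangement of $1,\dots,n$ (each used once) into a first row of length $n-m$ and a second row of length $m$, increasing along rows; $\underline{\mathfrak s}$ denotes the set of entries of the second row, which determines $\mathfrak s$. Let $s_1,\dots,s_n$ be the entries of $\mathfrak s$ read along the rows, first row first, and let $d=d(\mathfrak s)$ be the permutation matrix with entry $1$ at the positions $(a,s_a)$. Put $J=J(\mathfrak s)=\{(i,j)\in\Phi^-: i\in\underline{\mathfrak s},\ j\notin\underline{\mathfrak s}\}$, $L=L(\mathfrak s)=\{(i,j)\in\Phi^-: i,j\in\underline{\mathfrak s}\text{ or } i,j\notin\underline{\mathfrak s}\}$, $K=J\cup L$; these are closed. Let $P_\lambda$ be the subgroup of all $g\in GL_n(q)$ with $g_{ab}=0$ whenever $a>n-m\geq b$, $\overline{P_\lambda}=\sum_{h\in P_\lambda}h$, and $M_{\mathfrak s}=\overline{P_\lambda}\,d\,\mathbb CU\subseteq\mathbb C GL_n(q)$, a right $\mathbb CU$-module with basis $\{\overline{P_\lambda}du: u\in U_J\}$. For $A\in V_J$ let $e_A\in M_{\mathfrak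 s}$ be (up to a fixed nonzero scalar, the same for all $A$) the element $q^{-|J|}\sum_{u\in U_J}\overline{\chi_A(u-E)}\,\overline{P_\lambda}du$. The set $\mathcal E_J=\{e_A: A\in V_J\}$ is a basis of $M_{\mathfrak s}$ which is permuted by $U_K$ up to nonzero scalars. $\mathcal O_A^J$ denotes the $U_K$-orbit of $e_A$, i.e. the set of all $e_B$ such that $e_Ag$ is a scalar multiple of $e_B$ for some $g\in U_K$; its span $\mathbb C\mathcal O_A^J$ is a $\mathbb CU$-submodule of $M_{\mathfrak s}$. $e_A$ ($A\in V_J$) is called a verge if each row and each column of $A$ contains at most one nonzero entry; then $\mathrm{supp}(A)$ is a completely hook disconnected main condition set. *)

theory Defs
  imports
    "HOL-Algebra.Module"
    "HOL-Library.Function_Algebras"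
    "HOL-Library.Cardinality"
    "Jordan_Normal_Form.Matrix"
    Complex_Main
begin

text \<open>
  Conventions. The finite field is a type of sort \<open>{field, finite}\<close>, and \<open>q\<close> is its cardinality.
  Matrices are Jordan_Normal_Form matrices, so all indices run over \<open>0, \<dots>, n - 1\<close>
  instead of \<open>1, \<dots>, n\<close>; entries of tableaux are shifted accordingly.
\<close>

section \<open>Group algebras and right modules\<close>

text \<open>
  The complex group algebra of a finite group \<open>G\<close> consists of the complex functions vanishing outside
  \<open>carrier G\<close>. Thus for a subgroup \<open>H\<close> the group algebra of \<open>H\<close> is a subset of that of \<open>G\<close>.
  Addition and zero of functions are the pointwise ones of \<^theory>\<open>HOL-Library.Function_Algebras\<close>.
\<close>

definition cscale :: "complex \<Rightarrow> ('x \<Rightarrow> complex) \<Rightarrow> 'x \<Rightarrow> complex" where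
  "cscale c f = (\<lambda>x. c * f x)"

lemma vector_space_cscale: "vector_space cscale"
  by unfold_locales (auto simp: cscale_def fun_eq_iff algebra_simps)

definition cspan :: "('x \<Rightarrow> complex) set \<Rightarrow> ('x \<Rightarrow> complex) set" where
  "cspan S = module.span cscale S"

definition delta :: "'x \<Rightarrow> 'x \<Rightarrow> complex" where
  "delta g = (\<lambda>x. if x = g then 1 else 0)"

definition conv :: "('g, 'b) monoid_scheme \<Rightarrow> ('g \<Rightarrow> complex) \<Rightarrow> ('g \<Rightarrow> complex) \<Rightarrow> 'g \<Rightarrow> complex" where
  "conv G f h = (\<lambda>x. \<Sum>(u, v) \<in> {(u, v) \<in> carrier G \<times> carrier G. u \<otimes>\<^bsub>G\<^esub> v = x}. f u * h v)"

definition group_algebra :: "('g, 'b) monoid_scheme \<Rightarrow> ('g \<Rightarrow> complex) ring" where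
  "group_algebra G = \<lparr>carrier = {f. \<forall>x. x \<notin> carrier G \<longrightarrow> f x = 0},
     mult = conv G, one = delta \<one>\<^bsub>G\<^esub>, zero = 0, add = (+)\<rparr>"

text \<open>
  Right modules use the HOL-Algebra module record, where \<open>a \<odot> x\<close> has to be read as \<open>x\<close> times \<open>a\<close>;
  the associativity axiom is the one of a right module. The library predicate
  \<open>submodule\<close> (a subgroup closed under the action) applies unchanged.
\<close>

locale right_module = R?: ring R + M?: abelian_group M
  for R :: "('r, 'b) ring_scheme" (structure) and M :: "('r, 'v, 'c) module_scheme" (structure) +
  assumes smult_closed:
      "\<lbrakk>a \<in> carrier R; x \<in> carrier M\<rbrakk> \<Longrightarrow> a \<odot>\<^bsub>M\<^esub> x \<in> carrier M"
    and smult_l_distr: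
      "\<lbrakk>a \<in> carrier R; b \<in> carrier R; x \<in> carrier M\<rbrakk> \<Longrightarrow>
        (a \<oplus>\<^bsub>R\<^esub> b) \<odot>\<^bsub>M\<^esub> x = a \<odot>\<^bsub>M\<^esub> x \<oplus>\<^bsub>M\<^esub> b \<odot>\<^bsub>M\<^esub> x"
    and smult_r_distr:
      "\<lbrakk>a \<in> carrier R; x \<in> carrier M; y \<in> carrier M\<rbrakk> \<Longrightarrow>
        a \<odot>\<^bsub>M\<^esub> (x \<oplus>\<^bsub>M\<^esub> y) = a \<odot>\<^bsub>M\<^esub> x \<oplus>\<^bsub>M\<^esub> a \<odot>\<^bsub>M\<^esub> y"
    and smult_assoc:
      "\<lbrakk>a \<in> carrier R; b \<in> carrier R; x \<in> carrier M\<rbrakk> \<Longrightarrow>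
        (a \<otimes>\<^bsub>R\<^esub> b) \<odot>\<^bsub>M\<^esub> x = b \<odot>\<^bsub>M\<^esub> (a \<odot>\<^bsub>M\<^esub> x)"
    and smult_one: "x \<in> carrier M \<Longrightarrow> \<one>\<^bsub>R\<^esub> \<odot>\<^bsub>M\<^esub> x = x"

definition irreducible_right_module ::
  "('r, 'b) ring_scheme \<Rightarrow> ('r, 'v, 'c) module_scheme \<Rightarrow> bool" where
  "irreducible_right_module R M \<longleftrightarrow> right_module R M \<and> carrier M \<noteq> {\<zero>\<^bsub>M\<^esub>} \<and>
     (\<forall>N. submodule N R M \<longrightarrow> N = {\<zero>\<^bsub>M\<^esub>} \<or> N = carrier M)"

definition right_module_isomorphic ::
  "('r, 'b) ring_scheme \<Rightarrow> ('r, 'v, 'c) module_scheme \<Rightarrow> ('r, 'w, 'd) module_scheme \<Rightarrow> bool" where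
  "right_module_isomorphic R M N \<longleftrightarrow> right_module R M \<and> right_module R N \<and>
     (\<exists>f. bij_betw f (carrier M) (carrier N) \<and>
       (\<forall>x\<in>carrier M. \<forall>y\<in>carrier M. f (x \<oplus>\<^bsub>M\<^esub> y) = f x \<oplus>\<^bsub>N\<^esub> f y) \<and>
       (\<forall>a\<in>carrier R. \<forall>x\<in>carrier M. f (a \<odot>\<^bsub>M\<^esub> x) = a \<odot>\<^bsub>N\<^esub> f x))"

text \<open>
  A set \<open>N\<close> of elements of the group algebra of \<open>G\<close>, viewed as a module under right
  multiplication inside that group algebra. The fields \<open>mult\<close> and \<open>one\<close> play no role for modules.
\<close>

definition conv_module ::
  "('g, 'b) monoid_scheme \<Rightarrow> ('g \<Rightarrow> complex) set \<Rightarrow> ('g \<Rightarrow> complex, 'g \<Rightarrow> complex) module" where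
  "conv_module G N = \<lparr>carrier = N, mult = undefined, one = undefined, zero = 0, add = (+),
     smult = (\<lambda>a x. conv G x a)\<rparr>"

text \<open>
  The module induced from a right module \<open>W\<close> over the group algebra of a subgroup \<open>H\<close> of the
  finite group \<open>G\<close>, in its function model: the maps \<open>f\<close> from \<open>G\<close> to \<open>W\<close> with
  \<open>f (h g) = f g \<cdot> h\<^sup>-\<^sup>1\<close>, on which \<open>x \<in> G\<close> acts by \<open>(f \<cdot> x) g = f (g x\<^sup>-\<^sup>1)\<close>, extended linearly.
  Such an \<open>f\<close> corresponds to the sum of \<open>f g \<otimes> g\<close> over representatives \<open>g\<close> of the cosets \<open>H g\<close> in the
  tensor product of \<open>W\<close> with the group algebra of \<open>G\<close>. In \<open>smult\<close>, the complex number \<open>a x\<close> acts on \<open>W\<close>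
  as the element \<open>a x \<cdot> 1\<close> of the group algebra.
\<close>

definition induced_module ::
  "('g, 'b) monoid_scheme \<Rightarrow> 'g set \<Rightarrow> ('g \<Rightarrow> complex, 'w, 'c) module_scheme \<Rightarrow>
    ('g \<Rightarrow> complex, 'g \<Rightarrow> 'w) module" where
  "induced_module G H W = \<lparr>
     carrier = {f \<in> carrier G \<rightarrow>\<^sub>E carrier W.
       \<forall>h\<in>H. \<forall>g\<in>carrier G. f (h \<otimes>\<^bsub>G\<^esub> g) = delta (inv\<^bsub>G\<^esub> h) \<odot>\<^bsub>W\<^esub> f g},
     mult = undefined, one = undefined,
     zero = (\<lambda>g\<in>carrier G. \<zero>\<^bsub>W\<^esub>),
     add = (\<lambda>f f'. \<lambda>g\<in>carrier G. f g \<oplus>\<^bsub>W\<^esub> f' g),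
     smult = (\<lambda>a f. \<lambda>g\<in>carrier G.
       \<Oplus>\<^bsub>W\<^esub>x\<in>carrier G. cscale (a x) (delta \<one>\<^bsub>G\<^esub>) \<odot>\<^bsub>W\<^esub> f (g \<otimes>\<^bsub>G\<^esub> inv\<^bsub>G\<^esub> x))\<rparr>"

text \<open>
  Linear characters; the value \<open>0\<close> outside the group is a convention making them
  determined by their values on the group.
\<close>

definition linear_character :: "('g, 'b) monoid_scheme \<Rightarrow> ('g \<Rightarrow> complex) \<Rightarrow> bool" where
  "linear_character G \<psi> \<longleftrightarrow> (\<forall>x\<in>carrier G. \<psi> x \<noteq> 0) \<and>
     (\<forall>x\<in>carrier G. \<forall>y\<in>carrier G. \<psi> (x \<otimes>\<^bsub>G\<^esub> y) = \<psi> x * \<psi> y) \<and>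
     (\<forall>x. x \<notin> carrier G \<longrightarrow> \<psi> x = 0)"

definition nontrivial_additive_character :: "('a::field \<Rightarrow> complex) \<Rightarrow> bool" where
  "nontrivial_additive_character \<theta> \<longleftrightarrow>
     linear_character \<lparr>carrier = UNIV, mult = (+), one = 0\<rparr> \<theta> \<and> (\<exists>a. \<theta> a \<noteq> 1)"


section \<open>Unitriangular pattern groups\<close>

definition GL :: "nat \<Rightarrow> 'a::field mat monoid" where
  "GL n = units_of (ring_mat TYPE('a) n ())"

definition Phi :: "nat \<Rightarrow> (nat \<times> nat) set" where
  "Phi n = {(i, j). j < i \<and> i < n}"

definition msupp :: "'a::zero mat \<Rightarrow> (nat \<times> nat) set" where
  "msupp A = {(i, j). i < dim_row A \<and> j < dim_col A \<and> A $$ (i, j) \<noteq> 0}"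

definition Vset :: "nat \<Rightarrow> (nat \<times> nat) set \<Rightarrow> 'a::field mat set" where
  "Vset n S = {A \<in> carrier_mat n n. msupp A \<subseteq> S}"

definition Uset :: "nat \<Rightarrow> (nat \<times> nat) set \<Rightarrow> 'a::field mat set" where
  "Uset n S = {1\<^sub>m n + A | A. A \<in> Vset n S}"

definition root_elt :: "nat \<Rightarrow> nat \<times> nat \<Rightarrow> 'a::field \<Rightarrow> 'a mat" where
  "root_elt n ij \<alpha> = 1\<^sub>m n + mat n n (\<lambda>ab. if ab = ij then \<alpha> else 0)"

definition Ugroup :: "nat \<Rightarrow> 'a::field mat monoid" where
  "Ugroup n = (GL n)\<lparr>carrier := Uset n (Phi n)\<rparr>"

abbreviation CU :: "nat \<Rightarrow> ('a::field mat \<Rightarrow> complex) ring" where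
  "CU n \<equiv> group_algebra (Ugroup n)"

abbreviation gl_mult ::
  "nat \<Rightarrow> ('a::field mat \<Rightarrow> complex) \<Rightarrow> ('a mat \<Rightarrow> complex) \<Rightarrow> 'a mat \<Rightarrow> complex" where
  "gl_mult n \<equiv> conv (GL n)"

abbreviation gl_module ::
  "nat \<Rightarrow> ('a::field mat \<Rightarrow> complex) set \<Rightarrow> ('a mat \<Rightarrow> complex, 'a mat \<Rightarrow> complex) module" where
  "gl_module n \<equiv> conv_module (GL n)"

definition cyclic_right :: "nat \<Rightarrow> ('a::field mat \<Rightarrow> complex) \<Rightarrow> ('a mat \<Rightarrow> complex) set" where
  "cyclic_right n x = {gl_mult n x a | a. a \<in> carrier (CU n)}"

definition chi_char :: "('a::field \<Rightarrow> complex) \<Rightarrow> (nat \<times> nat) set \<Rightarrow> 'a mat \<Rightarrow> 'a mat \<Rightarrow> complex" where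
  "chi_char \<theta> S A B = \<theta> (\<Sum>ij\<in>S. A $$ ij * B $$ ij)"


section \<open>Lidempotents and the constituent attached to a main condition set\<close>

definition main_condition_set :: "nat \<Rightarrow> (nat \<times> nat) set \<Rightarrow> bool" where
  "main_condition_set n p \<longleftrightarrow> p \<subseteq> Phi n \<and> inj_on fst p \<and> inj_on snd p"

definition completely_hook_disconnected :: "(nat \<times> nat) set \<Rightarrow> bool" where
  "completely_hook_disconnected p \<longleftrightarrow> fst ` p \<inter> snd ` p = {}"

definition lidem ::
  "('a::{field,finite} \<Rightarrow> complex) \<Rightarrow> nat \<Rightarrow> 'a mat \<Rightarrow> 'a mat \<Rightarrow> complex" where
  "lidem \<theta> n A = cscale (1 / of_nat CARD('a) ^ card (Phi n))
     (\<Sum>u\<in>Uset n (Phi n). cscale (cnj (chi_char \<theta> (Phi n) A (u - 1\<^sub>m n))) (delta u))"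

definition lidem_orbit ::
  "('a::{field,finite} \<Rightarrow> complex) \<Rightarrow> nat \<Rightarrow> 'a mat \<Rightarrow> ('a mat \<Rightarrow> complex) set" where
  "lidem_orbit \<theta> n A = {lidem \<theta> n B | B. B \<in> Vset n (Phi n) \<and>
     (\<exists>u\<in>Uset n (Phi n). \<exists>c. gl_mult n (lidem \<theta> n A) (delta u) = cscale c (lidem \<theta> n B))}"

definition Rset :: "nat \<Rightarrow> (nat \<times> nat) set \<Rightarrow> (nat \<times> nat) set" where
  "Rset n p = {(r, s) \<in> Phi n. s \<notin> snd ` p} \<union> {(r, j). \<exists>i. (i, j) \<in> p \<and> i \<le> r \<and> r < n}"

definition Rhat :: "nat \<Rightarrow> (nat \<times> nat) set \<Rightarrow> (nat \<times> nat) set" where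
  "Rhat n p = Rset n p \<union>
     {(b, j) \<in> Phi n. \<exists>i r. (i, j) \<in> p \<and> (r, b) \<in> p \<and> j < b \<and> b < i \<and> i < r}"

text \<open>
  The isomorphism of \<open>Uset n (Rhat n p)\<close> modulo \<open>Uset n (Rhat n p - p)\<close> with the product of the
  root subgroups at the positions in \<open>p\<close> is induced by the inclusion of these
  root subgroups. Hence inflating the character of the product means prescribing the values on root elements.
\<close>

definition psi_char ::
  "('a::{field,finite} \<Rightarrow> complex) \<Rightarrow> nat \<Rightarrow> 'a mat \<Rightarrow> 'a mat \<Rightarrow> complex" where
  "psi_char \<theta> n A = (THE \<psi>.
     linear_character ((GL n)\<lparr>carrier := Uset n (Rhat n (msupp A))\<rparr>) \<psi> \<and>
     (\<forall>u\<in>Uset n (Rhat n (msupp A) - msupp A). \<psi> u = 1) \<and>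
     (\<forall>ij\<in>msupp A. \<forall>\<alpha>. \<psi> (root_elt n ij \<alpha>) = \<theta> (\<alpha> * A $$ ij)))"

definition eps_idem ::
  "('a::{field,finite} \<Rightarrow> complex) \<Rightarrow> nat \<Rightarrow> 'a mat \<Rightarrow> 'a mat \<Rightarrow> complex" where
  "eps_idem \<theta> n A = cscale (1 / of_nat (card (Uset n (Rhat n (msupp A)) :: 'a mat set)))
     (\<Sum>u\<in>Uset n (Rhat n (msupp A)). cscale (psi_char \<theta> n A (inv\<^bsub>GL n\<^esub> u)) (delta u))"

definition Ind_eps ::
  "('a::{field,finite} \<Rightarrow> complex) \<Rightarrow> nat \<Rightarrow> 'a mat \<Rightarrow>
    ('a mat \<Rightarrow> complex, 'a mat \<Rightarrow> 'a mat \<Rightarrow> complex) module" where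
  "Ind_eps \<theta> n A = induced_module (Ugroup n) (Uset n (Rhat n (msupp A)))
     (gl_module n (cspan {eps_idem \<theta> n A}))"

text \<open>
  \<open>N\<close> is the unique irreducible constituent of the orbit module of \<open>lidem \<theta> n A\<close> that corresponds to
  the trivial representation extended by the character given by \<open>A\<close>: an irreducible submodule
  isomorphic to \<open>Ind_eps \<theta> n A\<close>, and the only submodule of that isomorphism type
  (multiplicity one).
\<close>

definition is_constituent ::
  "('a::{field,finite} \<Rightarrow> complex) \<Rightarrow> nat \<Rightarrow> 'a mat \<Rightarrow> ('a mat \<Rightarrow> complex) set \<Rightarrow> bool" where
  "is_constituent \<theta> n A N \<longleftrightarrow>
     submodule N (CU n) (gl_module n (cspan (lidem_orbit \<theta> n A))) \<and>
     irreducible_right_module (CU n) (gl_module n N) \<and>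
     right_module_isomorphic (CU n) (gl_module n N) (Ind_eps \<theta> n A) \<and>
     (\<forall>N'. submodule N' (CU n) (gl_module n (cspan (lidem_orbit \<theta> n A))) \<and>
        right_module_isomorphic (CU n) (gl_module n N') (Ind_eps \<theta> n A) \<longrightarrow> N' = N)"


section \<open>Two part compositions\<close>

text \<open>
  A tableau of shape \<open>(n - m, m)\<close> is the pair of its rows.
\<close>

definition row_standard :: "nat \<Rightarrow> nat \<Rightarrow> nat list \<times> nat list \<Rightarrow> bool" where
  "row_standard n m s \<longleftrightarrow> length (fst s) = n - m \<and> length (snd s) = m \<and>
     sorted_wrt (<) (fst s) \<and> sorted_wrt (<) (snd s) \<and> set (fst s) \<union> set (snd s) = {0..<n}"

definition perm_mat :: "nat \<Rightarrow> nat list \<times> nat list \<Rightarrow> 'a::field mat" where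
  "perm_mat n s = mat n n (\<lambda>(a, b). if b = (fst s @ snd s) ! a then 1 else 0)"

definition Jset :: "nat \<Rightarrow> nat list \<times> nat list \<Rightarrow> (nat \<times> nat) set" where
  "Jset n s = {(i, j) \<in> Phi n. i \<in> set (snd s) \<and> j \<notin> set (snd s)}"

definition Lset :: "nat \<Rightarrow> nat list \<times> nat list \<Rightarrow> (nat \<times> nat) set" where
  "Lset n s = {(i, j) \<in> Phi n. i \<in> set (snd s) \<longleftrightarrow> j \<in> set (snd s)}"

definition Kset :: "nat \<Rightarrow> nat list \<times> nat list \<Rightarrow> (nat \<times> nat) set" where
  "Kset n s = Jset n s \<union> Lset n s"

text \<open>With 0-based indices the condition \<open>a > n - m \<ge> b\<close> becomes \<open>a \<ge> n - m > b\<close>.\<close>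

definition parabolic :: "nat \<Rightarrow> nat \<Rightarrow> 'a::field mat set" where
  "parabolic n m = {g \<in> carrier (GL n). \<forall>a b. a < n \<and> n - m \<le> a \<and> b < n - m \<longrightarrow> g $$ (a, b) = 0}"

text \<open>The element \<open>e\<^sub>A\<close>, with the free scalar normalised to \<open>1\<close>.\<close>

definition e_elt ::
  "('a::{field,finite} \<Rightarrow> complex) \<Rightarrow> nat \<Rightarrow> nat list \<times> nat list \<Rightarrow> 'a mat \<Rightarrow> 'a mat \<Rightarrow> complex" where
  "e_elt \<theta> n s A = cscale (1 / of_nat CARD('a) ^ card (Jset n s))
     (\<Sum>u\<in>Uset n (Jset n s). cscale (cnj (chi_char \<theta> (Jset n s) A (u - 1\<^sub>m n)))
        (gl_mult n (gl_mult n (\<Sum>h\<in>parabolic n (length (snd s)). delta h) (delta (perm_mat n s))) (delta u)))"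

definition e_orbit ::
  "('a::{field,finite} \<Rightarrow> complex) \<Rightarrow> nat \<Rightarrow> nat list \<times> nat list \<Rightarrow> 'a mat \<Rightarrow>
    ('a mat \<Rightarrow> complex) set" where
  "e_orbit \<theta> n s A = {e_elt \<theta> n s B | B. B \<in> Vset n (Jset n s) \<and>
     (\<exists>g\<in>Uset n (Kset n s). \<exists>c. gl_mult n (e_elt \<theta> n s A) (delta g) = cscale c (e_elt \<theta> n s B))}"

text \<open>The condition on \<open>A\<close> under which \<open>e\<^sub>A\<close> is called a verge.\<close>

definition verge :: "'a::zero mat \<Rightarrow> bool" where
  "verge A \<longleftrightarrow>
     (\<forall>i<dim_row A. card {j. j < dim_col A \<and> A $$ (i, j) \<noteq> 0} \<le> 1) \<and>
     (\<forall>j<dim_col A. card {i. i < dim_row A \<and> A $$ (i, j) \<noteq> 0} \<le> 1)"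

end

theory Submission
  imports Defs "Jordan_Normal_Form.Determinant"
begin

text \<open>
  Let \<open>\<psi>\<close> be the character of \<open>H = U\<^bsub>R\<^esub>\<close> for \<open>R = Rhat n p\<close>, and \<open>\<epsilon>\<close> its idempotent. Two facts about the
  lidempotent \<open>a = [A]\<close> drive the proof: \<open>a u \<epsilon>\<close> is a multiple of \<open>a \<epsilon>\<close> for all \<open>u\<close> in \<open>U\<close> (clear the
  rows of the matrix labelling \<open>a u\<close> from the bottom upwards), and left multiplication by \<open>a\<close> is
  injective on \<open>\<epsilon> CU\<close> (the stabilizer of the line of \<open>a\<close> is contained in \<open>H\<close>, and different characters
  are orthogonal). Together they give \<open>\<epsilon> u \<epsilon>\<close> in \<open>C \<epsilon>\<close>, so \<open>\<epsilon> CU\<close>, which is the induced module, is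
  irreducible, and \<open>a \<epsilon> CU\<close> is the only submodule of \<open>a CU\<close> isomorphic to it. On the permutation side, let
  \<open>b\<close> be the sum of the coset of the parabolic subgroup at \<open>d\<close>. Then \<open>y = b \<epsilon>\<close> is nonzero because \<open>\<psi>\<close> is trivial
  on the stabilizer of \<open>b\<close> in \<open>H\<close>, so \<open>y CU\<close> is isomorphic to \<open>\<epsilon> CU\<close>; averaging over suitable unipotent sets expresses \<open>y\<close>
  through \<open>e\<^sub>A\<close> and vice versa, and \<open>U = H U\<^sub>K\<close> shows that the orbit under \<open>U\<^sub>K\<close> already spans \<open>y CU\<close>.
\<close>

text \<open>All modules are compared with \<open>eps CU\<close> by left multiplication inside the
  algebra of \<open>GL n\<close>: a vector \<open>y\<close> with \<open>y * eps = y\<close> gives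
  the homomorphism sending \<open>x\<close> to \<open>y * x\<close>, so no dimensions have to be
  counted. The obstacle is that \<open>Rset\<close> is too small. If positions \<open>(t, j)\<close>
  and \<open>(r, c)\<close> of \<open>p\<close> satisfy \<open>j < c < t < r\<close>, then
  \<open>H\<close> has no root subgroup at \<open>(t, c)\<close>, and a label may have a nonzero
  entry there. For exactly such pairs \<open>Rhat\<close> contains \<open>(c, j)\<close>, and a root
  element at that position clears the entry. That \<open>psi\<close> remains multiplicative on the
  larger group is where hook disconnectedness enters. On the permutation side \<open>e_A\<close>
  involves all of \<open>U_J\<close>, whereas \<open>y\<close> sees only \<open>J0\<close>, the part
  of \<open>J\<close> inside \<open>Rhat\<close>. Summing translates over the rest of
  \<open>J\<close> leads from \<open>y\<close> to \<open>e_A\<close>. The way back sums over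
  \<open>U_T\<close>, where \<open>T\<close> consists of positions of \<open>L\<close> to the right
  of \<open>p\<close>: this produces a character sum that removes every term outside
  \<open>J0\<close>.\<close>

section \<open>Functions supported on a subset\<close>

definition vanishing_off :: "'x set \<Rightarrow> ('x \<Rightarrow> complex) set" where
  "vanishing_off S = {f. \<forall>x. x \<notin> S \<longrightarrow> f x = 0}"

lemma carrier_group_algebra [simp]: "carrier (group_algebra G) = vanishing_off (carrier G)"
  by (simp add: group_algebra_def vanishing_off_def)

lemma vanishing_offD: "f \<in> vanishing_off S \<Longrightarrow> x \<notin> S \<Longrightarrow> f x = 0"
  by (simp add: vanishing_off_def)

lemma vanishing_off_mono: "S \<subseteq> T \<Longrightarrow> f \<in> vanishing_off S \<Longrightarrow> f \<in> vanishing_off T"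
  by (auto simp: vanishing_off_def)

lemma vanishing_off_zero [simp]: "0 \<in> vanishing_off S"
  by (simp add: vanishing_off_def)

lemma vanishing_off_add: "f \<in> vanishing_off S \<Longrightarrow> g \<in> vanishing_off S \<Longrightarrow> f + g \<in> vanishing_off S"
  by (simp add: vanishing_off_def)

lemma vanishing_off_cscale: "f \<in> vanishing_off S \<Longrightarrow> cscale c f \<in> vanishing_off S"
  by (simp add: vanishing_off_def cscale_def)

lemma vanishing_off_delta: "u \<in> S \<Longrightarrow> delta u \<in> vanishing_off S"
  by (auto simp: vanishing_off_def delta_def)

lemma sum_fun_apply: "(\<Sum>i\<in>I. f i) x = (\<Sum>i\<in>I. f i x)"
  for f :: "'i \<Rightarrow> 'x \<Rightarrow> complex"
  by (induction I rule: infinite_finite_induct) auto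

lemma cscale_simps [simp]:
  "cscale c (cscale d f) = cscale (c * d) f" "cscale 1 f = f" "cscale 0 f = 0" "cscale c 0 = 0"
  by (auto simp: cscale_def)

lemma cscale_apply: "cscale c f x = c * f x"
  by (simp add: cscale_def)

lemma cscale_add_left: "cscale (c + d) f = cscale c f + cscale d f"
  by (auto simp: cscale_def algebra_simps)

lemma cscale_sum: "cscale c (\<Sum>i\<in>I. f i) = (\<Sum>i\<in>I. cscale c (f i))"
  by (auto simp: fun_eq_iff cscale_def sum_fun_apply sum_distrib_left)

lemma cscale_sum_left: "cscale (\<Sum>i\<in>I. c i) f = (\<Sum>i\<in>I. cscale (c i) f)"
  by (auto simp: fun_eq_iff cscale_def sum_fun_apply sum_distrib_right)

lemma uminus_eq_cscale: "- f = cscale (-1) f"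
  by (auto simp: cscale_def)

lemma diff_cscale: "f - cscale c g = f + cscale (- c) g"
  by (auto simp: cscale_def)

lemma cscale_eq_0_iff: "cscale c f = 0 \<longleftrightarrow> c = 0 \<or> f = 0"
  by (auto simp: cscale_def fun_eq_iff)

lemma vanishing_off_expand:
  assumes "finite S" "f \<in> vanishing_off S"
  shows "f = (\<Sum>u\<in>S. cscale (f u) (delta u))"
proof
  fix x
  have "(\<Sum>u\<in>S. f u * (if x = u then 1 else 0)) = (if x \<in> S then f x else 0)"
    using assms(1) by (simp add: if_distrib cong: if_cong)
  then show "f x = (\<Sum>u\<in>S. cscale (f u) (delta u)) x"
    using vanishing_offD[OF assms(2)] by (auto simp: sum_fun_apply cscale_def delta_def)
qed

section \<open>Convolution on a finite group\<close>

locale finite_group = group G for G :: "('g, 'b) monoid_scheme" (structure) +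
  assumes finite_carrier: "finite (carrier G)"
begin

lemma sum_translate_right: "a \<in> carrier G \<Longrightarrow> (\<Sum>v\<in>carrier G. f (v \<otimes> a)) = (\<Sum>v\<in>carrier G. f v)"
  by (rule sum.reindex_bij_witness[of _ "\<lambda>v. v \<otimes> inv a" "\<lambda>v. v \<otimes> a"]) (auto simp: m_assoc)

lemma conv_outside: "x \<notin> carrier G \<Longrightarrow> conv G f h x = 0"
  unfolding conv_def by (rule sum.neutral) auto

lemma conv_apply:
  assumes "x \<in> carrier G"
  shows "conv G f h x = (\<Sum>v\<in>carrier G. f (x \<otimes> inv v) * h v)"
  unfolding conv_def
proof (rule sum.reindex_bij_witness[of _ "\<lambda>v. (x \<otimes> inv v, v)" snd])
  fix p assume "p \<in> {(u, v) \<in> carrier G \<times> carrier G. u \<otimes> v = x}"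
  then obtain u v where p: "p = (u, v)" "u \<in> carrier G" "v \<in> carrier G" "u \<otimes> v = x" by auto
  have "x \<otimes> inv v = u" using p by (simp add: m_assoc flip: p(4))
  then show "(x \<otimes> inv (snd p), snd p) = p" "f (x \<otimes> inv (snd p)) * h (snd p) = (case p of (u, v) \<Rightarrow> f u * h v)"
      "snd p \<in> carrier G"
    using p by auto
next
  fix v assume "v \<in> carrier G"
  then show "(x \<otimes> inv v, v) \<in> {(u, v) \<in> carrier G \<times> carrier G. u \<otimes> v = x}"
    using assms by (simp add: m_assoc)
qed simp

lemma conv_vanishing_off: "conv G f h \<in> vanishing_off (carrier G)"
  by (simp add: vanishing_off_def conv_outside)

lemma conv_eqI: "(\<And>x. x \<in> carrier G \<Longrightarrow> conv G f h x = conv G f' h' x) \<Longrightarrow> conv G f h = conv G f' h'"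
  by (rule ext, case_tac "x \<in> carrier G") (auto simp: conv_outside)

lemma conv_add_left: "conv G (f + f') h = conv G f h + conv G f' h"
  and conv_add_right: "conv G f (h + h') = conv G f h + conv G f h'"
  by (auto simp: fun_eq_iff conv_def sum.distrib[symmetric] algebra_simps intro!: sum.cong)

lemma conv_cscale_left: "conv G (cscale c f) h = cscale c (conv G f h)"
  and conv_cscale_right: "conv G f (cscale c h) = cscale c (conv G f h)"
  by (auto simp: fun_eq_iff conv_def cscale_def sum_distrib_left intro!: sum.cong)

lemma conv_zero_left [simp]: "conv G 0 h = 0" and conv_zero_right [simp]: "conv G f 0 = 0"
  by (auto simp: fun_eq_iff conv_def)

lemma conv_sum_left: fixes f :: "'i \<Rightarrow> 'g \<Rightarrow> complex" shows "conv G (\<Sum>i\<in>I. f i) h = (\<Sum>i\<in>I. conv G (f i) h)"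
  by (induction I rule: infinite_finite_induct) (simp_all add: conv_add_left del: zero_fun_apply plus_fun_apply)

lemma conv_sum_right: fixes h :: "'i \<Rightarrow> 'g \<Rightarrow> complex" shows "conv G f (\<Sum>i\<in>I. h i) = (\<Sum>i\<in>I. conv G f (h i))"
  by (induction I rule: infinite_finite_induct) (simp_all add: conv_add_right del: zero_fun_apply plus_fun_apply)

lemma conv_diff_right: "conv G f (h - h') = conv G f h - conv G f h'"
  using conv_add_right[of f "h - h'" h'] by simp

lemma conv_assoc: "conv G (conv G f g) h = conv G f (conv G g h)"
proof (rule conv_eqI)
  fix x assume x: "x \<in> carrier G"
  have "conv G (conv G f g) h x
      = (\<Sum>v\<in>carrier G. (\<Sum>w\<in>carrier G. f (x \<otimes> inv v \<otimes> inv w) * g w) * h v)"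
    using x by (simp add: conv_apply)
  also have "\<dots> = (\<Sum>v\<in>carrier G. \<Sum>w\<in>carrier G. f (x \<otimes> inv w) * g (w \<otimes> inv v) * h v)"
  proof (rule sum.cong[OF refl])
    fix v assume v: "v \<in> carrier G"
    \<comment> \<open>Replacing \<open>w\<close> by \<open>w \<otimes> inv v\<close> frees the
      argument of \<open>f\<close> from \<open>v\<close>, so that the two sums can be
      exchanged.\<close>
    have "(\<Sum>w\<in>carrier G. f (x \<otimes> inv v \<otimes> inv w) * g w)
        = (\<Sum>w\<in>carrier G. f (x \<otimes> inv v \<otimes> inv (w \<otimes> inv v)) * g (w \<otimes> inv v))"
      using v by (subst sum_translate_right[of "inv v", symmetric]) auto
    also have "\<dots> = (\<Sum>w\<in>carrier G. f (x \<otimes> inv w) * g (w \<otimes> inv v))"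
    proof (rule sum.cong[OF refl])
      fix w assume w: "w \<in> carrier G"
      have "x \<otimes> inv v \<otimes> inv (w \<otimes> inv v) = x \<otimes> inv w"
        using x v w by (simp add: inv_mult_group m_assoc) (simp add: m_assoc[symmetric])
      then show "f (x \<otimes> inv v \<otimes> inv (w \<otimes> inv v)) * g (w \<otimes> inv v)
          = f (x \<otimes> inv w) * g (w \<otimes> inv v)"
        by simp
    qed
    finally show "(\<Sum>w\<in>carrier G. f (x \<otimes> inv v \<otimes> inv w) * g w) * h v
        = (\<Sum>w\<in>carrier G. f (x \<otimes> inv w) * g (w \<otimes> inv v) * h v)"
      by (simp add: sum_distrib_right)
  qed
  also have "\<dots> = (\<Sum>w\<in>carrier G. f (x \<otimes> inv w) * conv G g h w)"
    by (subst sum.swap) (auto simp: conv_apply sum_distrib_left mult.assoc intro!: sum.cong)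
  finally show "conv G (conv G f g) h x = conv G f (conv G g h) x"
    using x by (simp add: conv_apply)
qed

lemma conv_delta_right_apply:
  assumes "a \<in> carrier G" "x \<in> carrier G"
  shows "conv G f (delta a) x = f (x \<otimes> inv a)"
proof -
  have "conv G f (delta a) x = (\<Sum>v\<in>carrier G. if v = a then f (x \<otimes> inv v) else 0)"
    using assms by (auto simp: conv_apply delta_def intro!: sum.cong)
  then show ?thesis using assms finite_carrier by simp
qed

lemma conv_delta_one_right: "f \<in> vanishing_off (carrier G) \<Longrightarrow> conv G f (delta \<one>) = f"
  by (rule ext, case_tac "x \<in> carrier G")
     (auto simp: conv_delta_right_apply conv_outside vanishing_offD)

lemma conv_delta_delta:
  assumes "a \<in> carrier G" "b \<in> carrier G"
  shows "conv G (delta a) (delta b) = delta (a \<otimes> b)"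
proof
  fix x
  show "conv G (delta a) (delta b) x = delta (a \<otimes> b) x"
  proof (cases "x \<in> carrier G")
    case True
    then have "x \<otimes> inv b = a \<longleftrightarrow> x = a \<otimes> b"
      using assms by (auto simp: inv_solve_right m_assoc)
    with True show ?thesis using assms by (simp add: conv_delta_right_apply) (simp add: delta_def)
  qed (use assms in \<open>auto simp: conv_outside delta_def\<close>)
qed

lemma conv_delta_left_apply:
  assumes "a \<in> carrier G" "x \<in> carrier G"
  shows "conv G (delta a) f x = f (inv a \<otimes> x)"
proof -
  have "conv G (delta a) f x = (\<Sum>v\<in>carrier G. if v = inv a \<otimes> x then f v else 0)"
  proof -
    have "x \<otimes> inv v = a \<longleftrightarrow> v = inv a \<otimes> x" if "v \<in> carrier G" for v
    proof
      assume "x \<otimes> inv v = a"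
      then have "a \<otimes> v = x" using assms(2) that by (auto simp: m_assoc)
      then show "v = inv a \<otimes> x" using assms that by (auto simp: m_assoc[symmetric])
    next
      assume "v = inv a \<otimes> x"
      then have "x = a \<otimes> v" using assms by (auto simp: m_assoc[symmetric])
      then show "x \<otimes> inv v = a" using assms that by (auto simp: m_assoc)
    qed
    then show ?thesis using assms by (auto simp: conv_apply delta_def intro!: sum.cong)
  qed
  then show ?thesis using assms finite_carrier by simp
qed

lemma conv_delta_one_left: "f \<in> vanishing_off (carrier G) \<Longrightarrow> conv G (delta \<one>) f = f"
  by (rule ext, case_tac "x \<in> carrier G")
     (auto simp: conv_delta_left_apply conv_outside vanishing_offD)

lemma ring_group_algebra: "ring (group_algebra G)"
proof (rule ringI)
  show "abelian_group (group_algebra G)"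
  proof (rule abelian_groupI)
    show "\<exists>y\<in>carrier (group_algebra G). y \<oplus>\<^bsub>group_algebra G\<^esub> x = \<zero>\<^bsub>group_algebra G\<^esub>"
      if "x \<in> carrier (group_algebra G)" for x
      by (rule bexI[of _ "- x"]) (use that in \<open>auto simp: group_algebra_def vanishing_off_def\<close>)
  qed (auto simp: group_algebra_def algebra_simps)
  show "monoid (group_algebra G)"
    using conv_outside conv_delta_one_left conv_delta_one_right
    by (intro monoidI) (auto simp: group_algebra_def conv_assoc delta_def vanishing_off_def)
qed (auto simp: group_algebra_def conv_add_left conv_add_right)

lemma conv_expand:
  assumes "S \<subseteq> carrier G" "a \<in> vanishing_off S"
  shows "conv G f a = (\<Sum>u\<in>S. cscale (a u) (conv G f (delta u)))"
proof -
  have "finite S" using assms(1) finite_carrier finite_subset by blast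
  then have "conv G f a = conv G f (\<Sum>u\<in>S. cscale (a u) (delta u))"
    using vanishing_off_expand assms(2) by metis
  then show ?thesis by (simp add: conv_sum_right conv_cscale_right)
qed

end

section \<open>Right submodules over a subgroup algebra\<close>

locale finite_group_subgroup = finite_group G + U: subgroup U G
  for G :: "('g, 'b) monoid_scheme" (structure) and U
begin

abbreviation GU where "GU \<equiv> G\<lparr>carrier := U\<rparr>"

lemma finite_U: "finite U"
  using finite_carrier U.subset finite_subset by blast

lemma U_carrier: "u \<in> U \<Longrightarrow> u \<in> carrier G"
  using U.subset by blast

lemma finite_group_GU: "finite_group GU"
  by (intro finite_group.intro finite_group_axioms.intro subgroup_imp_group U.subgroup_axioms)
     (simp add: finite_U)

lemma inv_GU: "u \<in> U \<Longrightarrow> inv\<^bsub>GU\<^esub> u = inv u"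
  using m_inv_consistent[OF U.subgroup_axioms] by simp

text \<open>The pairs outside \<open>U\<close> contribute nothing to the larger sum. Hence
  \<open>CU\<close> can be handled inside the group algebra of \<open>G\<close>, where the vectors
  of the permutation module live as well.\<close>

lemma conv_GU:
  assumes "f \<in> vanishing_off U" "h \<in> vanishing_off U"
  shows "conv GU f h = conv G f h"
proof
  fix x
  let ?A = "{(u, v) \<in> U \<times> U. u \<otimes> v = x}" and ?B = "{(u, v) \<in> carrier G \<times> carrier G. u \<otimes> v = x}"
  have "finite ?B"
    by (rule finite_subset[of _ "carrier G \<times> carrier G"]) (auto simp: finite_carrier)
  then have "(\<Sum>(u, v)\<in>?A. f u * h v) = (\<Sum>(u, v)\<in>?B. f u * h v)"
    using assms by (intro sum.mono_neutral_left) (auto simp: vanishing_off_def U_carrier)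
  then show "conv GU f h x = conv G f h x"
    by (simp add: conv_def)
qed

lemma conv_U_vanishing_off:
  assumes "f \<in> vanishing_off U" "h \<in> vanishing_off U"
  shows "conv G f h \<in> vanishing_off U"
  using finite_group.conv_vanishing_off[OF finite_group_GU, of f h] conv_GU[OF assms] by simp

lemma ring_GU: "ring (group_algebra GU)"
  by (rule finite_group.ring_group_algebra[OF finite_group_GU])

lemma delta_U: "u \<in> U \<Longrightarrow> delta u \<in> vanishing_off U"
  by (rule vanishing_off_delta)

text \<open>The ambient space is the algebra of \<open>G\<close>, not that of \<open>U\<close>,
  because the permutation module consists of functions on all of \<open>GL n\<close>. Closure under
  scalars comes from the action of multiples of \<open>delta \<one>\<close>.\<close>

definition right_stable :: "('g \<Rightarrow> complex) set \<Rightarrow> bool" where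
  "right_stable N \<longleftrightarrow> N \<subseteq> vanishing_off (carrier G) \<and> 0 \<in> N \<and> (\<forall>x\<in>N. \<forall>y\<in>N. x + y \<in> N) \<and>
     (\<forall>x\<in>N. \<forall>a\<in>vanishing_off U. conv G x a \<in> N)"

lemma right_stable_cscale:
  assumes "right_stable N" "x \<in> N"
  shows "cscale c x \<in> N"
proof -
  have "cscale c x = conv G x (cscale c (delta \<one>))"
    using assms by (subst conv_cscale_right, subst conv_delta_one_right) (auto simp: right_stable_def)
  moreover have "cscale c (delta \<one>) \<in> vanishing_off U"
    by (intro vanishing_off_cscale delta_U) simp
  ultimately show ?thesis using assms unfolding right_stable_def by metis
qed

lemma right_stable_sum:
  assumes "right_stable N" "\<And>i. i \<in> I \<Longrightarrow> f i \<in> N"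
  shows "(\<Sum>i\<in>I. f i) \<in> N"
  using assms(2) by (induction I rule: infinite_finite_induct) (use assms(1) in \<open>auto simp: right_stable_def\<close>)

lemma right_stableI:
  assumes "N \<subseteq> vanishing_off (carrier G)" "0 \<in> N" "\<And>x y. x \<in> N \<Longrightarrow> y \<in> N \<Longrightarrow> x + y \<in> N"
    and "\<And>x c. x \<in> N \<Longrightarrow> cscale c x \<in> N" "\<And>x u. x \<in> N \<Longrightarrow> u \<in> U \<Longrightarrow> conv G x (delta u) \<in> N"
  shows "right_stable N"
proof -
  have sum: "(\<Sum>i\<in>I. f i) \<in> N" if "\<And>i. i \<in> I \<Longrightarrow> f i \<in> N" for f :: "'g \<Rightarrow> 'g \<Rightarrow> complex" and I
    using that by (induction I rule: infinite_finite_induct) (use assms in auto)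
  have "conv G x a \<in> N" if "x \<in> N" "a \<in> vanishing_off U" for x a
    using that by (subst conv_expand[OF U.subset]) (auto intro!: sum assms)
  then show ?thesis using assms by (auto simp: right_stable_def)
qed

lemma abelian_group_conv_module:
  assumes "right_stable N"
  shows "abelian_group (conv_module G N)"
proof (rule abelian_groupI)
  show "\<exists>y\<in>carrier (conv_module G N). y \<oplus>\<^bsub>conv_module G N\<^esub> x = \<zero>\<^bsub>conv_module G N\<^esub>"
    if "x \<in> carrier (conv_module G N)" for x
    using right_stable_cscale[OF assms, of x "-1"] that
    by (intro bexI[of _ "- x"]) (auto simp: conv_module_def uminus_eq_cscale[symmetric])
qed (use assms in \<open>auto simp: conv_module_def right_stable_def algebra_simps\<close>)

lemma right_module_conv_module:
  assumes "right_stable N"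
  shows "right_module (group_algebra GU) (conv_module G N)"
proof -
  have sm: "a \<odot>\<^bsub>conv_module G N\<^esub> x = conv G x a" for a x by (simp add: conv_module_def)
  have c: "carrier (conv_module G N) = N" by (simp add: conv_module_def)
  have add: "x \<oplus>\<^bsub>conv_module G N\<^esub> y = x + y" for x y by (simp add: conv_module_def)
  have mult: "a \<otimes>\<^bsub>group_algebra GU\<^esub> b = conv G a b"
    if "a \<in> vanishing_off U" "b \<in> vanishing_off U" for a b
    using conv_GU[OF that] by (simp add: group_algebra_def)
  have add': "a \<oplus>\<^bsub>group_algebra GU\<^esub> b = a + b" for a b by (simp add: group_algebra_def)
  have one: "\<one>\<^bsub>group_algebra GU\<^esub> = delta \<one>" by (simp add: group_algebra_def)
  show ?thesis
    unfolding right_module_def right_module_axioms_def sm c carrier_group_algebra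
    using ring_GU abelian_group_conv_module[OF assms] assms
    by (auto simp: mult one conv_assoc right_stable_def conv_add_right conv_add_left add add'
        conv_delta_one_right subset_iff)
qed

end

section \<open>Isomorphisms of right modules\<close>

lemma right_module_isomorphic_sym:
  assumes "right_module_isomorphic R M N"
  shows "right_module_isomorphic R N M"
proof -
  from assms obtain f where M: "right_module R M" and N: "right_module R N"
    and bij: "bij_betw f (carrier M) (carrier N)"
    and add: "\<And>x y. x \<in> carrier M \<Longrightarrow> y \<in> carrier M \<Longrightarrow> f (x \<oplus>\<^bsub>M\<^esub> y) = f x \<oplus>\<^bsub>N\<^esub> f y"
    and sm: "\<And>a x. a \<in> carrier R \<Longrightarrow> x \<in> carrier M \<Longrightarrow> f (a \<odot>\<^bsub>M\<^esub> x) = a \<odot>\<^bsub>N\<^esub> f x"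
    unfolding right_module_isomorphic_def by blast
  interpret M: right_module R M by fact
  let ?g = "inv_into (carrier M) f"
  have inv: "?g x \<in> carrier M" "f (?g x) = x" if "x \<in> carrier N" for x
    using that bij by (metis bij_betw_imp_surj_on inv_into_into, metis bij_betw_inv_into_right)
  have left: "?g (f x) = x" if "x \<in> carrier M" for x
    using that bij by (metis bij_betw_inv_into_left)
  have "?g (x \<oplus>\<^bsub>N\<^esub> y) = ?g x \<oplus>\<^bsub>M\<^esub> ?g y" if "x \<in> carrier N" "y \<in> carrier N" for x y
  proof -
    have "x \<oplus>\<^bsub>N\<^esub> y = f (?g x \<oplus>\<^bsub>M\<^esub> ?g y)" using that by (simp add: add inv)
    then show ?thesis using that by (simp add: left inv)
  qed
  moreover have "?g (a \<odot>\<^bsub>N\<^esub> x) = a \<odot>\<^bsub>M\<^esub> ?g x" if "a \<in> carrier R" "x \<in> carrier N" for a x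
  proof -
    have "a \<odot>\<^bsub>N\<^esub> x = f (a \<odot>\<^bsub>M\<^esub> ?g x)" using that by (simp add: sm inv)
    then show ?thesis using that by (simp add: left inv M.smult_closed)
  qed
  ultimately show ?thesis
    unfolding right_module_isomorphic_def using M N bij_betw_inv_into[OF bij] by blast
qed

lemma right_module_isomorphic_trans:
  assumes "right_module_isomorphic R M N" "right_module_isomorphic R N P"
  shows "right_module_isomorphic R M P"
proof -
  from assms(1) obtain f where M: "right_module R M"
    and f: "bij_betw f (carrier M) (carrier N)"
      "\<forall>x\<in>carrier M. \<forall>y\<in>carrier M. f (x \<oplus>\<^bsub>M\<^esub> y) = f x \<oplus>\<^bsub>N\<^esub> f y"
      "\<forall>a\<in>carrier R. \<forall>x\<in>carrier M. f (a \<odot>\<^bsub>M\<^esub> x) = a \<odot>\<^bsub>N\<^esub> f x"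
    unfolding right_module_isomorphic_def by blast
  from assms(2) obtain g where P: "right_module R P"
    and g: "bij_betw g (carrier N) (carrier P)"
      "\<forall>x\<in>carrier N. \<forall>y\<in>carrier N. g (x \<oplus>\<^bsub>N\<^esub> y) = g x \<oplus>\<^bsub>P\<^esub> g y"
      "\<forall>a\<in>carrier R. \<forall>x\<in>carrier N. g (a \<odot>\<^bsub>N\<^esub> x) = a \<odot>\<^bsub>P\<^esub> g x"
    unfolding right_module_isomorphic_def by blast
  have "f x \<in> carrier N" if "x \<in> carrier M" for x
    using bij_betwE[OF f(1)] that by blast
  then have "(\<forall>x\<in>carrier M. \<forall>y\<in>carrier M. (g \<circ> f) (x \<oplus>\<^bsub>M\<^esub> y) = (g \<circ> f) x \<oplus>\<^bsub>P\<^esub> (g \<circ> f) y)"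
    "(\<forall>a\<in>carrier R. \<forall>x\<in>carrier M. (g \<circ> f) (a \<odot>\<^bsub>M\<^esub> x) = a \<odot>\<^bsub>P\<^esub> (g \<circ> f) x)"
    using f g by simp_all
  with M P bij_betw_trans[OF f(1) g(1)] show ?thesis
    unfolding right_module_isomorphic_def by blast
qed

text \<open>This yields the module axioms for the induced module from those of an ideal, without
  checking them in the function model.\<close>

lemma right_module_transport:
  assumes M: "right_module R M" and bij: "bij_betw f (carrier M) (carrier N)"
    and add: "\<And>x y. x \<in> carrier M \<Longrightarrow> y \<in> carrier M \<Longrightarrow> f (x \<oplus>\<^bsub>M\<^esub> y) = f x \<oplus>\<^bsub>N\<^esub> f y"
    and sm: "\<And>a x. a \<in> carrier R \<Longrightarrow> x \<in> carrier M \<Longrightarrow> f (a \<odot>\<^bsub>M\<^esub> x) = a \<odot>\<^bsub>N\<^esub> f x"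
    and zero: "f \<zero>\<^bsub>M\<^esub> = \<zero>\<^bsub>N\<^esub>"
  shows "right_module R N"
proof -
  interpret M: right_module R M by fact
  have N: "carrier N = f ` carrier M" using bij by (simp add: bij_betw_def)
  have "abelian_group N"
  proof (rule abelian_groupI)
    show "\<exists>y\<in>carrier N. y \<oplus>\<^bsub>N\<^esub> x = \<zero>\<^bsub>N\<^esub>" if "x \<in> carrier N" for x
    proof -
      from that obtain x' where x': "x' \<in> carrier M" "x = f x'" by (auto simp: N)
      have "f (\<ominus>\<^bsub>M\<^esub> x') \<oplus>\<^bsub>N\<^esub> x = \<zero>\<^bsub>N\<^esub>"
        using x' by (simp add: add[symmetric] M.M.l_neg zero)
      then show ?thesis using x' by (auto simp: N)
    qed
  qed (auto simp: N add[symmetric] zero[symmetric] M.M.a_ac)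
  then show ?thesis
    unfolding right_module_def right_module_axioms_def
    using M.R.ring_axioms
    by (auto simp: N add[symmetric] sm[symmetric] M.smult_closed M.smult_l_distr M.smult_r_distr
        M.smult_assoc M.smult_one)
qed

section \<open>Submodules of a group algebra\<close>

context finite_group_subgroup
begin

lemma submodule_conv_module_iff:
  assumes "right_stable M"
  shows "submodule N (group_algebra GU) (conv_module G M) \<longleftrightarrow> right_stable N \<and> N \<subseteq> M"
proof
  assume N: "right_stable N \<and> N \<subseteq> M"
  interpret abelian_group "conv_module G M" by (rule abelian_group_conv_module[OF assms])
  have "inv\<^bsub>add_monoid (conv_module G M)\<^esub> x \<in> N" if "x \<in> N" for x
  proof -
    have mx: "- x \<in> N" using right_stable_cscale[of N x "-1"] N that by (simp add: uminus_eq_cscale)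
    have "\<ominus>\<^bsub>conv_module G M\<^esub> x = - x"
      using mx that N by (intro minus_equality) (auto simp: conv_module_def)
    then show ?thesis using mx by (simp add: a_inv_def)
  qed
  then show "submodule N (group_algebra GU) (conv_module G M)"
    unfolding submodule_def subgroup_def submodule_axioms_def
    using N by (auto simp: conv_module_def right_stable_def)
next
  assume "submodule N (group_algebra GU) (conv_module G M)"
  then show "right_stable N \<and> N \<subseteq> M"
    unfolding submodule_def subgroup_def submodule_axioms_def
    using assms by (auto simp: conv_module_def right_stable_def)
qed

lemma irreducible_conv_moduleI:
  assumes "right_stable M" "M \<noteq> {0}"
    and "\<And>N. right_stable N \<Longrightarrow> N \<subseteq> M \<Longrightarrow> N = {0} \<or> N = M"
  shows "irreducible_right_module (group_algebra GU) (conv_module G M)"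
  unfolding irreducible_right_module_def
  using assms submodule_conv_module_iff[OF assms(1)] right_module_conv_module[OF assms(1)]
  by (auto simp: conv_module_def)

definition cyc :: "('g \<Rightarrow> complex) \<Rightarrow> ('g \<Rightarrow> complex) set" where
  "cyc y = {conv G y a | a. a \<in> vanishing_off U}"

lemma right_stable_cyc: "right_stable (cyc y)"
proof -
  have "\<exists>c. conv G y a + conv G y b = conv G y c \<and> c \<in> vanishing_off U"
    if "a \<in> vanishing_off U" "b \<in> vanishing_off U" for a b
    using that by (intro exI[of _ "a + b"]) (simp add: conv_add_right vanishing_off_add)
  moreover have "\<exists>c. conv G (conv G y a) b = conv G y c \<and> c \<in> vanishing_off U"
    if "a \<in> vanishing_off U" "b \<in> vanishing_off U" for a b
    using that by (intro exI[of _ "conv G a b"]) (simp add: conv_assoc conv_U_vanishing_off)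
  moreover have "\<exists>a. 0 = conv G y a \<and> a \<in> vanishing_off U"
    by (intro exI[of _ 0]) simp
  ultimately show ?thesis
    unfolding right_stable_def cyc_def using conv_vanishing_off by auto
qed

lemma mem_cyc: "y \<in> vanishing_off (carrier G) \<Longrightarrow> y \<in> cyc y"
  unfolding cyc_def using conv_delta_one_right[of y] delta_U[of \<one>] by force

lemma cyc_subset: "right_stable N \<Longrightarrow> y \<in> N \<Longrightarrow> cyc y \<subseteq> N"
  by (auto simp: cyc_def right_stable_def)

lemma cyc_eqI: "x \<in> cyc y \<Longrightarrow> y \<in> cyc x \<Longrightarrow> cyc x = cyc y"
  by (meson cyc_subset right_stable_cyc subset_antisym)

end

section \<open>The idempotent of a linear character of a subgroup\<close>

locale character_idempotent = finite_group_subgroup + H: subgroup H G for H +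
  fixes \<psi> :: "'a \<Rightarrow> complex"
  assumes H_subset: "H \<subseteq> U"
    and \<psi>_mult: "\<And>g h. g \<in> H \<Longrightarrow> h \<in> H \<Longrightarrow> \<psi> (g \<otimes> h) = \<psi> g * \<psi> h"
    and \<psi>_one: "\<psi> \<one> = 1"
    and \<psi>_cnj: "\<And>h. h \<in> H \<Longrightarrow> cnj (\<psi> h) = \<psi> (inv h)"
begin

definition eps :: "'a \<Rightarrow> complex" where
  "eps = (\<lambda>u. if u \<in> H then \<psi> (inv u) / of_nat (card H) else 0)"

lemma H_carrier: "h \<in> H \<Longrightarrow> h \<in> carrier G"
  using H.subset by blast

lemma finite_H: "finite H"
  using H_subset finite_U finite_subset by blast

lemma card_H_nonzero: "card H \<noteq> 0"
  using finite_H H.one_closed by (metis card_0_eq empty_iff)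

lemma \<psi>_inv: "h \<in> H \<Longrightarrow> \<psi> (inv h) * \<psi> h = 1"
  using \<psi>_mult[of "inv h" h] \<psi>_one H.subset by auto

lemma eps_vanishing_off_H: "eps \<in> vanishing_off H"
  by (simp add: eps_def vanishing_off_def)

lemma eps_vanishing_off: "eps \<in> vanishing_off U"
  using eps_vanishing_off_H H_subset vanishing_off_mono by blast

lemma eps_nonzero: "eps \<noteq> 0"
proof
  assume "eps = 0"
  then have "eps \<one> = 0" by simp
  then show False using card_H_nonzero \<psi>_one by (simp add: eps_def)
qed

lemma eps_sum: "eps = (\<Sum>h\<in>H. cscale (\<psi> (inv h) / of_nat (card H)) (delta h))"
  using vanishing_off_expand[OF finite_H eps_vanishing_off_H] by (simp add: eps_def)

lemma delta_eps:
  assumes "h \<in> H"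
  shows "conv G (delta h) eps = cscale (\<psi> h) eps"
proof
  fix x
  show "conv G (delta h) eps x = cscale (\<psi> h) eps x"
  proof (cases "x \<in> carrier G")
    case True
    have "inv h \<otimes> x \<in> H \<longleftrightarrow> x \<in> H"
    proof
      assume "inv h \<otimes> x \<in> H"
      then have "h \<otimes> (inv h \<otimes> x) \<in> H" using assms by blast
      then show "x \<in> H" using True assms H_carrier by (simp add: m_assoc[symmetric])
    qed (use assms in blast)
    moreover have "\<psi> (inv (inv h \<otimes> x)) = \<psi> h * \<psi> (inv x)" if "x \<in> H"
      using that assms H_carrier by (simp add: inv_mult_group \<psi>_mult)
    ultimately show ?thesis
      using True assms H_carrier by (simp add: conv_delta_left_apply) (simp add: eps_def cscale_def)
  next
    case False
    then show ?thesis using H_carrier by (auto simp: conv_outside cscale_def eps_def)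
  qed
qed

lemma conv_delta_eps: "h \<in> H \<Longrightarrow> conv G (conv G x (delta h)) eps = cscale (\<psi> h) (conv G x eps)"
  by (simp add: conv_assoc delta_eps conv_cscale_right)

lemma conv_eps: "conv G x eps = (\<Sum>h\<in>H. cscale (\<psi> (inv h) / of_nat (card H)) (conv G x (delta h)))"
  by (subst eps_sum) (simp add: conv_sum_right conv_cscale_right)

lemma eps_conv: "conv G eps x = (\<Sum>h\<in>H. cscale (\<psi> (inv h) / of_nat (card H)) (conv G (delta h) x))"
  by (subst eps_sum) (simp add: conv_sum_left conv_cscale_left)

lemma sum_psi_inverse: "(\<Sum>h\<in>H. cscale (\<psi> (inv h) / of_nat (card H)) (cscale (\<psi> h) x)) = x"
proof -
  have "(\<Sum>h\<in>H. cscale (\<psi> (inv h) / of_nat (card H)) (cscale (\<psi> h) x))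
      = (\<Sum>h\<in>H. cscale (1 / of_nat (card H)) x)"
    by (rule sum.cong) (auto simp: \<psi>_inv)
  also have "\<dots> = cscale (\<Sum>h\<in>H. 1 / of_nat (card H)) x"
    by (rule cscale_sum_left[symmetric])
  finally show ?thesis using card_H_nonzero by simp
qed

lemma conv_eps_fixedI:
  "(\<And>h. h \<in> H \<Longrightarrow> conv G x (delta h) = cscale (\<psi> h) x) \<Longrightarrow> conv G x eps = x"
  unfolding conv_eps using sum_psi_inverse[of x] by simp

lemma eps_conv_fixedI:
  "(\<And>h. h \<in> H \<Longrightarrow> conv G (delta h) x = cscale (\<psi> h) x) \<Longrightarrow> conv G eps x = x"
  unfolding eps_conv using sum_psi_inverse[of x] by simp

lemma eps_eps: "conv G eps eps = eps"
  by (rule eps_conv_fixedI) (rule delta_eps)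

definition eps_ideal :: "('a \<Rightarrow> complex) set" where
  "eps_ideal = {x \<in> vanishing_off U. conv G eps x = x}"

lemma eps_ideal_eq_cyc: "eps_ideal = cyc eps"
proof
  show "eps_ideal \<subseteq> cyc eps" unfolding eps_ideal_def cyc_def by force
  show "cyc eps \<subseteq> eps_ideal" unfolding eps_ideal_def cyc_def
    by (auto simp: conv_assoc[symmetric] eps_eps conv_U_vanishing_off eps_vanishing_off)
qed

lemma right_stable_eps_ideal: "right_stable eps_ideal"
  by (simp add: eps_ideal_eq_cyc right_stable_cyc)

lemma eps_in_ideal: "eps \<in> eps_ideal"
  by (simp add: eps_ideal_def eps_eps eps_vanishing_off)

text \<open>The fixed point equation for \<open>eps\<close> becomes a covariance condition under
  left translation by \<open>H\<close>, the form in which it can be matched with the function model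
  of the induced module.\<close>

lemma eps_ideal_iff:
  "x \<in> eps_ideal \<longleftrightarrow> x \<in> vanishing_off U \<and> (\<forall>h\<in>H. \<forall>v\<in>U. x (h \<otimes> v) = \<psi> (inv h) * x v)"
proof (intro iffI conjI ballI)
  assume x: "x \<in> eps_ideal"
  then show "x \<in> vanishing_off U" by (simp add: eps_ideal_def)
  fix h v assume h: "h \<in> H" and v: "v \<in> U"
  have "x (h \<otimes> v) = conv G (delta (inv h)) x v"
    using h v H_carrier U_carrier by (simp add: conv_delta_left_apply)
  also have "\<dots> = conv G (delta (inv h)) (conv G eps x) v"
    using x by (simp add: eps_ideal_def)
  also have "\<dots> = \<psi> (inv h) * x v"
    using x h by (simp add: conv_assoc[symmetric] delta_eps conv_cscale_left)
      (simp add: eps_ideal_def cscale_def)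
  finally show "x (h \<otimes> v) = \<psi> (inv h) * x v" .
next
  assume x: "x \<in> vanishing_off U \<and> (\<forall>h\<in>H. \<forall>v\<in>U. x (h \<otimes> v) = \<psi> (inv h) * x v)"
  have "conv G (delta h) x = cscale (\<psi> h) x" if h: "h \<in> H" for h
  proof
    fix v
    have hU: "h \<in> U" using h H_subset by blast
    show "conv G (delta h) x v = cscale (\<psi> h) x v"
    proof (cases "v \<in> U")
      case True
      then have "x (inv h \<otimes> v) = \<psi> (inv (inv h)) * x v" using x h by blast
      then show ?thesis using True h H_carrier U_carrier
        by (simp add: conv_delta_left_apply cscale_def)
    next
      case False
      have "conv G (delta h) x \<in> vanishing_off U"
        using x hU by (intro conv_U_vanishing_off delta_U) auto
      then show ?thesis using False x by (auto simp: vanishing_offD cscale_def)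
    qed
  qed
  then have "conv G eps x = x" by (rule eps_conv_fixedI)
  then show "x \<in> eps_ideal" using x by (simp add: eps_ideal_def)
qed

text \<open>The conjugate-linear anti-automorphism of \<open>CU\<close> inverting group elements. It
  serves as an adjoint and replaces a complement argument in the proof of irreducibility.\<close>

definition star :: "('a \<Rightarrow> complex) \<Rightarrow> 'a \<Rightarrow> complex" where
  "star x = (\<lambda>g. if g \<in> U then cnj (x (inv g)) else 0)"

text \<open>Because \<open>\<psi>\<close> is unitary, \<open>eps\<close> is its own adjoint, so
  \<open>eps * x = x\<close> turns into its mirror image.\<close>

lemma star_eps:
  assumes x: "x \<in> eps_ideal"
  shows "conv G (star x) eps = star x"
proof (rule conv_eps_fixedI)
  fix h assume h: "h \<in> H"
  have hU: "h \<in> U" using h H_subset by blast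
  have sx: "star x \<in> vanishing_off U" by (simp add: star_def vanishing_off_def)
  show "conv G (star x) (delta h) = cscale (\<psi> h) (star x)"
  proof
    fix v
    show "conv G (star x) (delta h) v = cscale (\<psi> h) (star x) v"
    proof (cases "v \<in> U")
      case True
      have "x (h \<otimes> inv v) = \<psi> (inv h) * x (inv v)"
        using x h True by (auto simp: eps_ideal_iff)
      moreover have "cnj (\<psi> (inv h)) = \<psi> h" using \<psi>_cnj[of "inv h"] h H_carrier by simp
      ultimately have "cnj (x (inv (v \<otimes> inv h))) = \<psi> h * cnj (x (inv v))"
        using True h H_carrier U_carrier by (simp add: inv_mult_group)
      then show ?thesis using True hU U_carrier
        by (simp add: conv_delta_right_apply) (simp add: star_def cscale_def)
    next
      case False
      have "conv G (star x) (delta h) \<in> vanishing_off U"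
        using sx hU by (intro conv_U_vanishing_off delta_U) auto
      then show ?thesis using False sx by (simp add: vanishing_offD cscale_def)
    qed
  qed
qed

text \<open>At the unit, \<open>x * star x\<close> takes the sum of the squared moduli of the values
  of \<open>x\<close>.\<close>

lemma conv_star_eq_0:
  assumes x: "x \<in> vanishing_off U" and 0: "conv G x (star x) = 0"
  shows "x = 0"
proof -
  have "(0::complex) = conv G x (star x) \<one>" using 0 by simp
  also have "\<dots> = (\<Sum>v\<in>carrier G. x (inv v) * star x v)"
    by (simp add: conv_apply)
  also have "\<dots> = (\<Sum>v\<in>carrier G. complex_of_real ((cmod (x (inv v)))\<^sup>2))"
  proof (rule sum.cong[OF refl])
    fix v assume v: "v \<in> carrier G"
    show "x (inv v) * star x v = complex_of_real ((cmod (x (inv v)))\<^sup>2)"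
    proof (cases "v \<in> U")
      case False
      then have "inv v \<notin> U" using v U.m_inv_closed[of "inv v"] by auto
      then show ?thesis using x by (simp add: star_def vanishing_offD)
    qed (simp add: star_def complex_norm_square del: of_real_power)
  qed
  finally have "(\<Sum>v\<in>carrier G. (cmod (x (inv v)))\<^sup>2) = 0"
    by (metis of_real_eq_0_iff of_real_sum)
  then have "\<forall>v\<in>carrier G. x (inv v) = 0"
    by (simp add: sum_nonneg_eq_0_iff finite_carrier)
  then have "x v = 0" if "v \<in> U" for v using that U_carrier by (metis inv_closed inv_inv)
  then show ?thesis using x by (auto simp: vanishing_off_def fun_eq_iff)
qed

end

section \<open>Irreducibility of the ideal generated by the idempotent\<close>

context character_idempotent
begin

text \<open>The multipliers of single group elements combine linearly, which extends the scalar
  property from \<open>U\<close> to its group algebra.\<close>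

lemma conv_vanishing_off_eps:
  assumes "\<And>u. u \<in> U \<Longrightarrow> \<exists>c. conv G (conv G y (delta u)) eps = cscale c (conv G y eps)"
    and "a \<in> vanishing_off U"
  shows "\<exists>c. conv G (conv G y a) eps = cscale c (conv G y eps)"
proof -
  from assms(1) obtain c where c: "\<And>u. u \<in> U \<Longrightarrow>
    conv G (conv G y (delta u)) eps = cscale (c u) (conv G y eps)"
    by metis
  have "conv G (conv G y a) eps = (\<Sum>u\<in>U. cscale (a u) (conv G (conv G y (delta u)) eps))"
    by (subst conv_expand[OF U.subset assms(2)]) (simp add: conv_sum_left conv_cscale_left)
  also have "\<dots> = (\<Sum>u\<in>U. cscale (a u * c u) (conv G y eps))"
    by (rule sum.cong) (auto simp: c)
  also have "\<dots> = cscale (\<Sum>u\<in>U. a u * c u) (conv G y eps)"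
    by (rule cscale_sum_left[symmetric])
  finally show ?thesis by blast
qed

text \<open>
  If \<open>N\<close> is a proper submodule, then \<open>N * eps = 0\<close>; since \<open>star x * eps = star x\<close>, this
  forces \<open>x * star x = 0\<close> for all \<open>x\<close> in \<open>N\<close>.
\<close>

lemma eps_ideal_irreducible:
  assumes scal: "\<And>u. u \<in> U \<Longrightarrow> \<exists>c. conv G (conv G eps (delta u)) eps = cscale c eps"
    and N: "right_stable N" "N \<subseteq> eps_ideal"
  shows "N = {0} \<or> N = eps_ideal"
proof (cases "\<exists>x\<in>N. conv G x eps \<noteq> 0")
  case True
  then obtain x where x: "x \<in> N" "conv G x eps \<noteq> 0" by blast
  have "x \<in> vanishing_off U" "conv G eps x = x" using x N by (auto simp: eps_ideal_def)
  then obtain c where c: "conv G x eps = cscale c eps"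
    using conv_vanishing_off_eps[of eps x] scal by (auto simp: eps_eps)
  then have "c \<noteq> 0" using x by auto
  have "conv G x eps \<in> N" using x N eps_vanishing_off by (auto simp: right_stable_def)
  then have "cscale (1 / c) (conv G x eps) \<in> N" by (rule right_stable_cscale[OF N(1)])
  then have "eps \<in> N" using c \<open>c \<noteq> 0\<close> by simp
  then have "eps_ideal \<subseteq> N" using cyc_subset[OF N(1)] eps_ideal_eq_cyc by simp
  then show ?thesis using N by blast
next
  case False
  have "x = 0" if x: "x \<in> N" for x
  proof (rule conv_star_eq_0)
    have sx: "star x \<in> vanishing_off U" by (simp add: star_def vanishing_off_def)
    show "x \<in> vanishing_off U" using x N by (auto simp: eps_ideal_def)
    have "conv G x (star x) \<in> N" using x N sx by (auto simp: right_stable_def)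
    then have "conv G (conv G x (star x)) eps = 0" using False by blast
    then show "conv G x (star x) = 0" using x N star_eps by (auto simp: conv_assoc)
  qed
  then show ?thesis using N by (auto simp: right_stable_def)
qed

end

text \<open>The assumption says that \<open>eps CU eps\<close> is the line spanned by
  \<open>eps\<close>; it is the hypothesis of \<open>eps_ideal_irreducible\<close>.\<close>

locale irreducible_character_idempotent = character_idempotent +
  assumes scalar_eps: "\<And>u. u \<in> U \<Longrightarrow> \<exists>c. conv G (conv G eps (delta u)) eps = cscale c eps"
begin

text \<open>Left multiplication by \<open>y\<close> is a homomorphism on \<open>eps_ideal\<close>.
  Its kernel is a submodule missing \<open>eps\<close>, since \<open>y * eps = y\<close> is nonzero,
  and so it is zero by irreducibility. Submodules of \<open>cyc y\<close> are then recovered from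
  their preimages. Since \<open>y\<close> may be any function on \<open>G\<close>, this covers both
  \<open>a * eps\<close> and the vector \<open>b * eps\<close> of the permutation module.\<close>

lemma
  assumes y: "y \<in> vanishing_off (carrier G)" "conv G y eps = y" "y \<noteq> 0"
  shows conv_left_bij: "bij_betw (conv G y) eps_ideal (cyc y)"
    and cyc_irreducible: "irreducible_right_module (group_algebra GU) (conv_module G (cyc y))"
    and cyc_isomorphic_eps_ideal:
      "right_module_isomorphic (group_algebra GU) (conv_module G (cyc y)) (conv_module G eps_ideal)"
proof -
  have pre: "right_stable {x \<in> eps_ideal. conv G y x \<in> N}" if "right_stable N" for N
    using that right_stable_eps_ideal
    by (auto simp: right_stable_def conv_add_right conv_assoc[symmetric])
  have ker: "{x \<in> eps_ideal. conv G y x = 0} = {0}"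
  proof -
    have "right_stable {0}" by (simp add: right_stable_def)
    from pre[OF this] have "{x \<in> eps_ideal. conv G y x = 0} = {0}
        \<or> {x \<in> eps_ideal. conv G y x = 0} = eps_ideal"
      by (intro eps_ideal_irreducible scalar_eps) auto
    moreover have "eps \<notin> {x \<in> eps_ideal. conv G y x = 0}" using y by auto
    ultimately show ?thesis using eps_in_ideal by blast
  qed
  have inj: "inj_on (conv G y) eps_ideal"
  proof (rule inj_onI)
    fix x x' assume x: "x \<in> eps_ideal" "x' \<in> eps_ideal" and eq: "conv G y x = conv G y x'"
    have "x + cscale (-1) x' \<in> eps_ideal"
      using x right_stable_eps_ideal right_stable_cscale[OF right_stable_eps_ideal]
      by (auto simp: right_stable_def)
    then have "x - x' \<in> eps_ideal" by (simp add: uminus_eq_cscale[symmetric])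
    moreover have "conv G y (x - x') = 0" using eq by (simp add: conv_diff_right)
    ultimately have "x - x' = 0" using ker by blast
    then show "x = x'" by simp
  qed
  have im: "conv G y ` eps_ideal = cyc y"
  proof
    show "conv G y ` eps_ideal \<subseteq> cyc y" by (auto simp: cyc_def eps_ideal_def)
    show "cyc y \<subseteq> conv G y ` eps_ideal"
    proof
      fix z assume "z \<in> cyc y"
      then obtain a where a: "z = conv G y a" "a \<in> vanishing_off U" by (auto simp: cyc_def)
      \<comment> \<open>Since \<open>y * eps = y\<close>, the factor \<open>a\<close> may be
        replaced by \<open>eps * a\<close>, which lies in the ideal.\<close>
      then have "z = conv G y (conv G eps a)" using y by (simp add: conv_assoc[symmetric])
      moreover have "conv G eps a \<in> eps_ideal" using a eps_ideal_eq_cyc by (auto simp: cyc_def)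
      ultimately show "z \<in> conv G y ` eps_ideal" by blast
    qed
  qed
  show bij: "bij_betw (conv G y) eps_ideal (cyc y)" using inj im by (simp add: bij_betw_def)
  have "right_module_isomorphic (group_algebra GU) (conv_module G eps_ideal) (conv_module G (cyc y))"
    unfolding right_module_isomorphic_def
    using bij right_module_conv_module[OF right_stable_eps_ideal] right_module_conv_module[OF right_stable_cyc]
    by (intro conjI exI[of _ "conv G y"])
       (auto simp: conv_module_def conv_add_right conv_assoc)
  then show "right_module_isomorphic (group_algebra GU) (conv_module G (cyc y)) (conv_module G eps_ideal)"
    by (rule right_module_isomorphic_sym)
  show "irreducible_right_module (group_algebra GU) (conv_module G (cyc y))"
  proof (rule irreducible_conv_moduleI[OF right_stable_cyc])
    show "cyc y \<noteq> {0}" using mem_cyc y by blast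
    fix N assume N: "right_stable N" "N \<subseteq> cyc y"
    have *: "N = conv G y ` {x \<in> eps_ideal. conv G y x \<in> N}" using N im by auto
    have "{x \<in> eps_ideal. conv G y x \<in> N} = {0} \<or> {x \<in> eps_ideal. conv G y x \<in> N} = eps_ideal"
      by (intro eps_ideal_irreducible scalar_eps pre N) auto
    then show "N = {0} \<or> N = cyc y" using * im by force
  qed
qed

end

section \<open>The ideal as an induced module\<close>

context character_idempotent
begin

abbreviation "eps_module \<equiv> conv_module G (cspan {eps})"

abbreviation "Ind \<equiv> induced_module GU H eps_module"

lemma cspan_eps: "cspan {eps} = {cscale c eps | c. True}"
proof -
  interpret vector_space cscale by (rule vector_space_cscale)
  show ?thesis unfolding cspan_def span_singleton by auto
qed

text \<open>The inducing module is the line through \<open>eps\<close>, so a map into it is a scalar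
  function times \<open>eps\<close>; \<open>to_Ind\<close> passes from the scalar function to the
  map.\<close>

definition to_Ind :: "('a \<Rightarrow> complex) \<Rightarrow> 'a \<Rightarrow> 'a \<Rightarrow> complex" where
  "to_Ind x = (\<lambda>g\<in>U. cscale (x g) eps)"

lemma carrier_Ind: "carrier Ind = {f \<in> U \<rightarrow>\<^sub>E cspan {eps}. \<forall>h\<in>H. \<forall>g\<in>U. f (h \<otimes> g) = conv G (f g) (delta (inv h))}"
  using H_subset by (auto simp: induced_module_def conv_module_def inv_GU subset_iff)

text \<open>As \<open>\<psi>\<close> takes commuting values, right translation by \<open>h\<close>
  scales \<open>eps\<close> by the same factor as left translation does in
  \<open>delta_eps\<close>.\<close>

lemma eps_conv_delta: "h \<in> H \<Longrightarrow> conv G eps (delta h) = cscale (\<psi> h) eps"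
proof -
  assume h: "h \<in> H"
  show ?thesis
  proof
    fix x
    show "conv G eps (delta h) x = cscale (\<psi> h) eps x"
    proof (cases "x \<in> carrier G")
      case True
      have "x \<otimes> inv h \<in> H \<longleftrightarrow> x \<in> H"
      proof
        assume "x \<otimes> inv h \<in> H"
        then have "(x \<otimes> inv h) \<otimes> h \<in> H" using h by blast
        then show "x \<in> H" using True h H_carrier by (simp add: m_assoc)
      qed (use h in blast)
      moreover have "\<psi> (inv (x \<otimes> inv h)) = \<psi> h * \<psi> (inv x)" if "x \<in> H"
        using that h H_carrier by (simp add: inv_mult_group \<psi>_mult)
      ultimately show ?thesis
        using True h H_carrier by (simp add: conv_delta_right_apply) (simp add: eps_def cscale_def)
    next
      case False
      then show ?thesis using H_carrier by (auto simp: conv_outside cscale_def eps_def)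
    qed
  qed
qed

lemma finite_group_subgroup_H:
  "finite_group_subgroup G H"
  by unfold_locales

lemma finsum_conv_module:
  assumes "abelian_group (conv_module G N)" "finite I" "\<And>i. i \<in> I \<Longrightarrow> f i \<in> N"
  shows "finsum (conv_module G N) f I = (\<Sum>i\<in>I. f i)"
  using assms(2,3)
proof (induction I rule: finite_induct)
  case empty
  interpret abelian_group "conv_module G N" by fact
  show ?case by (subst finsum_empty) (simp add: conv_module_def)
next
  case (insert i I)
  interpret abelian_group "conv_module G N" by fact
  have "finsum (conv_module G N) f (insert i I) = f i \<oplus>\<^bsub>conv_module G N\<^esub> finsum (conv_module G N) f I"
    using insert by (intro finsum_insert) (auto simp: conv_module_def)
  then show ?case using insert by (simp add: conv_module_def)
qed

lemma right_stable_eps_module: "finite_group_subgroup.right_stable G H (cspan {eps})"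
proof (rule finite_group_subgroup.right_stableI[OF finite_group_subgroup_H])
  show "cspan {eps} \<subseteq> vanishing_off (carrier G)"
    using vanishing_off_mono[OF H.subset eps_vanishing_off_H] by (auto simp: cspan_eps vanishing_off_cscale)
  show "0 \<in> cspan {eps}" unfolding cspan_eps by (rule CollectI) (metis cscale_simps(3))
  show "x + y \<in> cspan {eps}" if "x \<in> cspan {eps}" "y \<in> cspan {eps}" for x y
    using that by (auto simp: cspan_eps cscale_add_left[symmetric])
  show "cscale c x \<in> cspan {eps}" if "x \<in> cspan {eps}" for x c
    using that by (auto simp: cspan_eps)
  show "conv G x (delta u) \<in> cspan {eps}" if "x \<in> cspan {eps}" "u \<in> H" for x u
    using that by (auto simp: cspan_eps conv_cscale_left eps_conv_delta)
qed

lemma eps_ideal_isomorphic_Ind: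
  "right_module_isomorphic (group_algebra GU) (conv_module G eps_ideal) Ind"
proof -
  have ab: "abelian_group eps_module"
    by (rule finite_group_subgroup.abelian_group_conv_module[OF finite_group_subgroup_H right_stable_eps_module])
  have eps1: "eps \<one> \<noteq> 0" using card_H_nonzero \<psi>_one by (simp add: eps_def)
  have eps_inj: "c = d" if "cscale c eps = cscale d eps" for c d
  proof -
    have "c * eps \<one> = d * eps \<one>" using that by (metis cscale_apply)
    then show ?thesis using eps1 by simp
  qed
  have HU: "h \<otimes> u \<in> U" if "h \<in> H" "u \<in> U" for h u using that H_subset by blast
  have inj: "inj_on to_Ind eps_ideal"
  proof (rule inj_onI)
    fix x y assume x: "x \<in> eps_ideal" and y: "y \<in> eps_ideal" and eq: "to_Ind x = to_Ind y"
    show "x = y"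
    proof
      fix g
      show "x g = y g"
      proof (cases "g \<in> U")
        case True
        then have "cscale (x g) eps = cscale (y g) eps" using fun_cong[OF eq, of g] by (simp add: to_Ind_def)
        then show ?thesis by (rule eps_inj)
      qed (use x y in \<open>auto simp: eps_ideal_def vanishing_offD\<close>)
    qed
  qed
  have im: "to_Ind ` eps_ideal = carrier Ind"
  proof (intro subset_antisym subsetI)
    fix f assume "f \<in> to_Ind ` eps_ideal"
    then obtain x where x: "x \<in> eps_ideal" "f = to_Ind x" by blast
    have "f \<in> U \<rightarrow>\<^sub>E cspan {eps}" by (auto simp: x to_Ind_def cspan_eps)
    moreover have "f (h \<otimes> g) = conv G (f g) (delta (inv h))" if "h \<in> H" "g \<in> U" for h g
      using that x HU
      by (auto simp: to_Ind_def conv_cscale_left eps_conv_delta eps_ideal_iff mult.commute)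
    ultimately show "f \<in> carrier Ind" unfolding carrier_Ind by blast
  next
    fix f assume "f \<in> carrier Ind"
    then have f: "f \<in> U \<rightarrow>\<^sub>E cspan {eps}" "\<And>h g. h \<in> H \<Longrightarrow> g \<in> U \<Longrightarrow> f (h \<otimes> g) = conv G (f g) (delta (inv h))"
      by (auto simp: carrier_Ind)
    then have "\<forall>g\<in>U. \<exists>c. f g = cscale c eps" by (auto simp: cspan_eps)
    then obtain c where c: "\<And>g. g \<in> U \<Longrightarrow> f g = cscale (c g) eps" by metis
    define x where "x = (\<lambda>g. if g \<in> U then c g else 0)"
    have "x (h \<otimes> g) = \<psi> (inv h) * x g" if "h \<in> H" "g \<in> U" for h g
    proof -
      have "cscale (c (h \<otimes> g)) eps = cscale (\<psi> (inv h) * c g) eps"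
        using f(2)[OF that] that HU by (simp add: c conv_cscale_left eps_conv_delta mult.commute)
      then show ?thesis using that HU eps_inj by (simp add: x_def)
    qed
    then have "x \<in> eps_ideal" by (auto simp: eps_ideal_iff x_def vanishing_off_def)
    moreover have "f = to_Ind x"
    proof
      fix g show "f g = to_Ind x g"
        using PiE_arb[OF f(1)] by (cases "g \<in> U") (auto simp: to_Ind_def x_def c)
    qed
    ultimately show "f \<in> to_Ind ` eps_ideal" by blast
  qed
  have bij: "bij_betw to_Ind eps_ideal (carrier Ind)" using inj im by (simp add: bij_betw_def)
  have add: "to_Ind (x + y) = to_Ind x \<oplus>\<^bsub>Ind\<^esub> to_Ind y" for x y
    by (auto simp: induced_module_def conv_module_def to_Ind_def cscale_add_left intro!: restrict_ext)
  have sm: "to_Ind (conv G x a) = a \<odot>\<^bsub>Ind\<^esub> to_Ind x"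
    if a: "a \<in> vanishing_off U" and x: "x \<in> eps_ideal" for a x
  proof -
    have e1: "cscale c (delta \<one>) \<in> vanishing_off H" for c
      by (intro vanishing_off_cscale vanishing_off_delta) simp
    have t1: "conv G (to_Ind x (g \<otimes> inv u)) (cscale (a u) (delta \<one>)) = cscale (x (g \<otimes> inv u) * a u) eps"
      if "g \<in> U" "u \<in> U" for g u
    proof -
      have "g \<otimes> inv u \<in> U" using that by blast
      moreover have "conv G eps (delta \<one>) = eps"
        by (rule conv_delta_one_right) (rule vanishing_off_mono[OF U.subset eps_vanishing_off])
      ultimately show ?thesis
        by (simp add: to_Ind_def conv_cscale_left conv_cscale_right mult.commute)
    qed
    \<comment> \<open>The action of \<open>a\<close> adds up the values at
      \<open>g \<otimes> inv u\<close> weighted by \<open>a u\<close>; on coefficients this is the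
      convolution formula \<open>conv_apply\<close>.\<close>
    have "cscale (conv G x a g) eps
        = (\<Oplus>\<^bsub>eps_module\<^esub>u\<in>U. conv G (to_Ind x (g \<otimes> inv\<^bsub>GU\<^esub> u)) (cscale (a u) (delta \<one>)))"
      if g: "g \<in> U" for g
    proof -
      have "(\<Oplus>\<^bsub>eps_module\<^esub>u\<in>U. conv G (to_Ind x (g \<otimes> inv\<^bsub>GU\<^esub> u)) (cscale (a u) (delta \<one>)))
          = (\<Sum>u\<in>U. conv G (to_Ind x (g \<otimes> inv\<^bsub>GU\<^esub> u)) (cscale (a u) (delta \<one>)))"
        using g by (intro finsum_conv_module ab finite_U) (auto simp: t1 cspan_eps inv_GU)
      also have "\<dots> = (\<Sum>u\<in>U. cscale (x (g \<otimes> inv u) * a u) eps)"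
        using g by (intro sum.cong) (auto simp: t1 inv_GU)
      also have "\<dots> = cscale (\<Sum>u\<in>U. x (g \<otimes> inv u) * a u) eps"
        by (rule cscale_sum_left[symmetric])
      also have "(\<Sum>u\<in>U. x (g \<otimes> inv u) * a u) = (\<Sum>u\<in>carrier G. x (g \<otimes> inv u) * a u)"
        using a by (intro sum.mono_neutral_left) (auto simp: finite_carrier vanishing_offD U_carrier)
      also have "\<dots> = conv G x a g" using g U_carrier by (simp add: conv_apply)
      finally show ?thesis by simp
    qed
    then show ?thesis
      by (auto simp: induced_module_def conv_module_def to_Ind_def[of "conv G x a"]
          intro!: restrict_ext)
  qed
  have R: "right_module (group_algebra GU) (conv_module G eps_ideal)"
    by (rule right_module_conv_module[OF right_stable_eps_ideal])
  have "right_module (group_algebra GU) Ind"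
    by (rule right_module_transport[OF R, of to_Ind])
       (use bij add sm in \<open>auto simp: conv_module_def to_Ind_def induced_module_def\<close>)
  then show ?thesis
    unfolding right_module_isomorphic_def using R bij add sm
    by (intro conjI exI[of _ to_Ind]) (auto simp: conv_module_def)
qed

end


section \<open>Multiplicity one inside a cyclic module\<close>

locale multiplicity_one_constituent = character_idempotent +
  fixes a :: "'a \<Rightarrow> complex"
  assumes a_vanishing_off: "a \<in> vanishing_off (carrier G)"
    and a_scalar: "\<And>u. u \<in> U \<Longrightarrow> \<exists>c. conv G (conv G a (delta u)) eps = cscale c (conv G a eps)"
    and a_injective: "\<And>x. x \<in> eps_ideal \<Longrightarrow> conv G a x = 0 \<Longrightarrow> x = 0"
begin

text \<open>Bracketing \<open>a * (eps * u * eps)\<close> as \<open>(a * (eps * u)) * eps\<close>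
  makes \<open>a_scalar\<close> applicable. The difference of \<open>eps * u * eps\<close> and the
  resulting multiple of \<open>eps\<close> lies in the ideal and is annihilated by \<open>a\<close>,
  hence is zero.\<close>

sublocale irreducible_character_idempotent
proof unfold_locales
  fix u assume u: "u \<in> U"
  let ?x = "conv G (conv G eps (delta u)) eps"
  have x: "?x \<in> eps_ideal"
    by (simp add: eps_ideal_def conv_U_vanishing_off eps_vanishing_off delta_U u conv_assoc[symmetric] eps_eps)
  have "conv G (conv G a (conv G eps (delta u))) eps = conv G a ?x" by (simp add: conv_assoc)
  then obtain c where "conv G a ?x = cscale c (conv G a eps)"
    using conv_vanishing_off_eps[of a "conv G eps (delta u)"] a_scalar u
    by (auto simp: conv_U_vanishing_off eps_vanishing_off delta_U)
  then have "conv G a (?x - cscale c eps) = 0" by (simp add: conv_diff_right conv_cscale_right)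
  moreover have "?x + cscale (- c) eps \<in> eps_ideal"
    using x eps_in_ideal right_stable_eps_ideal right_stable_cscale[OF right_stable_eps_ideal]
    by (auto simp: right_stable_def)
  then have "?x - cscale c eps \<in> eps_ideal"
    by (simp add: diff_cscale)
  ultimately have "?x - cscale c eps = 0" by (rule a_injective[rotated])
  then show "\<exists>c. ?x = cscale c eps" by auto
qed

lemma conv_a_eps_nonzero: "conv G a eps \<noteq> 0"
  using a_injective[OF eps_in_ideal] eps_nonzero by blast

lemma conv_a_eps_eps: "conv G (conv G a eps) eps = conv G a eps"
  by (simp add: conv_assoc eps_eps)

text \<open>An isomorphism \<open>f\<close> from \<open>eps_ideal\<close> onto \<open>N\<close>
  satisfies \<open>f eps = f eps * eps\<close>, and this is a nonzero multiple of
  \<open>a * eps\<close> by \<open>a_scalar\<close>. Since \<open>f eps\<close> generates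
  \<open>N\<close>, the submodule is determined.\<close>

lemma constituent_unique:
  assumes N: "right_stable N" "N \<subseteq> cyc a"
    and iso: "right_module_isomorphic (group_algebra GU) (conv_module G N) Ind"
  shows "N = cyc (conv G a eps)"
proof -
  have "right_module_isomorphic (group_algebra GU) (conv_module G eps_ideal) (conv_module G N)"
    using right_module_isomorphic_trans[OF eps_ideal_isomorphic_Ind right_module_isomorphic_sym[OF iso]] .
  then obtain f where bij: "bij_betw f eps_ideal N"
    and add: "\<And>x y. x \<in> eps_ideal \<Longrightarrow> y \<in> eps_ideal \<Longrightarrow> f (x + y) = f x + f y"
    and sm: "\<And>b x. b \<in> vanishing_off U \<Longrightarrow> x \<in> eps_ideal \<Longrightarrow> f (conv G x b) = conv G (f x) b"
    unfolding right_module_isomorphic_def by (auto simp: conv_module_def)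
  have fe: "f eps \<in> N" using bij eps_in_ideal bij_betwE by blast
  have "f (conv G eps eps) = conv G (f eps) eps" by (intro sm eps_vanishing_off eps_in_ideal)
  then have fe_eps: "f eps = conv G (f eps) eps" by (simp add: eps_eps)
  obtain b where b: "b \<in> vanishing_off U" "f eps = conv G a b" using fe N by (auto simp: cyc_def)
  obtain c where c: "f eps = cscale c (conv G a eps)"
    using conv_vanishing_off_eps[of a b] a_scalar b fe_eps by auto
  have f0: "f 0 = 0" using add[of 0 0] right_stable_eps_ideal by (simp add: right_stable_def)
  have "f eps \<noteq> f 0"
    using bij eps_nonzero eps_in_ideal right_stable_eps_ideal
    by (metis bij_betw_def inj_on_contraD right_stable_def)
  then have "c \<noteq> 0" using c f0 by auto
  then have "conv G a eps = cscale (1 / c) (f eps)" using c by simp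
  then have z: "conv G a eps \<in> N" using fe right_stable_cscale N by simp
  show ?thesis
  proof
    show "cyc (conv G a eps) \<subseteq> N" by (rule cyc_subset[OF N(1) z])
    show "N \<subseteq> cyc (conv G a eps)"
    proof
      fix y assume "y \<in> N"
      then obtain x where x: "x \<in> eps_ideal" "y = f x" using bij by (auto simp: bij_betw_def)
      then have "y = f (conv G eps x)" by (simp add: eps_ideal_def)
      also have "\<dots> = conv G (f eps) x" using x by (intro sm eps_in_ideal) (simp add: eps_ideal_def)
      also have "\<dots> = conv G (conv G a eps) (cscale c x)"
        by (simp add: c conv_cscale_left conv_cscale_right)
      finally show "y \<in> cyc (conv G a eps)"
        using x by (auto simp: cyc_def eps_ideal_def vanishing_off_cscale)
    qed
  qed
qed

lemma cyc_conv_a_eps_isomorphic_Ind: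
  "right_module_isomorphic (group_algebra GU) (conv_module G (cyc (conv G a eps))) Ind"
  by (rule right_module_isomorphic_trans[OF cyc_isomorphic_eps_ideal eps_ideal_isomorphic_Ind])
     (auto simp: conv_vanishing_off conv_a_eps_eps conv_a_eps_nonzero)

lemma constituent:
  shows "submodule (cyc (conv G a eps)) (group_algebra GU) (conv_module G (cyc a))"
    and "irreducible_right_module (group_algebra GU) (conv_module G (cyc (conv G a eps)))"
proof -
  have "conv G a eps \<in> cyc a" using eps_vanishing_off by (auto simp: cyc_def)
  then show "submodule (cyc (conv G a eps)) (group_algebra GU) (conv_module G (cyc a))"
    by (simp add: submodule_conv_module_iff right_stable_cyc cyc_subset)
  show "irreducible_right_module (group_algebra GU) (conv_module G (cyc (conv G a eps)))"
    by (rule cyc_irreducible) (auto simp: conv_vanishing_off conv_a_eps_eps conv_a_eps_nonzero)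
qed

end

section \<open>Pattern groups\<close>

abbreviation "gl_inv n \<equiv> m_inv (GL n)"

lemma mult_entry:
  assumes "A \<in> carrier_mat n n" "B \<in> carrier_mat n n" "i < n" "j < n"
  shows "(A * B) $$ (i, j) = (\<Sum>k<n. A $$ (i, k) * B $$ (k, j))"
  using assms by (auto simp: scalar_prod_def lessThan_atLeast0)

lemma finite_carrier_mat: "finite (carrier_mat n m :: 'a::finite mat set)"
proof (rule finite_subset)
  show "(carrier_mat n m :: 'a mat set) \<subseteq> mat n m ` (({..<n} \<times> {..<m}) \<rightarrow>\<^sub>E UNIV)"
  proof
    fix A :: "'a mat" assume A: "A \<in> carrier_mat n m"
    then have "A = mat n m (restrict (\<lambda>ij. A $$ ij) ({..<n} \<times> {..<m}))"
      by (intro eq_matI) auto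
    moreover have "restrict (\<lambda>ij. A $$ ij) ({..<n} \<times> {..<m}) \<in> ({..<n} \<times> {..<m}) \<rightarrow>\<^sub>E UNIV"
      by simp
    ultimately show "A \<in> mat n m ` (({..<n} \<times> {..<m}) \<rightarrow>\<^sub>E UNIV)"
      by (rule image_eqI)
  qed
  show "finite (mat n m ` (({..<n} \<times> {..<m}) \<rightarrow>\<^sub>E (UNIV :: 'a set)))"
    by (intro finite_imageI finite_PiE finite_cartesian_product) simp_all
qed

lemma GL_simps:
  "mult (GL n) = (*)" "one (GL n) = 1\<^sub>m n"
  "carrier (GL n) = Units (ring_mat TYPE('a::field) n ())"
  by (simp_all add: GL_def units_of_def ring_mat_simps)

lemma group_GL: "group (GL n :: 'a::field mat monoid)"
proof -
  interpret ring "ring_mat TYPE('a) n ()" by (rule ring_mat)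
  show ?thesis unfolding GL_def by (rule units_group)
qed

lemma GL_carrier_mat: "g \<in> carrier (GL n) \<Longrightarrow> g \<in> carrier_mat n n"
  by (auto simp: GL_simps Units_def ring_mat_simps)

lemma finite_group_GL: "finite_group (GL n :: 'a::{field,finite} mat monoid)"
  by (intro finite_group.intro finite_group_axioms.intro group_GL
      finite_subset[OF _ finite_carrier_mat[of n n]]) (auto simp: GL_carrier_mat)

lemma finite_Phi: "finite (Phi n)"
  by (rule finite_subset[of _ "{..<n} \<times> {..<n}"]) (auto simp: Phi_def)

lemma Vset_iff:
  "A \<in> Vset n S \<longleftrightarrow> A \<in> carrier_mat n n \<and> (\<forall>i<n. \<forall>j<n. A $$ (i, j) \<noteq> 0 \<longrightarrow> (i, j) \<in> S)"
  by (auto simp: Vset_def msupp_def)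

lemma VsetD: "A \<in> Vset n S \<Longrightarrow> i < n \<Longrightarrow> j < n \<Longrightarrow> (i, j) \<notin> S \<Longrightarrow> A $$ (i, j) = 0"
  by (auto simp: Vset_iff)

lemma Uset_iff:
  assumes "S \<subseteq> Phi n"
  shows "u \<in> Uset n S \<longleftrightarrow> u \<in> carrier_mat n n \<and> (\<forall>i<n. u $$ (i, i) = 1) \<and>
    (\<forall>i<n. \<forall>j<n. i \<noteq> j \<longrightarrow> u $$ (i, j) \<noteq> 0 \<longrightarrow> (i, j) \<in> S)" (is "_ \<longleftrightarrow> ?R")
proof
  assume "u \<in> Uset n S"
  then obtain A where A: "A \<in> Vset n S" "u = 1\<^sub>m n + A" by (auto simp: Uset_def)
  moreover have "A $$ (i, i) = 0" if "i < n" for i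
    using A that assms by (auto simp: Phi_def intro!: VsetD)
  ultimately show ?R by (auto simp: Vset_iff)
next
  assume R: ?R
  then have "u - 1\<^sub>m n \<in> Vset n S" by (auto simp: Vset_iff)
  moreover have "u = 1\<^sub>m n + (u - 1\<^sub>m n)" using R by (intro eq_matI) auto
  ultimately show "u \<in> Uset n S" unfolding Uset_def by blast
qed

lemma UsetD:
  assumes "S \<subseteq> Phi n" "u \<in> Uset n S"
  shows "u \<in> carrier_mat n n" "\<And>i. i < n \<Longrightarrow> u $$ (i, i) = 1"
    "\<And>i j. i < n \<Longrightarrow> j < n \<Longrightarrow> i \<noteq> j \<Longrightarrow> (i, j) \<notin> S \<Longrightarrow> u $$ (i, j) = 0"
  using assms by (auto simp: Uset_iff)

lemma Uset_upper_zero: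
  assumes "S \<subseteq> Phi n" "u \<in> Uset n S" "i < j" "j < n"
  shows "u $$ (i, j) = 0"
  using assms by (intro UsetD(3)[OF assms(1,2)]) (auto simp: Phi_def)

lemma Uset_mono: "S \<subseteq> T \<Longrightarrow> Uset n S \<subseteq> Uset n T"
  by (auto simp: Uset_def Vset_def)

lemma one_Uset: "S \<subseteq> Phi n \<Longrightarrow> 1\<^sub>m n \<in> Uset n S"
  by (auto simp: Uset_iff)

lemma one_plus_Uset: "A \<in> Vset n S \<Longrightarrow> 1\<^sub>m n + A \<in> Uset n S"
  by (auto simp: Uset_def)

lemma Uset_GL:
  fixes u :: "'a::field mat"
  assumes "S \<subseteq> Phi n" "u \<in> Uset n S"
  shows "u \<in> carrier (GL n)"
proof -
  note u = UsetD[OF assms] Uset_upper_zero[OF assms]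
  have "det u = prod_list (diag_mat u)" by (rule det_lower_triangular[OF u(4) u(1)])
  also have "diag_mat u = map (\<lambda>i. 1) [0..<n]" using u by (auto simp: diag_mat_def)
  also have "prod_list \<dots> = 1" by (induction n) auto
  finally show ?thesis using det_non_zero_imp_unit[OF u(1)] by (simp add: GL_simps)
qed

lemma Uset_mult:
  assumes "S \<subseteq> Phi n" "trans S" "u \<in> Uset n S" "v \<in> Uset n S"
  shows "u * v \<in> Uset n S"
proof -
  note u = UsetD[OF assms(1,3)] and v = UsetD[OF assms(1,4)]
  have eq: "(u * v) $$ (i, j) = (\<Sum>k<n. u $$ (i, k) * v $$ (k, j))" if "i < n" "j < n" for i j
    using that u v by (intro mult_entry)
  have diag: "(u * v) $$ (i, i) = 1" if "i < n" for i
  proof -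
    have "u $$ (i, k) * v $$ (k, i) = (if k = i then 1 else 0)" if "k < n" for k
      using u v \<open>i < n\<close> that assms(1)
      by (cases "k < i") (auto simp: Uset_upper_zero[OF assms(1,4)] Uset_upper_zero[OF assms(1,3)])
    then show ?thesis using that by (simp add: eq)
  qed
  moreover have off: "(u * v) $$ (i, j) = 0" if "i < n" "j < n" "i \<noteq> j" "(i, j) \<notin> S" for i j
  proof -
    have "u $$ (i, k) * v $$ (k, j) = 0" if "k < n" for k
    proof (cases "k = i \<or> k = j")
      case True
      then show ?thesis using u v \<open>i < n\<close> \<open>j < n\<close> \<open>i \<noteq> j\<close> \<open>(i, j) \<notin> S\<close> by auto
    next
      case False
      then show ?thesis using u(3)[of i k] v(3)[of k j] that \<open>i < n\<close> \<open>j < n\<close> \<open>(i, j) \<notin> S\<close>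
          transD[OF assms(2), of i k j] by fastforce
    qed
    then have "(\<Sum>k<n. u $$ (i, k) * v $$ (k, j)) = 0" by (intro sum.neutral) blast
    then show ?thesis using that by (simp add: eq)
  qed
  ultimately show ?thesis using u v by (auto simp: Uset_iff[OF assms(1)])
qed

lemma finite_Uset: "finite (Uset n S :: 'a::{field,finite} mat set)"
  by (rule finite_subset[OF _ finite_carrier_mat[of n n]]) (auto simp: Uset_def Vset_def)

lemma finite_Vset: "finite (Vset n S :: 'a::{field,finite} mat set)"
  by (rule finite_subset[OF _ finite_carrier_mat[of n n]]) (auto simp: Vset_def)

text \<open>Left multiplication by \<open>x\<close> permutes the finite set \<open>S\<close>, so
  some element of \<open>S\<close> goes to the unit. This spares a formula for the inverse of a
  unitriangular matrix.\<close>

lemma (in group) finite_subgroupI: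
  assumes "finite S" "S \<subseteq> carrier G" "\<one> \<in> S" "\<And>x y. x \<in> S \<Longrightarrow> y \<in> S \<Longrightarrow> x \<otimes> y \<in> S"
  shows "subgroup S G"
proof (rule subgroupI)
  fix x assume x: "x \<in> S"
  have "inj_on ((\<otimes>) x) S" using x assms(2) by (auto simp: inj_on_def subset_iff)
  then have "(\<otimes>) x ` S = S" using x assms by (intro endo_inj_surj) auto
  then obtain y where "y \<in> S" "x \<otimes> y = \<one>" using assms(3) by (metis imageE)
  then show "inv x \<in> S" using x assms(2) by (metis inv_equality inv_comm subsetD)
qed (use assms in auto)

lemma subgroup_Uset:
  assumes "S \<subseteq> Phi n" "trans S"
  shows "subgroup (Uset n S) (GL n :: 'a::{field,finite} mat monoid)"
proof -
  interpret group "GL n :: 'a mat monoid" by (rule group_GL)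
  show ?thesis
    by (rule finite_subgroupI)
       (use assms in \<open>auto simp: finite_Uset GL_simps(1,2) Uset_GL Uset_mult one_Uset\<close>)
qed

lemma trans_Phi: "trans (Phi n)"
  by (auto simp: trans_def Phi_def)

lemma subgroup_U: "finite_group_subgroup (GL n :: 'a::{field,finite} mat monoid) (Uset n (Phi n))"
  by (intro finite_group_subgroup.intro finite_group_GL subgroup_Uset trans_Phi) auto

lemma card_Uset:
  assumes "S \<subseteq> Phi n"
  shows "card (Uset n S :: 'a::{field,finite} mat set) = CARD('a) ^ card S"
proof -
  have "finite S" using assms finite_Phi finite_subset by blast
  let ?f = "\<lambda>u::'a mat. restrict (\<lambda>ij. u $$ ij) S"
  have "bij_betw ?f (Uset n S) (S \<rightarrow>\<^sub>E UNIV)"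
    unfolding bij_betw_def
  proof
    show "inj_on ?f (Uset n S)"
    proof (rule inj_onI)
      fix u v :: "'a mat" assume u: "u \<in> Uset n S" and v: "v \<in> Uset n S" and eq: "?f u = ?f v"
      show "u = v"
      proof (rule eq_matI)
        fix i j assume "i < dim_row v" "j < dim_col v"
        then have ij: "i < n" "j < n" using v by (auto simp: Uset_iff[OF assms])
        show "u $$ (i, j) = v $$ (i, j)"
        proof (cases "(i, j) \<in> S")
          case True
          then show ?thesis using fun_cong[OF eq, of "(i, j)"] by simp
        next
          case False
          then show ?thesis
            using UsetD(2,3)[OF assms u] UsetD(2,3)[OF assms v] ij by (cases "i = j") auto
        qed
      qed (use u v in \<open>auto simp: Uset_iff[OF assms]\<close>)
    qed
    show "?f ` Uset n S = (S \<rightarrow>\<^sub>E UNIV)"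
    proof (intro subset_antisym subsetI)
      fix f :: "nat \<times> nat \<Rightarrow> 'a" assume f: "f \<in> S \<rightarrow>\<^sub>E UNIV"
      let ?u = "mat n n (\<lambda>ij. if ij \<in> S then f ij else if fst ij = snd ij then 1 else 0)"
      have "?u \<in> Uset n S" using assms by (auto simp: Uset_iff[OF assms] Phi_def)
      moreover have "f = ?f ?u"
        using f assms by (intro extensionalityI[of _ S]) (auto simp: Phi_def PiE_def)
      ultimately show "f \<in> ?f ` Uset n S" by blast
    qed auto
  qed
  then have "card (Uset n S :: 'a mat set) = card (S \<rightarrow>\<^sub>E (UNIV :: 'a set))" by (rule bij_betw_same_card)
  then show ?thesis using \<open>finite S\<close> by (simp add: card_PiE)
qed

text \<open>Each fibre of the product map injects into \<open>H \<inter> K\<close>: relative to a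
  fixed pair \<open>(h0, k0)\<close> of the fibre, \<open>(h, k)\<close> is sent to
  \<open>inv h0 \<otimes> h\<close>, which equals \<open>k0 \<otimes> inv k\<close>.\<close>

lemma (in group) card_mult_le:
  assumes H: "subgroup H G" "finite H" and K: "subgroup K G" "finite K"
  shows "card H * card K \<le> card ((\<lambda>(h, k). h \<otimes> k) ` (H \<times> K)) * card (H \<inter> K)"
proof -
  let ?f = "\<lambda>(h, k). h \<otimes> k"
  interpret H: subgroup H G by fact
  interpret K: subgroup K G by fact
  have "card {p \<in> H \<times> K. ?f p = w} \<le> card (H \<inter> K)" if w: "w \<in> ?f ` (H \<times> K)" for w
  proof -
    from w obtain h0 k0 where 0: "h0 \<in> H" "k0 \<in> K" "w = h0 \<otimes> k0" by auto
    let ?g = "\<lambda>(h, k). inv h0 \<otimes> h"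
    show ?thesis
    proof (rule card_inj_on_le)
      show "inj_on ?g {p \<in> H \<times> K. ?f p = w}"
      proof (rule inj_onI)
        fix p p' assume p: "p \<in> {p \<in> H \<times> K. ?f p = w}" "p' \<in> {p \<in> H \<times> K. ?f p = w}"
          and eq: "?g p = ?g p'"
        obtain h k h' k' where *: "p = (h, k)" "p' = (h', k')" "h \<in> H" "k \<in> K" "h' \<in> H" "k' \<in> K"
          "h' \<otimes> k' = h \<otimes> k"
          using p by (cases p; cases p') auto
        then have "h = h'" using 0 eq by (simp add: H.mem_carrier)
        then show "p = p'" using * by (simp add: H.mem_carrier K.mem_carrier)
      qed
      show "?g ` {p \<in> H \<times> K. ?f p = w} \<subseteq> H \<inter> K"
      proof
        fix x assume "x \<in> ?g ` {p \<in> H \<times> K. ?f p = w}"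
        then obtain h k where *: "h \<in> H" "k \<in> K" "h \<otimes> k = w" and x: "x = inv h0 \<otimes> h" by auto
        have c: "h \<in> carrier G" "k \<in> carrier G" "h0 \<in> carrier G" "k0 \<in> carrier G"
          using * 0 H.subset K.subset by auto
        have "h \<otimes> k = h0 \<otimes> k0" using * 0 by simp
        then have "inv h0 \<otimes> (h \<otimes> k) \<otimes> inv k = inv h0 \<otimes> (h0 \<otimes> k0) \<otimes> inv k" by simp
        then have "inv h0 \<otimes> h = k0 \<otimes> inv k"
          using c by (simp add: m_assoc) (simp add: m_assoc[symmetric])
        moreover have "inv h0 \<otimes> h \<in> H" "k0 \<otimes> inv k \<in> K" using * 0 by blast+
        ultimately show "x \<in> H \<inter> K" by (simp add: x)
      qed
    qed (use assms in auto)
  qed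
  then have "(\<Sum>w\<in>?f ` (H \<times> K). card {p \<in> H \<times> K. ?f p = w}) \<le> card (?f ` (H \<times> K)) * card (H \<inter> K)"
    using sum_bounded_above[of "?f ` (H \<times> K)" "\<lambda>w. card {p \<in> H \<times> K. ?f p = w}" "card (H \<inter> K)"] by simp
  moreover have "card (H \<times> K) = (\<Sum>w\<in>?f ` (H \<times> K). card {p \<in> H \<times> K. ?f p = w})"
    using sum.image_gen[of "H \<times> K" "\<lambda>_. 1::nat" ?f] assms by simp
  ultimately show ?thesis by (simp add: card_cartesian_product)
qed

lemma Uset_Int: "Uset n S \<inter> Uset n T = Uset n (S \<inter> T)" if "S \<subseteq> Phi n" "T \<subseteq> Phi n"
proof -
  have "S \<inter> T \<subseteq> Phi n" using that by blast
  then show ?thesis using that by (auto simp: Uset_iff)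
qed

text \<open>Counting replaces an explicit factorization: by \<open>card_mult_le\<close> the products
  number at least \<open>q\<close> to the power
  \<open>card S + card T - card (S \<inter> T)\<close>, which is the order of the group for
  \<open>S \<union> T\<close>.\<close>

lemma Uset_factor:
  assumes S: "S \<subseteq> Phi n" "trans S" and T: "T \<subseteq> Phi n" "trans T" and ST: "trans (S \<union> T)"
  shows "(\<lambda>(s, t). s * t) ` (Uset n S \<times> Uset n T) = (Uset n (S \<union> T) :: 'a::{field,finite} mat set)"
proof -
  interpret group "GL n :: 'a mat monoid" by (rule group_GL)
  let ?f = "\<lambda>(s, t). s * t :: 'a mat"
  have fin: "finite S" "finite T" using S T finite_Phi finite_subset by blast+
  have "CARD('a) ^ card S * CARD('a) ^ card T \<le> card (?f ` (Uset n S \<times> Uset n T)) * CARD('a) ^ card (S \<inter> T)"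
    using card_mult_le[OF subgroup_Uset[OF S] finite_Uset subgroup_Uset[OF T] finite_Uset] S T
    by (simp add: Uset_Int card_Uset GL_simps(1) le_infI1)
  moreover have "card S + card T = card (S \<union> T) + card (S \<inter> T)"
    using fin by (rule card_Un_Int)
  ultimately have "CARD('a) ^ card (S \<union> T) * CARD('a) ^ card (S \<inter> T)
      \<le> card (?f ` (Uset n S \<times> Uset n T)) * CARD('a) ^ card (S \<inter> T)"
    by (simp add: power_add[symmetric])
  then have "card (Uset n (S \<union> T) :: 'a mat set) \<le> card (?f ` (Uset n S \<times> Uset n T))"
    using S T by (simp add: card_Uset)
  moreover have "?f ` (Uset n S \<times> Uset n T) \<subseteq> Uset n (S \<union> T)"
  proof clarify
    fix s t :: "'a mat" assume "s \<in> Uset n S" "t \<in> Uset n T"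
    then show "s * t \<in> Uset n (S \<union> T)"
      using S T Uset_mono[of S "S \<union> T" n] Uset_mono[of T "S \<union> T" n] by (intro Uset_mult ST) auto
  qed
  ultimately show ?thesis by (intro card_seteq finite_Uset)
qed

lemma Uset_factor_bij:
  assumes S: "S \<subseteq> Phi n" "trans S" and T: "T \<subseteq> Phi n" "trans T" and ST: "trans (S \<union> T)"
    and disj: "S \<inter> T = {}"
  shows "bij_betw (\<lambda>(s, t). s * t) (Uset n S \<times> Uset n T) (Uset n (S \<union> T) :: 'a::{field,finite} mat set)"
  unfolding bij_betw_def
proof
  have fin: "finite S" "finite T" using S T finite_Phi finite_subset by blast+
  show im: "(\<lambda>(s, t). s * t) ` (Uset n S \<times> Uset n T) = (Uset n (S \<union> T) :: 'a mat set)"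
    by (rule Uset_factor[OF S T ST])
  have "card (Uset n (S \<union> T) :: 'a mat set) = card (Uset n S \<times> Uset n T :: ('a mat \<times> 'a mat) set)"
    using S(1) T(1) by (simp add: card_Uset card_cartesian_product card_Un_disjoint[OF fin disj] power_add)
  then have "card ((\<lambda>(s, t). s * t :: 'a mat) ` (Uset n S \<times> Uset n T)) = card (Uset n S \<times> Uset n T :: ('a mat \<times> 'a mat) set)"
    unfolding im .
  then show "inj_on (\<lambda>(s, t). s * t :: 'a mat) (Uset n S \<times> Uset n T)"
    by (intro eq_card_imp_inj_on finite_cartesian_product finite_Uset)
qed

lemma Uset_inv:
  fixes u :: "'a::{field,finite} mat"
  assumes "S \<subseteq> Phi n" "trans S" "u \<in> Uset n S"
  shows "gl_inv n u \<in> Uset n S" "gl_inv n u * u = 1\<^sub>m n" "u * gl_inv n u = 1\<^sub>m n"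
proof -
  interpret group "GL n :: 'a mat monoid" by (rule group_GL)
  show "gl_inv n u \<in> Uset n S" using subgroup.m_inv_closed[OF subgroup_Uset] assms by blast
  show "gl_inv n u * u = 1\<^sub>m n" "u * gl_inv n u = 1\<^sub>m n"
    using l_inv[of u] r_inv[of u] Uset_GL[OF assms(1,3)] by (simp_all add: GL_simps(1,2))
qed

section \<open>Additive characters\<close>

locale additive_character =
  fixes \<theta> :: "'a::{field,finite} \<Rightarrow> complex"
  assumes nontrivial: "nontrivial_additive_character \<theta>"
begin

lemma \<theta>_add: "\<theta> (a + b) = \<theta> a * \<theta> b"
  and \<theta>_nonzero: "\<theta> a \<noteq> 0"
  using nontrivial by (auto simp: nontrivial_additive_character_def linear_character_def)

lemma \<theta>_nontrivial: "\<exists>a. \<theta> a \<noteq> 1"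
  using nontrivial by (auto simp: nontrivial_additive_character_def)

lemma \<theta>_0: "\<theta> 0 = 1"
  using \<theta>_add[of 0 0] \<theta>_nonzero[of 0] by simp

lemma \<theta>_cnj: "cnj (\<theta> a) = \<theta> (- a)"
proof -
  \<comment> \<open>Translation by \<open>a\<close> multiplies the product over the whole field by
    \<open>\<theta> a ^ q\<close>, so the values of \<open>\<theta>\<close> are roots of unity and
    have modulus 1.\<close>
  have "(\<Prod>b\<in>UNIV. \<theta> (a + b)) = (\<Prod>b\<in>UNIV. \<theta> b)"
    by (rule prod.reindex_bij_witness[of _ "\<lambda>b. b - a" "\<lambda>b. a + b"]) auto
  then have "\<theta> a ^ CARD('a) = 1" using \<theta>_nonzero by (simp add: \<theta>_add prod.distrib)
  then have "norm (\<theta> a) ^ CARD('a) = 1" by (metis norm_one norm_power)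
  then have "norm (\<theta> a) = 1"
    using power_eq_imp_eq_base[of "norm (\<theta> a)" "CARD('a)" 1] by simp
  then have "\<theta> a * cnj (\<theta> a) = 1" by (simp add: complex_norm_square[symmetric])
  moreover have "\<theta> a * \<theta> (- a) = 1" by (simp add: \<theta>_add[symmetric] \<theta>_0)
  ultimately have "\<theta> a * cnj (\<theta> a) = \<theta> a * \<theta> (- a)" by simp
  then show ?thesis using \<theta>_nonzero[of a] by simp
qed

lemma \<theta>_nontrivial_mult: "c \<noteq> 0 \<Longrightarrow> \<exists>a. \<theta> (a * c) \<noteq> 1"
  using \<theta>_nontrivial by (metis nonzero_eq_divide_eq)

text \<open>Translating \<open>X\<close> by a suitable multiple of the matrix unit at
  \<open>(i, j)\<close> multiplies the sum by a factor different from 1.\<close>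

lemma chi_char_sum_eq_0:
  assumes S: "S \<subseteq> {..<n} \<times> {..<n}" and ij: "(i, j) \<in> S" and C: "C $$ (i, j) \<noteq> 0"
  shows "(\<Sum>X\<in>Vset n S. chi_char \<theta> S C X) = 0"
proof -
  have fin: "finite S" by (rule finite_subset[OF S]) auto
  obtain a where a: "\<theta> (a * C $$ (i, j)) \<noteq> 1" using \<theta>_nontrivial_mult[OF C] by blast
  let ?E = "\<lambda>a. mat n n (\<lambda>kl. if kl = (i, j) then a else 0)"
  have E: "?E a \<in> Vset n S" for a using ij by (auto simp: Vset_iff)
  have VV: "X + Y \<in> Vset n S" if "X \<in> Vset n S" "Y \<in> Vset n S" for X Y :: "'a mat"
    using that by (auto simp: Vset_iff) (metis add.right_neutral)
  have "(\<Sum>X\<in>Vset n S. chi_char \<theta> S C X) = (\<Sum>X\<in>Vset n S. chi_char \<theta> S C (X + ?E a))"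
  proof (rule sum.reindex_bij_witness[of _ "\<lambda>X. X + ?E a" "\<lambda>X. X + ?E (- a)"])
    fix X :: "'a mat" assume X: "X \<in> Vset n S"
    then have "X \<in> carrier_mat n n" by (simp add: Vset_iff)
    then show "X + ?E a + ?E (- a) = X" "X + ?E (- a) + ?E a = X" by (auto intro!: eq_matI)
    then show "chi_char \<theta> S C (X + ?E (- a) + ?E a) = chi_char \<theta> S C X" by simp
  qed (use VV E in auto)
  also have "\<dots> = (\<Sum>X\<in>Vset n S. \<theta> (a * C $$ (i, j)) * chi_char \<theta> S C X)"
  proof (rule sum.cong[OF refl])
    fix X :: "'a mat" assume X: "X \<in> Vset n S"
    have "(\<Sum>kl\<in>S. C $$ kl * (X + ?E a) $$ kl) = (\<Sum>kl\<in>S. C $$ kl * X $$ kl + (if kl = (i, j) then a * C $$ (i, j) else 0))"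
    proof (rule sum.cong[OF refl])
      fix kl assume "kl \<in> S"
      then obtain k l where "kl = (k, l)" "k < n" "l < n" using S by auto
      then show "C $$ kl * (X + ?E a) $$ kl = C $$ kl * X $$ kl + (if kl = (i, j) then a * C $$ (i, j) else 0)"
        using X by (auto simp: Vset_iff algebra_simps)
    qed
    also have "\<dots> = (\<Sum>kl\<in>S. C $$ kl * X $$ kl) + a * C $$ (i, j)"
      using fin ij by (simp add: sum.distrib)
    finally show "chi_char \<theta> S C (X + ?E a) = \<theta> (a * C $$ (i, j)) * chi_char \<theta> S C X"
      by (simp add: chi_char_def \<theta>_add mult.commute)
  qed
  finally have "(\<Sum>X\<in>Vset n S. chi_char \<theta> S C X) = \<theta> (a * C $$ (i, j)) * (\<Sum>X\<in>Vset n S. chi_char \<theta> S C X)"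
    unfolding sum_distrib_left .
  then show ?thesis using a by simp
qed

end

section \<open>The linear character attached to a main condition set\<close>

lemma sum_two_terms:
  fixes f :: "nat \<Rightarrow> 'b::comm_monoid_add"
  assumes "i < n" "j < n" "i \<noteq> j" "\<And>k. k < n \<Longrightarrow> k \<noteq> i \<Longrightarrow> k \<noteq> j \<Longrightarrow> f k = 0"
  shows "(\<Sum>k<n. f k) = f i + f j"
proof -
  have "(\<Sum>k<n. f k) = (\<Sum>k\<in>{i, j}. f k)"
    using assms by (intro sum.mono_neutral_right) auto
  then show ?thesis using assms(3) by simp
qed

lemma sum_one_term:
  fixes f :: "nat \<Rightarrow> 'b::comm_monoid_add"
  assumes "i < n" "\<And>k. k < n \<Longrightarrow> k \<noteq> i \<Longrightarrow> f k = 0"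
  shows "(\<Sum>k<n. f k) = f i"
proof -
  have "(\<Sum>k<n. f k) = (\<Sum>k\<in>{i}. f k)"
    using assms by (intro sum.mono_neutral_right) auto
  then show ?thesis by simp
qed

lemma root_elt_entry:
  assumes "k < n" "l < n"
  shows "root_elt n (i, j) a $$ (k, l) = (if k = l then 1 else 0) + (if k = i \<and> l = j then a else 0)"
  using assms by (simp add: root_elt_def)

lemma root_elt_Uset: "(i, j) \<in> S \<Longrightarrow> S \<subseteq> Phi n \<Longrightarrow> root_elt n (i, j) a \<in> Uset n S"
  unfolding root_elt_def by (rule one_plus_Uset) (auto simp: Vset_iff)

locale hook_disconnected = additive_character \<theta> for \<theta> :: "'a::{field,finite} \<Rightarrow> complex" +
  fixes n :: nat and A :: "'a mat"
  assumes A_carrier: "A \<in> carrier_mat n n"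
    and main_condition: "main_condition_set n (msupp A)"
    and hook_disconnected: "completely_hook_disconnected (msupp A)"
begin

abbreviation "p \<equiv> msupp A"
abbreviation "U \<equiv> Uset n (Phi n) :: 'a mat set"
abbreviation "H \<equiv> Uset n (Rhat n p) :: 'a mat set"

lemma p_iff: "(i, j) \<in> p \<longleftrightarrow> i < n \<and> j < n \<and> A $$ (i, j) \<noteq> 0"
  using A_carrier by (auto simp: msupp_def)

lemma p_Phi: "p \<subseteq> Phi n"
  using main_condition by (simp add: main_condition_set_def)

lemma p_less: "(i, j) \<in> p \<Longrightarrow> j < i" "(i, j) \<in> p \<Longrightarrow> i < n" "(i, j) \<in> p \<Longrightarrow> j < n"
  using p_Phi by (auto simp: Phi_def)

lemma p_row: "(i, j) \<in> p \<Longrightarrow> (i, j') \<in> p \<Longrightarrow> j = j'"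
  and p_col: "(i, j) \<in> p \<Longrightarrow> (i', j) \<in> p \<Longrightarrow> i = i'"
  using main_condition inj_onD[of fst p "(i, j)" "(i, j')"] inj_onD[of snd p "(i, j)" "(i', j)"]
  by (auto simp: main_condition_set_def)

lemma p_disconnected: "(i, j) \<in> p \<Longrightarrow> (k, i) \<in> p \<Longrightarrow> False"
  using hook_disconnected by (force simp: completely_hook_disconnected_def)

lemma A_zero: "i < n \<Longrightarrow> j < n \<Longrightarrow> (i, j) \<notin> p \<Longrightarrow> A $$ (i, j) = 0"
  by (auto simp: p_iff)

lemma finite_p: "finite p"
  using p_Phi finite_Phi finite_subset by blast

lemma A_Vset: "A \<in> Vset n (Phi n)"
  using A_carrier p_Phi by (auto simp: Vset_iff p_iff subset_iff)

text \<open>A column holds at most one position of \<open>p\<close>, so the two clauses of the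
  definition merge into one condition, vacuous for columns without a position.\<close>

lemma Rset_iff:
  "(r, s) \<in> Rset n p \<longleftrightarrow> s < r \<and> r < n \<and> (\<forall>i. (i, s) \<in> p \<longrightarrow> i \<le> r)"
proof (cases "\<exists>i. (i, s) \<in> p")
  case True
  then obtain i where i: "(i, s) \<in> p" by blast
  then have "s \<in> snd ` p" by force
  moreover have "(i', s) \<in> p \<longleftrightarrow> i' = i" for i' using i p_col by blast
  ultimately show ?thesis using p_less[OF i] by (auto simp: Rset_def)
next
  case False
  then have "s \<notin> snd ` p" by force
  then show ?thesis using False by (auto simp: Rset_def Phi_def)
qed

text \<open>This form can be chained, as the closure of \<open>Rhat\<close> requires. The
  inequalities \<open>j < b < i\<close> of the definition come back from \<open>s < r\<close> and
  the failure of \<open>i \<le> r\<close>.\<close>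

lemma Rhat_iff:
  "(r, s) \<in> Rhat n p \<longleftrightarrow> s < r \<and> r < n \<and> (\<forall>i. (i, s) \<in> p \<longrightarrow> i \<le> r \<or> (\<exists>r'. (r', r) \<in> p \<and> i < r'))"
  (is "_ \<longleftrightarrow> ?R")
proof
  assume "(r, s) \<in> Rhat n p"
  then consider "(r, s) \<in> Rset n p" | i r' where "(r, s) \<in> Phi n" "(i, s) \<in> p" "(r', r) \<in> p" "i < r'"
    by (auto simp: Rhat_def)
  then show ?R by cases (auto simp: Rset_iff Phi_def dest: p_col)
next
  assume R: ?R
  show "(r, s) \<in> Rhat n p"
  proof (cases "(r, s) \<in> Rset n p")
    case False
    then obtain i where i: "(i, s) \<in> p" "\<not> i \<le> r" using R by (auto simp: Rset_iff)
    with R obtain r' where "(r', r) \<in> p" "i < r'" by blast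
    then show ?thesis using i R by (auto simp: Rhat_def Phi_def)
  qed (simp add: Rhat_def)
qed

lemma Rset_Phi: "Rset n p \<subseteq> Phi n" and Rhat_Phi: "Rhat n p \<subseteq> Phi n"
  by (auto simp: Rset_iff Rhat_iff Phi_def)

lemma Rset_Rhat: "Rset n p \<subseteq> Rhat n p"
  by (auto simp: Rhat_def)

lemma p_Rhat: "p \<subseteq> Rhat n p"
proof
  fix ij assume "ij \<in> p"
  then show "ij \<in> Rhat n p"
    using p_less by (cases ij) (auto simp: Rhat_iff dest: p_col)
qed

text \<open>Let \<open>(i, t)\<close> be in \<open>p\<close>. If \<open>i \<le> s\<close>, then
  \<open>i \<le> r\<close> because \<open>s < r\<close>. Otherwise column \<open>s\<close> has a
  position \<open>(r', s)\<close> with \<open>i < r'\<close>, and membership of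
  \<open>(r, s)\<close> gives \<open>r' \<le> r\<close> or a position in column \<open>r\<close>
  lying below row \<open>r'\<close>.\<close>

lemma trans_Rhat: "trans (Rhat n p)"
proof (rule transI)
  fix r s t assume rs: "(r, s) \<in> Rhat n p" and st: "(s, t) \<in> Rhat n p"
  have "i \<le> r \<or> (\<exists>r'. (r', r) \<in> p \<and> i < r')" if i: "(i, t) \<in> p" for i
  proof -
    from st i consider "i \<le> s" | r' where "(r', s) \<in> p" "i < r'" by (auto simp: Rhat_iff)
    then show ?thesis
    proof cases
      case 1
      then show ?thesis using rs by (auto simp: Rhat_iff)
    next
      case 2
      then have "r' \<le> r \<or> (\<exists>r''. (r'', r) \<in> p \<and> r' < r'')" using rs by (auto simp: Rhat_iff)
      then show ?thesis using 2 by force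
    qed
  qed
  then show "(r, t) \<in> Rhat n p" using rs st by (auto simp: Rhat_iff)
qed

text \<open>Lower triangularity leaves the summands with \<open>j \<le> k \<le> i\<close>, and the
  two end points contribute the two entries.\<close>

lemma mult_entry_p:
  assumes g: "g \<in> U" and h: "h \<in> U" and ij: "(i, j) \<in> p"
    and 0: "\<And>k. j < k \<Longrightarrow> k < i \<Longrightarrow> g $$ (i, k) * h $$ (k, j) = 0"
  shows "(g * h) $$ (i, j) = g $$ (i, j) + h $$ (i, j)"
proof -
  note b = p_less[OF ij]
  note U = UsetD(1,2)[OF subset_refl] Uset_upper_zero[OF subset_refl]
  have "(g * h) $$ (i, j) = (\<Sum>k<n. g $$ (i, k) * h $$ (k, j))"
    using g h b by (intro mult_entry) (auto simp: U)
  also have "\<dots> = g $$ (i, i) * h $$ (i, j) + g $$ (i, j) * h $$ (j, j)"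
  proof (rule sum_two_terms)
    fix k assume k: "k < n" "k \<noteq> i" "k \<noteq> j"
    then consider "i < k" | "k < j" | "j < k" "k < i" by linarith
    then show "g $$ (i, k) * h $$ (k, j) = 0"
      using k b g h by cases (auto simp: U 0)
  qed (use b in auto)
  finally show ?thesis using g h b by (simp add: U add.commute)
qed

lemma H_U: "H \<subseteq> U"
  by (rule Uset_mono[OF Rhat_Phi])

text \<open>Suppose \<open>(i, k)\<close> and \<open>(k, j)\<close> are in \<open>Rhat\<close> with
  \<open>j < k < i\<close>. As \<open>(i, j)\<close> is in \<open>p\<close> and
  \<open>k < i\<close>, column \<open>k\<close> has a position \<open>(r', k)\<close> with
  \<open>i < r'\<close>. Then \<open>(i, k)\<close> in \<open>Rhat\<close> forces \<open>i\<close>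
  to be a column of \<open>p\<close>, but it is already a row: this is excluded by hook
  disconnectedness.\<close>

lemma mult_entry_H:
  assumes g: "g \<in> H" and h: "h \<in> H" and ij: "(i, j) \<in> p"
  shows "(g * h) $$ (i, j) = g $$ (i, j) + h $$ (i, j)"
proof (rule mult_entry_p)
  fix k assume k: "j < k" "k < i"
  have n: "i < n" "j < n" "k < n" using p_less[OF ij] k by auto
  show "g $$ (i, k) * h $$ (k, j) = 0"
  proof (rule ccontr)
    assume "g $$ (i, k) * h $$ (k, j) \<noteq> 0"
    then have "(i, k) \<in> Rhat n p" "(k, j) \<in> Rhat n p"
      using g h k n by (auto simp: Uset_iff[OF Rhat_Phi])
    then show False using k ij p_disconnected[OF ij] by (fastforce simp: Rhat_iff)
  qed
qed (use g h ij H_U in auto)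

text \<open>A formula for the character that \<open>psi_char\<close> describes only through its
  properties; the value 0 off \<open>H\<close> follows the convention in
  \<open>linear_character\<close>.\<close>

definition psi :: "'a mat \<Rightarrow> complex" where
  "psi h = (if h \<in> H then \<theta> (\<Sum>ij\<in>p. A $$ ij * h $$ ij) else 0)"

lemma psi_mult: "g \<in> H \<Longrightarrow> h \<in> H \<Longrightarrow> psi (g * h) = psi g * psi h"
proof -
  assume g: "g \<in> H" and h: "h \<in> H"
  have "(\<Sum>ij\<in>p. A $$ ij * (g * h) $$ ij) = (\<Sum>ij\<in>p. A $$ ij * g $$ ij + A $$ ij * h $$ ij)"
    using mult_entry_H[OF g h] by (intro sum.cong) (auto simp: algebra_simps)
  then show ?thesis
    using g h Uset_mult[OF Rhat_Phi trans_Rhat g h] by (simp add: psi_def sum.distrib \<theta>_add)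
qed

lemma psi_one_if: "h \<in> H \<Longrightarrow> (\<And>i j. (i, j) \<in> p \<Longrightarrow> h $$ (i, j) = 0) \<Longrightarrow> psi h = 1"
proof -
  assume h: "h \<in> H" "\<And>i j. (i, j) \<in> p \<Longrightarrow> h $$ (i, j) = 0"
  then have "(\<Sum>ij\<in>p. A $$ ij * h $$ ij) = 0" by (intro sum.neutral) auto
  then show "psi h = 1" using h by (simp add: psi_def \<theta>_0)
qed

lemma psi_root_elt:
  assumes ij: "(i, j) \<in> p"
  shows "psi (root_elt n (i, j) a) = \<theta> (a * A $$ (i, j))"
proof -
  have "(\<Sum>kl\<in>p. A $$ kl * root_elt n (i, j) a $$ kl) = (\<Sum>kl\<in>p. if kl = (i, j) then a * A $$ (i, j) else 0)"
  proof (rule sum.cong[OF refl])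
    fix kl assume "kl \<in> p"
    moreover obtain k l where "kl = (k, l)" by (cases kl)
    ultimately show "A $$ kl * root_elt n (i, j) a $$ kl = (if kl = (i, j) then a * A $$ (i, j) else 0)"
      using p_less[of k l] by (auto simp: root_elt_entry)
  qed
  also have "\<dots> = a * A $$ (i, j)" using finite_p ij by simp
  finally show ?thesis using root_elt_Uset[OF _ Rhat_Phi] ij p_Rhat by (auto simp: psi_def)
qed

text \<open>Induction on the number of nonzero entries of \<open>h\<close> at \<open>p\<close>.
  Multiplying by a root element of \<open>H\<close> removes one such entry and, by
  \<open>mult_entry_H\<close>, leaves the others; once none is left, \<open>h\<close> lies in the
  subgroup where both characters are trivial.\<close>

lemma linear_character_unique:
  fixes \<phi> :: "'a mat \<Rightarrow> complex"
  assumes lin: "linear_character ((GL n)\<lparr>carrier := H\<rparr>) \<phi>"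
    and triv: "\<forall>u\<in>Uset n (Rhat n p - p). \<phi> u = 1"
    and root: "\<forall>ij\<in>p. \<forall>\<alpha>. \<phi> (root_elt n ij \<alpha>) = \<theta> (\<alpha> * A $$ ij)"
  shows "\<phi> = psi"
proof
  fix h
  have mult: "\<phi> (g * h) = \<phi> g * \<phi> h" if "g \<in> H" "h \<in> H" for g h
    using lin that by (simp add: linear_character_def GL_simps)
  show "\<phi> h = psi h"
  proof (cases "h \<in> H")
    case False
    then show ?thesis using lin by (simp add: linear_character_def psi_def)
  next
    case True
    then show ?thesis
    proof (induction "card {ij \<in> p. h $$ ij \<noteq> 0}" arbitrary: h rule: less_induct)
      case less
      show ?case
      proof (cases "\<exists>ij\<in>p. h $$ ij \<noteq> 0")
        case False
        then have "h \<in> Uset n (Rhat n p - p)"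
          using less.prems Rhat_Phi by (subst Uset_iff) (auto simp: Uset_iff)
        then show ?thesis using False triv less.prems psi_one_if[of h] by auto
      next
        case True
        then obtain i j where ij: "(i, j) \<in> p" and ne: "h $$ (i, j) \<noteq> 0" by auto
        let ?x = "root_elt n (i, j) (- h $$ (i, j))"
        have x: "?x \<in> H" using root_elt_Uset[OF _ Rhat_Phi] ij p_Rhat by blast
        have hx: "h * ?x \<in> H" using Uset_mult[OF Rhat_Phi trans_Rhat less.prems x] .
        have eq: "(h * ?x) $$ (k, l) = (if (k, l) = (i, j) then 0 else h $$ (k, l))" if kl: "(k, l) \<in> p" for k l
          using mult_entry_H[OF less.prems x kl] p_less[OF kl] by (auto simp: root_elt_entry)
        have "{kl \<in> p. (h * ?x) $$ kl \<noteq> 0} = {kl \<in> p. h $$ kl \<noteq> 0} - {(i, j)}"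
          using eq by (auto split: if_splits)
        then have "card {kl \<in> p. (h * ?x) $$ kl \<noteq> 0} < card {kl \<in> p. h $$ kl \<noteq> 0}"
          using ij ne finite_p by (intro psubset_card_mono) auto
        then have "\<phi> (h * ?x) = psi (h * ?x)" using less.hyps hx by blast
        then have "\<phi> h * \<phi> ?x = psi h * psi ?x" using mult psi_mult less.prems x by simp
        moreover have "\<phi> ?x = psi ?x" "\<phi> ?x \<noteq> 0"
          using root ij psi_root_elt[OF ij] \<theta>_nonzero by auto
        ultimately show ?thesis by simp
      qed
    qed
  qed
qed

lemma psi_char_eq: "psi_char \<theta> n A = psi"
  unfolding psi_char_def
proof (rule the_equality)
  show "linear_character ((GL n)\<lparr>carrier := H\<rparr>) psi \<and>
     (\<forall>u\<in>Uset n (Rhat n p - p). psi u = 1) \<and>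
     (\<forall>ij\<in>p. \<forall>\<alpha>. psi (root_elt n ij \<alpha>) = \<theta> (\<alpha> * A $$ ij))"
  proof (intro conjI ballI allI)
    show "linear_character ((GL n)\<lparr>carrier := H\<rparr>) psi"
      using \<theta>_nonzero psi_mult by (auto simp: linear_character_def GL_simps psi_def)
    fix u :: "'a mat" assume u: "u \<in> Uset n (Rhat n p - p)"
    then have "u \<in> H" using Uset_mono[of "Rhat n p - p" "Rhat n p" n] by auto
    moreover have "u $$ (i, j) = 0" if "(i, j) \<in> p" for i j
    proof (rule UsetD(3))
      show "Rhat n p - p \<subseteq> Phi n" using Rhat_Phi by blast
    qed (use that u p_less[OF that] in auto)
    ultimately show "psi u = 1" by (rule psi_one_if)
  next
    fix ij \<alpha> assume "ij \<in> p"
    then show "psi (root_elt n ij \<alpha>) = \<theta> (\<alpha> * A $$ ij)"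
      using psi_root_elt by (cases ij) auto
  qed
qed (use linear_character_unique in blast)

lemma psi_one: "psi (1\<^sub>m n) = 1"
proof (rule psi_one_if)
  fix i j assume "(i, j) \<in> p"
  from p_less[OF this] show "1\<^sub>m n $$ (i, j) = (0 :: 'a)" by simp
qed (rule one_Uset[OF Rhat_Phi])

lemma psi_inv: "h \<in> H \<Longrightarrow> psi h * psi (gl_inv n h) = 1"
  using psi_mult[of h "gl_inv n h"] Uset_inv[OF Rhat_Phi trans_Rhat, of h] psi_one by simp

lemma psi_cnj: "h \<in> H \<Longrightarrow> cnj (psi h) = psi (gl_inv n h)"
proof -
  assume h: "h \<in> H"
  have "psi h * cnj (psi h) = 1" using h by (simp add: psi_def \<theta>_cnj \<theta>_add[symmetric] \<theta>_0)
  then have "psi h * cnj (psi h) = psi h * psi (gl_inv n h)" "psi h \<noteq> 0" using psi_inv[OF h] by auto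
  then show ?thesis by simp
qed

sublocale character_idempotent "GL n :: 'a mat monoid" U H psi
proof -
  interpret finite_group_subgroup "GL n :: 'a mat monoid" U by (rule subgroup_U)
  show "character_idempotent (GL n :: 'a mat monoid) U H psi"
    by (intro character_idempotent.intro character_idempotent_axioms.intro subgroup_U
        subgroup_Uset Rhat_Phi trans_Rhat H_U)
       (auto simp: GL_simps psi_mult psi_one psi_cnj)
qed

lemma eps_idem_eq: "eps_idem \<theta> n A = eps"
  by (subst eps_sum) (simp add: eps_idem_def psi_char_eq cscale_sum)

end

section \<open>The orbit module of a lidempotent\<close>

lemma sum_Phi:
  fixes f :: "nat \<times> nat \<Rightarrow> 'b::comm_monoid_add"
  shows "(\<Sum>ij\<in>Phi n. f ij) = (\<Sum>i<n. \<Sum>j<n. if j < i then f (i, j) else 0)"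
proof -
  have "(\<Sum>i<n. \<Sum>j<n. if j < i then f (i, j) else 0)
      = (\<Sum>ij\<in>{..<n} \<times> {..<n}. if ij \<in> Phi n then f ij else 0)"
    by (subst sum.cartesian_product) (auto intro!: sum.cong simp: Phi_def)
  also have "\<dots> = (\<Sum>ij\<in>Phi n. f ij)"
    by (subst sum.inter_restrict[symmetric]) (auto intro!: sum.cong simp: Phi_def)
  finally show ?thesis by simp
qed

lemma sum_Phi_Vset:
  assumes "B \<in> Vset n (Phi n)"
  shows "(\<Sum>ij\<in>Phi n. B $$ ij * f ij) = (\<Sum>i<n. \<Sum>j<n. B $$ (i, j) * f (i, j))"
  unfolding sum_Phi using assms by (intro sum.cong) (auto simp: Vset_iff Phi_def)

text \<open>The strictly lower part of \<open>B\<close> times the transpose of \<open>k\<close>. Up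
  to a scalar, the lidempotent of \<open>B\<close> multiplied on the right by the inverse of
  \<open>k\<close> is the one labelled by this matrix.\<close>

definition twist :: "nat \<Rightarrow> 'a::field mat \<Rightarrow> 'a mat \<Rightarrow> 'a mat" where
  "twist n B k = mat n n (\<lambda>(i, c). if c < i then \<Sum>j<n. B $$ (i, j) * k $$ (c, j) else 0)"

lemma twist_Vset: "twist n B k \<in> Vset n (Phi n)"
  by (auto simp: Vset_iff twist_def Phi_def)

text \<open>In the entrywise pairing, the right factor \<open>k\<close> moves over to
  \<open>B\<close> as its transpose. The diagonal of \<open>w\<close> consists of ones and
  contributes the term that is independent of \<open>w\<close>; above the diagonal \<open>w\<close>
  vanishes.\<close>

lemma pairing_twist:
  fixes B w k :: "'a::field mat"
  assumes B: "B \<in> Vset n (Phi n)" and w: "w \<in> Uset n (Phi n)" and k: "k \<in> Uset n (Phi n)"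
  shows "(\<Sum>ij\<in>Phi n. B $$ ij * (w * k - 1\<^sub>m n) $$ ij)
    = (\<Sum>ij\<in>Phi n. twist n B k $$ ij * (w - 1\<^sub>m n) $$ ij) + (\<Sum>ij\<in>Phi n. B $$ ij * k $$ ij)"
proof -
  note U = UsetD(1,2)[OF subset_refl] Uset_upper_zero[OF subset_refl]
  define T where "T i c = (\<Sum>j<n. B $$ (i, j) * k $$ (c, j))" for i c
  have "(\<Sum>ij\<in>Phi n. B $$ ij * (w * k - 1\<^sub>m n) $$ ij) = (\<Sum>ij\<in>Phi n. B $$ ij * (w * k) $$ ij)"
    using U[OF w] U[OF k] by (intro sum.cong) (auto simp: Phi_def)
  also have "\<dots> = (\<Sum>i<n. \<Sum>j<n. B $$ (i, j) * (\<Sum>c<n. w $$ (i, c) * k $$ (c, j)))"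
    unfolding sum_Phi_Vset[OF B] using U(1)[OF w] U(1)[OF k]
    by (intro sum.cong refl) (simp add: mult_entry[of _ n] del: index_mult_mat)
  also have "\<dots> = (\<Sum>i<n. \<Sum>c<n. w $$ (i, c) * T i c)"
    unfolding T_def sum_distrib_left by (subst sum.swap) (simp add: mult_ac)
  also have "\<dots> = (\<Sum>i<n. (\<Sum>c<n. if c < i then T i c * w $$ (i, c) else 0) + T i i)"
  proof (rule sum.cong[OF refl])
    fix i assume i: "i \<in> {..<n}"
    have "(\<Sum>c<n. w $$ (i, c) * T i c) = (\<Sum>c<n. (if c < i then T i c * w $$ (i, c) else 0) + (if c = i then T i i else 0))"
    proof (rule sum.cong[OF refl])
      fix c assume "c \<in> {..<n}"
      then show "w $$ (i, c) * T i c = (if c < i then T i c * w $$ (i, c) else 0) + (if c = i then T i i else 0)"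
        using U(2,3)[OF w] i by (cases c i rule: linorder_cases) auto
    qed
    then show "(\<Sum>c<n. w $$ (i, c) * T i c) = (\<Sum>c<n. if c < i then T i c * w $$ (i, c) else 0) + T i i"
      using i by (simp add: sum.distrib)
  qed
  also have "\<dots> = (\<Sum>i<n. \<Sum>c<n. if c < i then T i c * w $$ (i, c) else 0) + (\<Sum>i<n. T i i)"
    by (simp add: sum.distrib)
  also have "(\<Sum>i<n. T i i) = (\<Sum>ij\<in>Phi n. B $$ ij * k $$ ij)"
    unfolding sum_Phi_Vset[OF B] T_def by simp
  also have "(\<Sum>i<n. \<Sum>c<n. if c < i then T i c * w $$ (i, c) else 0)
      = (\<Sum>ij\<in>Phi n. twist n B k $$ ij * (w - 1\<^sub>m n) $$ ij)"
    unfolding sum_Phi T_def using U(1)[OF w] by (intro sum.cong refl) (auto simp: twist_def)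
  finally show ?thesis .
qed

context additive_character
begin

lemma lidem_eq:
  "lidem \<theta> n B = (\<lambda>u. if u \<in> Uset n (Phi n)
    then cnj (chi_char \<theta> (Phi n) B (u - 1\<^sub>m n)) / of_nat CARD('a) ^ card (Phi n) else 0)"
proof -
  have "(\<Sum>u\<in>Uset n (Phi n). cscale (f u) (delta u)) = (\<lambda>u. if u \<in> Uset n (Phi n) then f u else 0)"
    for f :: "'a mat \<Rightarrow> complex"
    by (subst vanishing_off_expand[OF finite_Uset[of n "Phi n"]]) (auto simp: vanishing_off_def intro!: sum.cong)
  then show ?thesis unfolding lidem_def by (auto simp: cscale_def fun_eq_iff)
qed

lemma lidem_vanishing_off: "lidem \<theta> n B \<in> vanishing_off (Uset n (Phi n))"
  by (simp add: lidem_eq vanishing_off_def)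

lemma lidem_conv_delta:
  assumes B: "B \<in> Vset n (Phi n)" and u: "u \<in> Uset n (Phi n)"
  shows "gl_mult n (lidem \<theta> n B) (delta u) =
    cscale (cnj (\<theta> (\<Sum>ij\<in>Phi n. B $$ ij * (gl_inv n u) $$ ij))) (lidem \<theta> n (twist n B (gl_inv n u)))"
    (is "?l = ?r")
proof
  interpret finite_group_subgroup "GL n :: 'a mat monoid" "Uset n (Phi n)" by (rule subgroup_U)
  fix w
  show "?l w = ?r w"
  proof (cases "w \<in> Uset n (Phi n)")
    case True
    note k = Uset_inv(1)[OF subset_refl trans_Phi u]
    have "w * gl_inv n u \<in> Uset n (Phi n)" by (rule Uset_mult[OF subset_refl trans_Phi True k])
    then show ?thesis using u True U_carrier
      by (simp add: conv_delta_right_apply GL_simps(1))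
        (simp add: lidem_eq cscale_def chi_char_def pairing_twist[OF B True k] \<theta>_add)
  next
    case False
    have "?l \<in> vanishing_off (Uset n (Phi n))"
      by (rule conv_U_vanishing_off[OF lidem_vanishing_off delta_U[OF u]])
    then show ?thesis using False by (simp add: vanishing_offD cscale_def lidem_eq)
  qed
qed

end

section \<open>Action of the lidempotent on the ideal: scalars and injectivity\<close>

context hook_disconnected
begin

abbreviation "a \<equiv> lidem \<theta> n A"

lemma psi_nonzero: "h \<in> H \<Longrightarrow> psi h \<noteq> 0"
  by (simp add: psi_def \<theta>_nonzero)

lemma a_vanishing: "a \<in> vanishing_off U"
  by (rule lidem_vanishing_off)

text \<open>The labels occurring in the orbit of \<open>a\<close> have this shape by
  \<open>arm_shaped_twist_A\<close>, and clearing a row preserves it, so an induction can run over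
  such labels.\<close>

definition arm_shaped :: "'a mat \<Rightarrow> bool" where
  "arm_shaped B \<longleftrightarrow> B \<in> Vset n (Phi n) \<and> (\<forall>i<n. \<forall>c<n. (\<forall>j. (i, j) \<in> p \<longrightarrow> c < j) \<longrightarrow> B $$ (i, c) = 0) \<and>
     (\<forall>(i, j)\<in>p. B $$ (i, j) = A $$ (i, j))"

text \<open>
  The rows of \<open>B\<close> are cleared from the bottom to the top. An entry at \<open>(t, c)\<close> to the right of the
  position of \<open>p\<close> in row \<open>t\<close> either makes the root subgroup at \<open>(t, c)\<close> act by a character
  different from \<open>psi\<close>, or \<open>c\<close> is a column of \<open>p\<close> whose position lies further down, and then a root element
  of \<open>H\<close> clears the entry.
\<close>

lemma lidem_eps_arm_shaped:
  assumes "arm_shaped B" "t \<le> n" "\<And>i c. t \<le> i \<Longrightarrow> i < n \<Longrightarrow> c < n \<Longrightarrow> B $$ (i, c) = A $$ (i, c)"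
  shows "\<exists>c. gl_mult n (lidem \<theta> n B) eps = cscale c (gl_mult n a eps)"
  using assms
proof (induction t arbitrary: B)
  case 0
  then have "B = A" using A_carrier by (intro eq_matI) (auto simp: arm_shaped_def Vset_iff)
  then show ?case by (intro exI[of _ 1]) simp
next
  case (Suc t)
  note pure = Suc.prems(3)
  have tn: "t < n" using Suc.prems by simp
  have B: "B \<in> Vset n (Phi n)" and B0: "\<And>i c. i < n \<Longrightarrow> c < n \<Longrightarrow> (\<And>j. (i, j) \<in> p \<Longrightarrow> c < j) \<Longrightarrow> B $$ (i, c) = 0"
    and Bp: "\<And>i j. (i, j) \<in> p \<Longrightarrow> B $$ (i, j) = A $$ (i, j)"
    using Suc.prems(1) by (auto simp: arm_shaped_def)
  show ?case
  proof (cases "\<exists>j. (t, j) \<in> p")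
    \<comment> \<open>A row without a position of \<open>p\<close> is zero both in an arm shaped
      label and in \<open>A\<close>; there is nothing to clear.\<close>
    case False
    have "B $$ (i, c) = A $$ (i, c)" if "t \<le> i" "i < n" "c < n" for i c
      using that pure[of i c] B0[of t c] False A_zero[of t c] by (cases "i = t") auto
    then show ?thesis using Suc.IH[of B] Suc.prems tn by simp
  next
    case True
    then obtain j where tj: "(t, j) \<in> p" by blast
    note jt = p_less[OF tj]
    define C where "C = {c. j < c \<and> c < t \<and> B $$ (t, c) \<noteq> 0}"
    show ?thesis
    proof (cases "\<exists>c\<in>C. (t, c) \<in> Rhat n p")
      case True
      then obtain c where c: "j < c" "c < t" "B $$ (t, c) \<noteq> 0" "(t, c) \<in> Rhat n p" by (auto simp: C_def)
      obtain \<alpha> where \<alpha>: "\<theta> (\<alpha> * B $$ (t, c)) \<noteq> 1" using \<theta>_nontrivial_mult[OF c(3)] by blast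
      let ?k = "root_elt n (t, c) \<alpha> :: 'a mat"
      have kH: "?k \<in> H" using root_elt_Uset[OF c(4) Rhat_Phi] .
      have kU: "?k \<in> U" using kH H_U by blast
      \<comment> \<open>The root element fixes the label only if column \<open>c\<close> of
        \<open>B\<close> vanishes below row \<open>t\<close>. There \<open>B\<close> equals
        \<open>A\<close>, and a position \<open>(i, c)\<close> of \<open>p\<close> would make
        \<open>t\<close> a column of \<open>p\<close>, although \<open>t\<close> is already a row of
        \<open>p\<close>.\<close>
      have "B $$ (i, c) = 0" if "t < i" "i < n" for i
      proof -
        have "(i, c) \<notin> p"
        proof
          assume "(i, c) \<in> p"
          then have "\<exists>r. (r, t) \<in> p" using c(4) \<open>t < i\<close> by (auto simp: Rhat_iff)
          then show False using p_disconnected[OF tj] by blast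
        qed
        then show ?thesis using pure[of i c] A_zero[of i c] that c by simp
      qed
      then have "twist n B ?k = B"
      proof (intro eq_matI)
        fix i l assume "i < dim_row B" "l < dim_col B"
        then have il: "i < n" "l < n" using B by (auto simp: Vset_iff)
        have "(\<Sum>m<n. B $$ (i, m) * ?k $$ (l, m)) = B $$ (i, l) + (if l = t then B $$ (i, c) * \<alpha> else 0)"
        proof (cases "l = t")
          case True
          have "(\<Sum>m<n. B $$ (i, m) * ?k $$ (l, m)) = B $$ (i, l) * ?k $$ (l, l) + B $$ (i, c) * ?k $$ (l, c)"
            using il c True by (intro sum_two_terms) (auto simp: root_elt_entry)
          then show ?thesis using il c True by (simp add: root_elt_entry)
        next
          case False
          then have "(\<Sum>m<n. B $$ (i, m) * ?k $$ (l, m)) = B $$ (i, l) * ?k $$ (l, l)"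
            using il by (intro sum_one_term) (auto simp: root_elt_entry)
          then show ?thesis using il False by (simp add: root_elt_entry)
        qed
        then show "twist n B ?k $$ (i, l) = B $$ (i, l)"
          using il \<open>\<And>i. t < i \<Longrightarrow> i < n \<Longrightarrow> B $$ (i, c) = 0\<close> VsetD[OF B, of i l]
          by (auto simp: twist_def Phi_def)
      qed (use B in \<open>auto simp: Vset_iff twist_def\<close>)
      moreover have "(\<Sum>ij\<in>Phi n. B $$ ij * ?k $$ ij) = \<alpha> * B $$ (t, c)"
      proof -
        have "(\<Sum>ij\<in>Phi n. B $$ ij * ?k $$ ij) = (\<Sum>ij\<in>Phi n. if ij = (t, c) then \<alpha> * B $$ (t, c) else 0)"
          by (intro sum.cong refl) (auto simp: Phi_def root_elt_entry split: if_splits)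
        then show ?thesis using finite_Phi c tn by (simp add: Phi_def)
      qed
      ultimately have "gl_mult n (lidem \<theta> n B) (delta (gl_inv n ?k))
          = cscale (cnj (\<theta> (\<alpha> * B $$ (t, c)))) (lidem \<theta> n B)"
        using lidem_conv_delta[OF B Uset_inv(1)[OF subset_refl trans_Phi kU]] kU U_carrier by simp
      moreover have "psi ?k = 1"
      proof (rule psi_one_if[OF kH])
        fix k l assume kl: "(k, l) \<in> p"
        show "?k $$ (k, l) = 0" using p_less[OF kl] p_row[OF tj] kl c by (auto simp: root_elt_entry)
      qed
      then have "psi (gl_inv n ?k) = 1" using psi_inv[OF kH] by simp
      \<comment> \<open>The inverse root element scales the lidempotent by a factor other than 1,
        but \<open>eps\<close> by 1, so their product is zero and the multiplier 0 serves.\<close>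
      ultimately have "cscale (cnj (\<theta> (\<alpha> * B $$ (t, c)))) (gl_mult n (lidem \<theta> n B) eps) = gl_mult n (lidem \<theta> n B) eps"
        using conv_delta_eps[OF Uset_inv(1)[OF Rhat_Phi trans_Rhat kH], of "lidem \<theta> n B"]
        by (simp add: conv_cscale_left)
      then have "cscale (1 - cnj (\<theta> (\<alpha> * B $$ (t, c)))) (gl_mult n (lidem \<theta> n B) eps) = 0"
        by (simp add: cscale_def fun_eq_iff algebra_simps)
      moreover have "1 - cnj (\<theta> (\<alpha> * B $$ (t, c))) \<noteq> 0"
        using \<alpha> by (metis complex_cnj_cnj complex_cnj_one right_minus_eq)
      ultimately have "gl_mult n (lidem \<theta> n B) eps = 0" by (simp add: cscale_eq_0_iff)
      then show ?thesis by (intro exI[of _ 0]) simp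
    next
      case False
      \<comment> \<open>Since \<open>(t, c)\<close> is not in \<open>Rhat\<close>, some
        \<open>(r, c)\<close> in \<open>p\<close> has \<open>t < r\<close>. With
        \<open>(t, j)\<close> it forms a pair as in the definition of \<open>Rhat\<close>, which
        puts \<open>(c, j)\<close> into \<open>Rhat\<close>.\<close>
      have C: "\<exists>r. (r, c) \<in> p \<and> t < r" "(c, j) \<in> Rhat n p" if "c \<in> C" for c
      proof -
        have "c < t" "j < c" "(t, c) \<notin> Rhat n p" using that False by (auto simp: C_def)
        then show *: "\<exists>r. (r, c) \<in> p \<and> t < r" using tn by (force simp: Rhat_iff)
        have "i = t" if "(i, j) \<in> p" for i using p_col[OF that tj] .
        then show "(c, j) \<in> Rhat n p" using * \<open>c < t\<close> \<open>j < c\<close> tn by (auto simp: Rhat_iff)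
      qed
      \<comment> \<open>The twist adds \<open>A $$ (t, j) * \<gamma> c\<close> to the entry at
        \<open>(t, c)\<close>; with this choice all unwanted entries of row \<open>t\<close> are
        cleared at once.\<close>
      define \<gamma> where "\<gamma> c = (if c \<in> C then - B $$ (t, c) / A $$ (t, j) else 0)" for c
      define k where "k = mat n n (\<lambda>(c, l). if c = l then 1 else if l = j then \<gamma> c else 0)"
      have kH: "k \<in> H"
        using C(2) by (subst Uset_iff[OF Rhat_Phi]) (auto simp: k_def \<gamma>_def split: if_splits)
      have kU: "k \<in> U" using kH H_U by blast
      let ?B = "twist n B k"
      have "j \<notin> C" by (simp add: C_def)
      have entry: "?B $$ (i, c) = B $$ (i, c) + B $$ (i, j) * \<gamma> c" if "c < i" "i < n" for i c
      proof -
        have "(\<Sum>m<n. B $$ (i, m) * k $$ (c, m)) = B $$ (i, c) + B $$ (i, j) * \<gamma> c"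
        proof (cases "c = j")
          case True
          have "(\<Sum>m<n. B $$ (i, m) * k $$ (c, m)) = B $$ (i, c) * k $$ (c, c)"
            using that True by (intro sum_one_term) (auto simp: k_def)
          then show ?thesis using that True \<open>j \<notin> C\<close> by (simp add: k_def \<gamma>_def)
        next
          case False
          have "(\<Sum>m<n. B $$ (i, m) * k $$ (c, m)) = B $$ (i, c) * k $$ (c, c) + B $$ (i, j) * k $$ (c, j)"
            using that jt False by (intro sum_two_terms) (auto simp: k_def)
          then show ?thesis using that jt False by (simp add: k_def)
        qed
        then show ?thesis using that by (simp add: twist_def)
      qed
      have upper: "?B $$ (i, c) = 0" if "i \<le> c" "i < n" "c < n" for i c
        using that by (simp add: twist_def)
      \<comment> \<open>The rows below \<open>t\<close> are untouched by the twist, since column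
        \<open>j\<close> has its only position of \<open>p\<close> in row \<open>t\<close>.\<close>
      have Bij: "B $$ (i, j) = 0" if "t < i" "i < n" for i
      proof -
        have "(i, j) \<notin> p" using p_col[OF tj] that by blast
        then show ?thesis using pure[of i j] A_zero[of i j] that jt by simp
      qed
      have shaped: "arm_shaped ?B"
        unfolding arm_shaped_def
      proof (intro conjI allI impI ballI; (clarify)?)
        show "?B \<in> Vset n (Phi n)" by (rule twist_Vset)
        fix i c assume ic: "i < n" "c < n" "\<forall>j. (i, j) \<in> p \<longrightarrow> c < j"
        show "?B $$ (i, c) = 0"
        proof (cases "c < i")
          case True
          have "B $$ (i, j) * \<gamma> c = 0"
          proof (cases "c \<in> C")
            case True
            then have "j < c" by (simp add: C_def)
            then have "B $$ (i, j) = 0" using ic jt by (intro B0) auto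
            then show ?thesis by simp
          qed (simp add: \<gamma>_def)
          then show ?thesis using entry[OF True ic(1)] B0[OF ic(1,2)] ic by simp
        qed (use ic upper in simp)
      next
        fix i l assume il: "(i, l) \<in> p"
        have "B $$ (i, j) * \<gamma> l = 0"
        proof (cases "l \<in> C")
          case True
          then obtain r where "(r, l) \<in> p" "t < r" using C(1) by blast
          then have "t < i" using p_col[OF il] by blast
          then show ?thesis using Bij p_less[OF il] by simp
        qed (simp add: \<gamma>_def)
        then show "?B $$ (i, l) = A $$ (i, l)" using entry p_less[OF il] Bp[OF il] by simp
      qed
      have pure': "?B $$ (i, c) = A $$ (i, c)" if "t \<le> i" "i < n" "c < n" for i c
      proof (cases "c < i")
        case False
        then have "(i, c) \<notin> p" using p_less(1)[of i c] by auto
        then show ?thesis using upper[of i c] A_zero[of i c] that False by simp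
      next
        case ci: True
        show ?thesis
        proof (cases "i = t")
          case False
          then show ?thesis using entry[OF ci] pure[of i c] Bij[of i] that by simp
        next
          case True
          consider "c < j" | "c = j" | "c \<in> C" | "j < c" "c \<notin> C" by linarith
          then show ?thesis
          proof cases
            case 1
            then have "B $$ (t, c) = 0" using p_row[OF tj] that True by (intro B0) auto
            moreover have "(t, c) \<notin> p" using p_row[OF tj] 1 by blast
            ultimately show ?thesis
              using 1 entry[OF ci] that True A_zero[of t c] by (simp add: \<gamma>_def C_def)
          next
            case 2
            then show ?thesis using entry[OF ci] that True Bp[OF tj] \<open>j \<notin> C\<close> by (simp add: \<gamma>_def)
          next
            case 3
            then have "(t, c) \<notin> p" using p_row[OF tj] by (auto simp: C_def)
            then show ?thesis using 3 entry[OF ci] that True A_zero[of t c] Bp[OF tj] tj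
              by (simp add: \<gamma>_def p_iff)
          next
            case 4
            then have "(t, c) \<notin> p" "B $$ (t, c) = 0" using p_row[OF tj] ci True by (auto simp: C_def)
            then show ?thesis using 4 entry[OF ci] that True A_zero[of t c] by (simp add: \<gamma>_def)
          qed
        qed
      qed
      obtain c where c: "gl_mult n (lidem \<theta> n ?B) eps = cscale c (gl_mult n a eps)"
        using Suc.IH[OF shaped _ pure'] tn by auto
      let ?h = "gl_inv n k"
      have h: "?h \<in> H" by (rule Uset_inv(1)[OF Rhat_Phi trans_Rhat kH])
      obtain s where "gl_mult n (lidem \<theta> n B) (delta ?h) = cscale s (lidem \<theta> n ?B)"
        using lidem_conv_delta[OF B Uset_inv(1)[OF subset_refl trans_Phi kU]] kU U_carrier by simp
      then have "cscale (psi ?h) (gl_mult n (lidem \<theta> n B) eps) = cscale (s * c) (gl_mult n a eps)"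
        using conv_delta_eps[OF h, of "lidem \<theta> n B"] c by (simp add: conv_cscale_left)
      then have "cscale (1 / psi ?h) (cscale (psi ?h) (gl_mult n (lidem \<theta> n B) eps))
          = cscale (1 / psi ?h) (cscale (s * c) (gl_mult n a eps))" by simp
      then show ?thesis using psi_nonzero[OF h] by auto
    qed
  qed
qed

lemma twist_A_entry:
  assumes "(i, j) \<in> p" "c < i"
  shows "twist n A k $$ (i, c) = A $$ (i, j) * k $$ (c, j)"
proof -
  note b = p_less[OF assms(1)]
  have "(\<Sum>m<n. A $$ (i, m) * k $$ (c, m)) = A $$ (i, j) * k $$ (c, j)"
  proof (rule sum_one_term)
    fix m assume "m < n" "m \<noteq> j"
    then have "A $$ (i, m) = 0" using p_row[OF assms(1)] b by (intro A_zero) auto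
    then show "A $$ (i, m) * k $$ (c, m) = 0" by simp
  qed (use b in auto)
  then show ?thesis using assms b by (simp add: twist_def)
qed

text \<open>The only nonzero entry of row \<open>i\<close> of \<open>A\<close> is at
  \<open>(i, j)\<close>, so that row of the twist is a multiple of column \<open>j\<close> of
  \<open>k\<close>, which starts with a 1 at \<open>j\<close>.\<close>

lemma arm_shaped_twist_A:
  assumes k: "k \<in> U"
  shows "arm_shaped (twist n A k)"
  unfolding arm_shaped_def
proof (intro conjI allI impI ballI; (clarify)?)
  note kD = UsetD(1,2)[OF subset_refl k] Uset_upper_zero[OF subset_refl k]
  show "twist n A k \<in> Vset n (Phi n)" by (rule twist_Vset)
  fix i c assume ic: "i < n" "c < n" "\<forall>j. (i, j) \<in> p \<longrightarrow> c < j"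
  show "twist n A k $$ (i, c) = 0"
  proof (cases "\<exists>j. (i, j) \<in> p")
    case True
    then obtain j where j: "(i, j) \<in> p" by blast
    then have "c < j" using ic by blast
    then show ?thesis using twist_A_entry[OF j, of c k] p_less[OF j] kD(3)[of c j] by simp
  next
    case False
    then show ?thesis using ic by (auto simp: twist_def A_zero)
  qed
next
  fix i j assume "(i, j) \<in> p"
  with twist_A_entry[OF this, of j k] p_less[OF this]
  show "twist n A k $$ (i, j) = A $$ (i, j)" using UsetD(2)[OF subset_refl k] by simp
qed

lemma a_delta_eps:
  assumes u: "u \<in> U"
  shows "\<exists>c. gl_mult n (gl_mult n a (delta u)) eps = cscale c (gl_mult n a eps)"
proof -
  note k = Uset_inv(1)[OF subset_refl trans_Phi u]
  obtain c where "gl_mult n (lidem \<theta> n (twist n A (gl_inv n u))) eps = cscale c (gl_mult n a eps)"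
    using lidem_eps_arm_shaped[OF arm_shaped_twist_A[OF k], of n] by auto
  then show ?thesis
    using lidem_conv_delta[OF A_Vset u] by (auto simp: conv_cscale_left)
qed

text \<open>The product is the character labelled by \<open>B - C\<close>, whose sum vanishes unless
  the label is zero.\<close>

lemma chi_char_orthogonal:
  fixes B C :: "'a mat"
  assumes B: "B \<in> Vset n (Phi n)" and C: "C \<in> Vset n (Phi n)"
  shows "(\<Sum>X\<in>Vset n (Phi n). chi_char \<theta> (Phi n) B X * cnj (chi_char \<theta> (Phi n) C X))
    = (if B = C then of_nat (card (Vset n (Phi n) :: 'a mat set)) else 0)"
proof -
  have BC: "B \<in> carrier_mat n n" "C \<in> carrier_mat n n" using B C by (auto simp: Vset_iff)
  have *: "chi_char \<theta> (Phi n) B X * cnj (chi_char \<theta> (Phi n) C X) = chi_char \<theta> (Phi n) (B - C) X" for X :: "'a mat"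
  proof -
    have "(\<Sum>ij\<in>Phi n. (B - C) $$ ij * X $$ ij) = (\<Sum>ij\<in>Phi n. B $$ ij * X $$ ij - C $$ ij * X $$ ij)"
      using BC by (intro sum.cong refl) (auto simp: Phi_def algebra_simps)
    then show ?thesis by (simp add: chi_char_def \<theta>_cnj \<theta>_add[symmetric] sum_subtractf)
  qed
  show ?thesis
  proof (cases "B = C")
    case True
    have "chi_char \<theta> (Phi n) (B - C) X = 1" for X :: "'a mat"
    proof -
      have "(\<Sum>ij\<in>Phi n. (B - C) $$ ij * X $$ ij) = 0"
        using BC True by (intro sum.neutral) (auto simp: Phi_def)
      then show ?thesis by (simp add: chi_char_def \<theta>_0)
    qed
    then show ?thesis using True unfolding * by simp
  next
    case False
    then obtain i j where ij: "i < n" "j < n" "B $$ (i, j) \<noteq> C $$ (i, j)"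
      using BC by (metis carrier_matD eq_matI)
    then have "(i, j) \<in> Phi n" using VsetD[OF B ij(1,2)] VsetD[OF C ij(1,2)] by metis
    moreover have "(B - C) $$ (i, j) \<noteq> 0" using ij BC by simp
    ultimately have "(\<Sum>X\<in>Vset n (Phi n). chi_char \<theta> (Phi n) (B - C) X) = 0"
      by (intro chi_char_sum_eq_0[of _ n]) (auto simp: Phi_def)
    then show ?thesis using False unfolding * by simp
  qed
qed

text \<open>For \<open>(i, j)\<close> in \<open>p\<close>, equal labels mean that column
  \<open>j\<close> of the inverses of \<open>u\<close> and \<open>v\<close> agrees above row
  \<open>i\<close>. As \<open>v\<close> is lower triangular, the entries of
  \<open>v * gl_inv n u\<close> in that part of the column agree with those of the identity.\<close>

lemma twist_A_stabilizer:
  assumes u: "u \<in> U" and v: "v \<in> U"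
    and eq: "twist n A (gl_inv n u) = twist n A (gl_inv n v)"
  shows "v * gl_inv n u \<in> Uset n (Rset n p)"
proof -
  define k l where "k = gl_inv n u" and "l = gl_inv n v"
  have k: "k \<in> U" and l: "l \<in> U" using Uset_inv(1)[OF subset_refl trans_Phi] u v by (auto simp: k_def l_def)
  have vk: "v * k \<in> U" by (rule Uset_mult[OF subset_refl trans_Phi v k])
  have kl: "k $$ (c, j) = l $$ (c, j)" if ij: "(i, j) \<in> p" and c: "c < i" for i j c
    using twist_A_entry[OF ij c, of k] twist_A_entry[OF ij c, of l] eq ij
    by (simp add: k_def l_def p_iff)
  have "(v * k) $$ (c, j) = 0" if ij: "(i, j) \<in> p" and c: "c < i" "c \<noteq> j" for i j c
  proof -
    note b = p_less[OF ij]
    have "(v * k) $$ (c, j) = (\<Sum>m<n. v $$ (c, m) * k $$ (m, j))"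
      using v k b c UsetD(1)[OF subset_refl] by (intro mult_entry) auto
    also have "\<dots> = (\<Sum>m<n. v $$ (c, m) * l $$ (m, j))"
    proof (rule sum.cong[OF refl])
      fix m assume "m \<in> {..<n}"
      then show "v $$ (c, m) * k $$ (m, j) = v $$ (c, m) * l $$ (m, j)"
        using kl[OF ij, of m] Uset_upper_zero[OF subset_refl v, of c m] c by (cases "m < i") auto
    qed
    also have "\<dots> = (v * l) $$ (c, j)"
      using v l b c UsetD(1)[OF subset_refl] by (intro mult_entry[symmetric]) auto
    also have "\<dots> = 0"
      using Uset_inv(3)[OF subset_refl trans_Phi v] b c by (simp add: l_def)
    finally show ?thesis .
  qed
  then have "v * k \<in> Uset n (Rset n p)"
    using vk Uset_iff[OF subset_refl, of "v * k"] Uset_iff[OF Rset_Phi, of "v * k"]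
    by (auto simp: Rset_iff Phi_def not_le)
  then show ?thesis by (simp add: k_def)
qed

text \<open>Write \<open>a * x\<close> as a combination of lidempotents with labels
  \<open>B u\<close>. Pairing it with the character labelled \<open>B v\<close> retains the
  \<open>u\<close> with \<open>B u = B v\<close>. All these \<open>u\<close> contribute the same
  amount, so nothing cancels and \<open>x v\<close> must be 0.\<close>

lemma a_injective:
  assumes x: "x \<in> eps_ideal" and 0: "gl_mult n a x = 0"
  shows "x = 0"
proof
  fix v
  have xU: "x \<in> vanishing_off U" using x by (simp add: eps_ideal_def)
  show "x v = (0 :: 'a mat \<Rightarrow> complex) v"
  proof (cases "v \<in> U")
    case False
    then show ?thesis using xU by (simp add: vanishing_offD)
  next
    case v: True
    let ?V = "Vset n (Phi n) :: 'a mat set"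
    define s where "s u = cnj (\<theta> (\<Sum>ij\<in>Phi n. A $$ ij * (gl_inv n u) $$ ij))" for u
    define B where "B u = twist n A (gl_inv n u)" for u
    have BV: "B u \<in> ?V" for u by (simp add: B_def twist_Vset)
    have eq: "(\<Sum>u\<in>U. x u * s u * cnj (chi_char \<theta> (Phi n) (B u) X)) = 0" if X: "X \<in> ?V" for X
    proof -
      have X1: "1\<^sub>m n + X - 1\<^sub>m n = X" using X by (intro eq_matI) (auto simp: Vset_iff)
      have "gl_mult n a x = (\<Sum>u\<in>U. cscale (x u) (cscale (s u) (lidem \<theta> n (B u))))"
        unfolding s_def B_def
        by (subst conv_expand[OF U.subset xU]) (auto intro!: sum.cong simp: lidem_conv_delta[OF A_Vset])
      then have "gl_mult n a x (1\<^sub>m n + X) =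
          (\<Sum>u\<in>U. x u * (s u * (cnj (chi_char \<theta> (Phi n) (B u) X) / of_nat CARD('a) ^ card (Phi n))))"
        using one_plus_Uset[OF X] by (simp add: sum_fun_apply cscale_def lidem_eq X1)
      also have "\<dots> = (\<Sum>u\<in>U. x u * s u * cnj (chi_char \<theta> (Phi n) (B u) X)) / of_nat CARD('a) ^ card (Phi n)"
        by (simp add: sum_divide_distrib mult.assoc)
      finally show ?thesis using 0 by simp
    qed
    \<comment> \<open>Here \<open>u\<close> is the inverse of \<open>w'\<close> times
      \<open>v\<close>. Covariance of \<open>x\<close> produces \<open>psi w'\<close>, the scalar
      \<open>s\<close> produces its conjugate, and the two cancel.\<close>
    have same: "x u * s u = x v * s v" if u: "u \<in> U" and Bu: "B u = B v" for u
    proof -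
      define w' where "w' = v * gl_inv n u"
      have w'R: "w' \<in> Uset n (Rset n p)"
        using twist_A_stabilizer[OF u v] Bu by (simp add: w'_def B_def)
      then have w'H: "w' \<in> H" using Uset_mono[OF Rset_Rhat] by blast
      let ?w = "gl_inv n w'"
      have wH: "?w \<in> H" using w'H by blast
      have uw: "u = ?w * v" and lw: "gl_inv n u = gl_inv n v * w'"
        using u v U_carrier inv_mult_group[of v "gl_inv n u"] m_assoc[of u "gl_inv n v" v]
          m_assoc[of "gl_inv n v" v "gl_inv n u"] Uset_inv[OF subset_refl trans_Phi v]
          UsetD(1)[OF subset_refl u] UsetD(1)[OF subset_refl Uset_inv(1)[OF subset_refl trans_Phi u]]
        by (simp_all add: w'_def GL_simps(1,2))
      have "x u = psi w' * x v" using x wH v uw w'H H_carrier by (simp add: eps_ideal_iff GL_simps(1))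
      moreover have "s u = s v * cnj (psi w')"
      proof -
        have vU: "gl_inv n v \<in> U" using v by blast
        \<comment> \<open>The inverse of \<open>v\<close> need not lie in \<open>H\<close>, so
          \<open>mult_entry_H\<close> does not apply; the middle terms vanish because
          \<open>w'\<close> has no entries between the diagonal and row \<open>i\<close> in column
          \<open>j\<close>.\<close>
        have entry: "(gl_inv n v * w') $$ (i, j) = (gl_inv n v) $$ (i, j) + w' $$ (i, j)" if ij: "(i, j) \<in> p" for i j
        proof (rule mult_entry_p)
          fix k assume k: "j < k" "k < i"
          then have "w' $$ (k, j) = 0" using p_less[OF ij] ij
            by (intro UsetD(3)[OF Rset_Phi w'R]) (auto simp: Rset_iff)
          then show "(gl_inv n v) $$ (i, k) * w' $$ (k, j) = 0" by simp
        qed (use vU w'H H_U ij in auto)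
        have Phi_p: "(\<Sum>ij\<in>Phi n. A $$ ij * f ij) = (\<Sum>ij\<in>p. A $$ ij * f ij)" for f
          using p_Phi finite_Phi by (intro sum.mono_neutral_right) (auto simp: Phi_def A_zero)
        have "(\<Sum>ij\<in>p. A $$ ij * (gl_inv n v * w') $$ ij)
            = (\<Sum>ij\<in>p. A $$ ij * (gl_inv n v) $$ ij + A $$ ij * w' $$ ij)"
          using entry by (intro sum.cong refl) (auto simp: algebra_simps)
        then show ?thesis
          using w'H unfolding s_def lw Phi_p by (simp add: psi_def sum.distrib \<theta>_add)
      qed
      moreover have "psi w' * cnj (psi w') = 1" using psi_cnj[OF w'H] psi_inv[OF w'H] by simp
      ultimately show ?thesis by (simp add: mult_ac)
    qed
    have "(0::complex) = (\<Sum>X\<in>?V. chi_char \<theta> (Phi n) (B v) X * (\<Sum>u\<in>U. x u * s u * cnj (chi_char \<theta> (Phi n) (B u) X)))"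
      using eq by simp
    also have "\<dots> = (\<Sum>u\<in>U. x u * s u * (\<Sum>X\<in>?V. chi_char \<theta> (Phi n) (B v) X * cnj (chi_char \<theta> (Phi n) (B u) X)))"
      unfolding sum_distrib_left by (subst sum.swap) (simp add: mult_ac)
    also have "\<dots> = (\<Sum>u\<in>U. if B u = B v then x v * s v * of_nat (card ?V) else 0)"
      unfolding chi_char_orthogonal[OF BV BV] by (intro sum.cong refl) (auto simp: same)
    also have "\<dots> = of_nat (card {u \<in> U. B u = B v}) * (x v * s v * of_nat (card ?V))"
      by (subst sum.inter_filter[symmetric]) (auto simp: finite_Uset)
    finally have "of_nat (card {u \<in> U. B u = B v}) * (x v * s v * of_nat (card ?V)) = (0::complex)" by simp
    moreover have "card {u \<in> U. B u = B v} \<noteq> 0"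
      using v finite_Uset[of n "Phi n", where ?'a = 'a] by (auto simp: card_eq_0_iff)
    moreover have "card ?V \<noteq> 0" using A_Vset finite_Vset[of n "Phi n", where ?'a = 'a] by (auto simp: card_eq_0_iff)
    moreover have "s v \<noteq> 0" by (simp add: s_def \<theta>_nonzero)
    ultimately show ?thesis by simp
  qed
qed

sublocale multiplicity_one_constituent "GL n :: 'a mat monoid" U H psi a
  by unfold_locales
    (use a_vanishing vanishing_off_mono[OF U.subset] a_delta_eps a_injective in auto)

lemma cyc_a_eq_lidem_orbit: "cyc a = cspan (lidem_orbit \<theta> n A)"
proof -
  interpret v: vector_space "cscale :: complex \<Rightarrow> ('a mat \<Rightarrow> complex) \<Rightarrow> _" by (rule vector_space_cscale)
  \<comment> \<open>\<open>lidem_orbit\<close> admits every scalar \<open>c\<close>; translation by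
    \<open>u\<close> is invertible, which rules out the scalar 0.\<close>
  have nz: "gl_mult n a (delta u) \<noteq> 0" if u: "u \<in> U" for u
  proof
    assume "gl_mult n a (delta u) = 0"
    then have "gl_mult n (gl_mult n a (delta u)) (delta (gl_inv n u)) = 0" by simp
    then have "a = 0"
      using u U_carrier a_vanishing_off by (simp add: conv_assoc conv_delta_delta conv_delta_one_right)
    then show False using conv_a_eps_nonzero by simp
  qed
  show ?thesis
  proof
    show "cyc a \<subseteq> cspan (lidem_orbit \<theta> n A)"
    proof
      fix y assume "y \<in> cyc a"
      then obtain x where x: "x \<in> vanishing_off U" "y = gl_mult n a x" by (auto simp: cyc_def)
      have "gl_mult n a (delta u) \<in> cspan (lidem_orbit \<theta> n A)" if u: "u \<in> U" for u
      proof -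
        obtain c where c: "gl_mult n a (delta u) = cscale c (lidem \<theta> n (twist n A (gl_inv n u)))"
          using lidem_conv_delta[OF A_Vset u] by blast
        then have "lidem \<theta> n (twist n A (gl_inv n u)) \<in> lidem_orbit \<theta> n A"
          using u twist_Vset unfolding lidem_orbit_def by blast
        then show ?thesis unfolding c cspan_def by (intro v.span_scale v.span_base)
      qed
      then show "y \<in> cspan (lidem_orbit \<theta> n A)"
        unfolding x(2) conv_expand[OF U.subset x(1)] cspan_def by (intro v.span_sum v.span_scale)
    qed
    show "cspan (lidem_orbit \<theta> n A) \<subseteq> cyc a"
      unfolding cspan_def
    proof (rule v.span_minimal)
      show "lidem_orbit \<theta> n A \<subseteq> cyc a"
      proof
        fix y assume "y \<in> lidem_orbit \<theta> n A"
        then obtain u c where u: "u \<in> U" "gl_mult n a (delta u) = cscale c y" by (auto simp: lidem_orbit_def)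
        then have "c \<noteq> 0" using nz by auto
        then have "y = cscale (1 / c) (gl_mult n a (delta u))" using u by simp
        moreover have "gl_mult n a (delta u) \<in> cyc a" using delta_U[OF u(1)] by (auto simp: cyc_def)
        ultimately show "y \<in> cyc a" using right_stable_cscale[OF right_stable_cyc] by simp
      qed
      show "v.subspace (cyc a)"
        using right_stable_cyc[of a] right_stable_cscale[OF right_stable_cyc]
        by (intro v.subspaceI) (auto simp: right_stable_def)
    qed
  qed
qed

end

section \<open>Permutation modules of two part compositions\<close>

locale two_part_tableau =
  fixes n m :: nat and s :: "nat list \<times> nat list"
  assumes row_standard: "row_standard n m s"
begin

abbreviation "row_word \<equiv> fst s @ snd s"
abbreviation "S2 \<equiv> set (snd s)"

lemma length_rows: "length (fst s) = n - m" "length (snd s) = m"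
  and set_row_word: "set row_word = {0..<n}"
  using row_standard by (auto simp: row_standard_def)

text \<open>In \<open>row_standard\<close> the length \<open>n - m\<close> is a truncated
  difference, so this bound has to be extracted from the entries of the second row.\<close>

lemma m_le_n: "m \<le> n"
proof -
  have "distinct (snd s)" using row_standard by (simp add: row_standard_def strict_sorted_iff)
  then have "m = card S2" using length_rows by (simp add: distinct_card)
  also have "\<dots> \<le> card {0..<n}" using set_row_word by (intro card_mono) auto
  finally show ?thesis by simp
qed

lemma length_row_word: "length row_word = n"
  using length_rows m_le_n by simp

lemma distinct_row_word: "distinct row_word"
  by (rule card_distinct) (use set_row_word length_row_word in simp)

lemma row_word_less: "a < n \<Longrightarrow> row_word ! a < n"
  using set_row_word length_row_word nth_mem[of a row_word] by auto

lemma row_word_inj: "a < n \<Longrightarrow> b < n \<Longrightarrow> row_word ! a = row_word ! b \<longleftrightarrow> a = b"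
  using distinct_row_word length_row_word by (simp add: nth_eq_iff_index_eq)

lemma row_word_surj: "i < n \<Longrightarrow> \<exists>a<n. row_word ! a = i"
  using set_row_word length_row_word by (metis atLeastLessThan_iff in_set_conv_nth zero_le)

lemma row_word_S2: "a < n \<Longrightarrow> row_word ! a \<in> S2 \<longleftrightarrow> n - m \<le> a"
proof (cases "a < n - m")
  case True
  then have "row_word ! a \<in> set (fst s)" using length_rows by (simp add: nth_append)
  moreover have "set (fst s) \<inter> S2 = {}" using distinct_row_word by simp
  ultimately show ?thesis using True by auto
next
  case False
  assume "a < n"
  then show ?thesis using False length_rows m_le_n by (auto simp: nth_append)
qed

lemma Jset_iff: "(i, j) \<in> Jset n s \<longleftrightarrow> (i, j) \<in> Phi n \<and> i \<in> S2 \<and> j \<notin> S2"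
  and Lset_iff: "(i, j) \<in> Lset n s \<longleftrightarrow> (i, j) \<in> Phi n \<and> (i \<in> S2 \<longleftrightarrow> j \<in> S2)"
  and Kset_iff: "(i, j) \<in> Kset n s \<longleftrightarrow> (i, j) \<in> Phi n \<and> (j \<in> S2 \<longrightarrow> i \<in> S2)"
  by (auto simp: Jset_def Lset_def Kset_def)

lemma Jset_Phi: "Jset n s \<subseteq> Phi n" and Lset_Phi: "Lset n s \<subseteq> Phi n" and Kset_Phi: "Kset n s \<subseteq> Phi n"
  by (auto simp: Jset_def Lset_def Kset_def)

lemma trans_Jset: "trans (Jset n s)" and trans_Lset: "trans (Lset n s)" and trans_Kset: "trans (Kset n s)"
  by (auto simp: trans_def Jset_iff Lset_iff Kset_iff Phi_def)

lemma perm_mat_mult_entry: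
  assumes "B \<in> carrier_mat n n" "a < n" "j < n"
  shows "(perm_mat n s * B) $$ (a, j) = B $$ (row_word ! a, j)"
proof -
  have "(perm_mat n s * B) $$ (a, j) = (\<Sum>k<n. perm_mat n s $$ (a, k) * B $$ (k, j))"
    using assms by (intro mult_entry) (auto simp: perm_mat_def)
  also have "\<dots> = perm_mat n s $$ (a, row_word ! a) * B $$ (row_word ! a, j)"
    using assms row_word_less by (intro sum_one_term) (auto simp: perm_mat_def)
  finally show ?thesis using assms row_word_less by (simp add: perm_mat_def)
qed

lemma mult_perm_mat_entry:
  assumes "B \<in> carrier_mat n n" "i < n" "b < n"
  shows "(B * perm_mat n s) $$ (i, row_word ! b) = B $$ (i, b)"
proof -
  have "(B * perm_mat n s) $$ (i, row_word ! b) = (\<Sum>k<n. B $$ (i, k) * perm_mat n s $$ (k, row_word ! b))"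
    using assms row_word_less by (intro mult_entry) (auto simp: perm_mat_def)
  also have "\<dots> = B $$ (i, b) * perm_mat n s $$ (b, row_word ! b)"
    using assms row_word_less row_word_inj by (intro sum_one_term) (auto simp: perm_mat_def)
  finally show ?thesis using assms row_word_less by (simp add: perm_mat_def)
qed

lemma perm_mat_GL: "(perm_mat n s :: 'a::field mat) \<in> carrier (GL n)"
proof -
  let ?d = "perm_mat n s :: 'a mat"
  let ?e = "mat n n (\<lambda>(b, a). if b = row_word ! a then 1 else 0) :: 'a mat"
  have d: "?d \<in> carrier_mat n n" by (simp add: perm_mat_def)
  have "?d * ?e = 1\<^sub>m n"
  proof (rule eq_matI)
    fix a b assume "a < dim_row (1\<^sub>m n :: 'a mat)" "b < dim_col (1\<^sub>m n :: 'a mat)"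
    then show "(?d * ?e) $$ (a, b) = 1\<^sub>m n $$ (a, b)"
      by (subst perm_mat_mult_entry) (auto simp: row_word_less row_word_inj)
  qed (auto simp: perm_mat_def)
  moreover from this have "?e * ?d = 1\<^sub>m n"
    by (intro mat_mult_left_right_inverse[OF d]) auto
  ultimately show ?thesis
    using d unfolding GL_simps Units_def ring_mat_simps by (intro CollectI conjI bexI[of _ ?e]) auto
qed

end

locale verge_module = hook_disconnected \<theta> n A + two_part_tableau n m s
  for \<theta> :: "'a::{field,finite} \<Rightarrow> complex" and n A m s +
  assumes A_J: "A \<in> Vset n (Jset n s)"
begin

abbreviation "J \<equiv> Jset n s"
abbreviation "d \<equiv> perm_mat n s :: 'a mat"
abbreviation "P \<equiv> parabolic n m :: 'a mat set"

lemma d_GL: "d \<in> carrier (GL n)"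
  by (rule perm_mat_GL)

definition b :: "'a mat \<Rightarrow> complex" where
  "b = gl_mult n (\<Sum>h\<in>P. delta h) (delta d)"

lemma p_J: "p \<subseteq> J"
  using A_J by (auto simp: Vset_iff p_iff)

lemma p_S2: "(i, j) \<in> p \<Longrightarrow> i \<in> S2" "(i, j) \<in> p \<Longrightarrow> j \<notin> S2"
  using p_J by (auto simp: Jset_iff)

lemma P_GL: "g \<in> P \<Longrightarrow> g \<in> carrier (GL n)"
  by (simp add: parabolic_def)

lemma finite_P: "finite P"
  by (rule finite_subset[OF _ finite_carrier]) (auto simp: P_GL)

lemma P_mult: "g \<in> P \<Longrightarrow> h \<in> P \<Longrightarrow> g * h \<in> P"
proof -
  assume g: "g \<in> P" and h: "h \<in> P"
  have "(g * h) $$ (a, c) = 0" if "a < n" "n - m \<le> a" "c < n - m" for a c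
  proof -
    have "(g * h) $$ (a, c) = (\<Sum>k<n. g $$ (a, k) * h $$ (k, c))"
      using g h that by (intro mult_entry GL_carrier_mat P_GL) auto
    also have "\<dots> = 0"
    proof (rule sum.neutral, rule ballI)
      fix k assume "k \<in> {..<n}"
      then show "g $$ (a, k) * h $$ (k, c) = 0"
        using g h that by (cases "k < n - m") (auto simp: parabolic_def)
    qed
    finally show ?thesis .
  qed
  moreover have "g * h \<in> carrier (GL n)" using m_closed[OF P_GL[OF g] P_GL[OF h]] by (simp add: GL_simps(1))
  ultimately show "g * h \<in> P" by (auto simp: parabolic_def)
qed

text \<open>Conjugation by \<open>d\<close> moves the entry of \<open>l\<close> at two letters of
  the row word to the places of these letters. The zero block of \<open>P\<close> thus consists of
  the positions with row in \<open>S2\<close> and column outside; those above the diagonal vanish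
  anyway, the others form \<open>J\<close>.\<close>

lemma conjugate_P_iff:
  assumes l: "l \<in> U"
  shows "d \<otimes>\<^bsub>GL n\<^esub> l \<otimes>\<^bsub>GL n\<^esub> gl_inv n d \<in> P \<longleftrightarrow> (\<forall>(i, j)\<in>J. l $$ (i, j) = 0)"
proof -
  let ?q = "d \<otimes>\<^bsub>GL n\<^esub> l \<otimes>\<^bsub>GL n\<^esub> gl_inv n d"
  have q: "?q \<in> carrier (GL n)" using l U_carrier d_GL by simp
  have "?q \<otimes>\<^bsub>GL n\<^esub> d = d \<otimes>\<^bsub>GL n\<^esub> l" using l U_carrier d_GL by (simp add: m_assoc)
  then have "?q * d = d * l" by (simp add: GL_simps(1))
  then have entry: "?q $$ (a, c) = l $$ (row_word ! a, row_word ! c)" if "a < n" "c < n" for a c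
    using mult_perm_mat_entry[OF GL_carrier_mat[OF q] that]
      perm_mat_mult_entry[OF UsetD(1)[OF subset_refl l], of a "row_word ! c"] that row_word_less by simp
  show ?thesis
  proof
    assume qP: "?q \<in> P"
    show "\<forall>(i, j)\<in>J. l $$ (i, j) = 0"
    proof clarify
      fix i j assume ij: "(i, j) \<in> J"
      then obtain a c where ac: "a < n" "c < n" "row_word ! a = i" "row_word ! c = j"
        using row_word_surj[of i] row_word_surj[of j] by (auto simp: Jset_iff Phi_def)
      then have "n - m \<le> a" "c < n - m"
        using ij row_word_S2[of a] row_word_S2[of c] by (auto simp: Jset_iff)
      then have "?q $$ (a, c) = 0" using qP ac by (simp add: parabolic_def)
      then show "l $$ (i, j) = 0" using entry ac by simp
    qed
  next
    assume 0: "\<forall>(i, j)\<in>J. l $$ (i, j) = 0"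
    have "?q $$ (a, c) = 0" if "a < n" "n - m \<le> a" "c < n - m" for a c
    proof -
      let ?i = "row_word ! a" and ?j = "row_word ! c"
      have c: "c < n" using that by simp
      have S: "?i \<in> S2" "?j \<notin> S2" using that c row_word_S2 by auto
      have ij: "?i < n" "?j < n" using that c row_word_less by auto
      consider "?j < ?i" | "?i < ?j" using S by (metis linorder_neqE_nat)
      then have "l $$ (?i, ?j) = 0"
      proof cases
        case 1
        then show ?thesis using 0 S ij by (auto simp: Jset_iff Phi_def)
      qed (use Uset_upper_zero[OF subset_refl l] ij in auto)
      then show ?thesis using entry that c by simp
    qed
    then show "?q \<in> P" using q by (auto simp: parabolic_def)
  qed
qed

text \<open>Moving \<open>l\<close> to the left past \<open>d\<close> turns it into an element of
  \<open>P\<close>, and right multiplication by that element permutes \<open>P\<close>.\<close>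

lemma b_delta:
  assumes l: "l \<in> U" and 0: "\<And>i j. (i, j) \<in> J \<Longrightarrow> l $$ (i, j) = 0"
  shows "gl_mult n b (delta l) = b"
proof -
  let ?q = "d \<otimes>\<^bsub>GL n\<^esub> l \<otimes>\<^bsub>GL n\<^esub> gl_inv n d"
  have qP: "?q \<in> P" using 0 by (subst conjugate_P_iff[OF l]) auto
  have qd: "?q \<otimes>\<^bsub>GL n\<^esub> d = d \<otimes>\<^bsub>GL n\<^esub> l" using l U_carrier d_GL by (simp add: m_assoc)
  have inj: "inj_on (\<lambda>h. h * ?q) P"
  proof (rule inj_onI)
    fix g h assume "g \<in> P" "h \<in> P" "g * ?q = h * ?q"
    then show "g = h" using right_cancel[of ?q g h] P_GL[of g] P_GL[of h] P_GL[OF qP] by (simp add: GL_simps(1))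
  qed
  have "(\<lambda>h. h * ?q) ` P = P"
    by (rule endo_inj_surj[OF finite_P _ inj]) (use P_mult qP in auto)
  then have "(\<Sum>h\<in>P. delta h) = (\<Sum>h\<in>P. delta (h * ?q))"
    using sum.reindex[OF inj, of delta] by simp
  also have "\<dots> = gl_mult n (\<Sum>h\<in>P. delta h) (delta ?q)"
    using P_GL qP by (simp add: conv_sum_left conv_delta_delta GL_simps(1))
  finally have "b = gl_mult n (gl_mult n (\<Sum>h\<in>P. delta h) (delta ?q)) (delta d)"
    by (simp add: b_def)
  also have "\<dots> = gl_mult n (\<Sum>h\<in>P. delta h) (delta (?q \<otimes>\<^bsub>GL n\<^esub> d))"
    using P_GL[OF qP] d_GL by (simp add: conv_assoc conv_delta_delta)
  also have "\<dots> = gl_mult n b (delta l)"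
    unfolding qd using l U_carrier d_GL by (simp add: b_def conv_assoc conv_delta_delta)
  finally show ?thesis by simp
qed

definition y :: "'a mat \<Rightarrow> complex" where
  "y = gl_mult n b eps"

lemma y_eps: "gl_mult n y eps = y"
  by (simp add: y_def conv_assoc eps_eps)

lemma y_vanishing_off: "y \<in> vanishing_off (carrier (GL n))"
  by (simp add: y_def conv_vanishing_off)

lemma b_apply:
  assumes "g \<in> carrier (GL n)"
  shows "b g = (if g \<otimes>\<^bsub>GL n\<^esub> gl_inv n d \<in> P then 1 else 0)"
proof -
  have "b g = (\<Sum>h\<in>P. if g \<otimes>\<^bsub>GL n\<^esub> gl_inv n d = h then 1 else 0)"
    using assms d_GL unfolding b_def
    by (subst conv_delta_right_apply) (auto simp: sum_fun_apply delta_def)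
  then show ?thesis using finite_P by simp
qed

lemma y_nonzero: "y \<noteq> 0"
proof
  assume "y = 0"
  let ?D = "{h \<in> H. d \<otimes>\<^bsub>GL n\<^esub> gl_inv n h \<otimes>\<^bsub>GL n\<^esub> gl_inv n d \<in> P}"
  \<comment> \<open>At \<open>d\<close> only those \<open>h\<close> count whose inverse is
    conjugated into \<open>P\<close> by \<open>d\<close>. They have no entries at \<open>p\<close>,
    so all summands are equal and positive.\<close>
  have "y d = (\<Sum>h\<in>H. psi (gl_inv n h) / of_nat (card H) * b (d \<otimes>\<^bsub>GL n\<^esub> gl_inv n h))"
    unfolding y_def conv_eps sum_fun_apply
    by (intro sum.cong refl) (simp add: cscale_def conv_delta_right_apply d_GL H_carrier)
  also have "\<dots> = (\<Sum>h\<in>H. if h \<in> ?D then 1 / of_nat (card H) else 0)"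
  proof (rule sum.cong[OF refl])
    fix h assume h: "h \<in> H"
    then have ih: "gl_inv n h \<in> H" by blast
    have "psi (gl_inv n h) = 1" if "h \<in> ?D"
      using that conjugate_P_iff[of "gl_inv n h"] ih H_U p_J by (intro psi_one_if) auto
    then show "psi (gl_inv n h) / of_nat (card H) * b (d \<otimes>\<^bsub>GL n\<^esub> gl_inv n h)
        = (if h \<in> ?D then 1 / of_nat (card H) else 0)"
      using h H_carrier d_GL by (auto simp: b_apply)
  qed
  also have "\<dots> = of_nat (card ?D) / of_nat (card H)"
    by (subst sum.inter_filter[symmetric]) (auto simp: finite_H)
  finally have "of_nat (card ?D) / of_nat (card H) = (0::complex)" using \<open>y = 0\<close> by simp
  then have "card ?D = 0" using card_H_nonzero by simp
  moreover have "1\<^sub>m n \<in> ?D"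
  proof -
    have one: "1\<^sub>m n = \<one>\<^bsub>GL n\<^esub>" by (simp add: GL_simps)
    have "1\<^sub>m n \<in> P" using Uset_GL[OF subset_refl one_Uset[OF subset_refl]] by (auto simp: parabolic_def)
    then have "\<one>\<^bsub>GL n\<^esub> \<in> P" by (simp add: one)
    then show ?thesis using d_GL one_Uset[OF Rhat_Phi] by (simp add: one)
  qed
  ultimately show False using finite_H by auto
qed

end

section \<open>Calculations with matrices of prescribed support\<close>

lemma sum_Vset:
  assumes S: "S \<subseteq> {..<n} \<times> {..<n}" and B: "B \<in> Vset n S"
  shows "(\<Sum>ij\<in>S. B $$ ij * f ij) = (\<Sum>i<n. \<Sum>j<n. B $$ (i, j) * f (i, j))"
proof -
  have "(\<Sum>i<n. \<Sum>j<n. B $$ (i, j) * f (i, j)) = (\<Sum>ij\<in>{..<n} \<times> {..<n}. B $$ ij * f ij)"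
    by (simp add: sum.cartesian_product split_def)
  also have "\<dots> = (\<Sum>ij\<in>S. B $$ ij * f ij)"
    using S B by (intro sum.mono_neutral_right) (auto simp: Vset_iff)
  finally show ?thesis by simp
qed

lemma sum_swap_pairs:
  "(\<Sum>i\<in>I. \<Sum>j\<in>I'. \<Sum>u\<in>M. \<Sum>v\<in>M'. F i j u v) = (\<Sum>u\<in>M. \<Sum>v\<in>M'. \<Sum>i\<in>I. \<Sum>j\<in>I'. F i j u v)"
  unfolding sum.cartesian_product
  by (rule sum.reindex_bij_witness[of _ "\<lambda>(u, v, i, j). (i, j, u, v)" "\<lambda>(i, j, u, v). (u, v, i, j)"]) auto

lemma Vset_add: "X \<in> Vset n S \<Longrightarrow> Y \<in> Vset n S \<Longrightarrow> X + Y \<in> Vset n S"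
  by (auto simp: Vset_iff) (metis add.right_neutral)

lemma Vset_uminus: "X \<in> Vset n S \<Longrightarrow> - X \<in> Vset n S"
  by (auto simp: Vset_iff)

lemma Vset_carrier: "X \<in> Vset n S \<Longrightarrow> X \<in> carrier_mat n n"
  by (simp add: Vset_iff)

lemma one_plus_minus_one: "X \<in> carrier_mat n n \<Longrightarrow> 1\<^sub>m n + X - 1\<^sub>m n = (X :: 'a::field mat)"
  by (intro eq_matI) auto

lemma bij_betw_one_plus: "bij_betw (\<lambda>X :: 'a::field mat. 1\<^sub>m n + X) (Vset n S) (Uset n S)"
  unfolding bij_betw_def
proof
  show "inj_on (\<lambda>X :: 'a mat. 1\<^sub>m n + X) (Vset n S)"
    by (rule inj_on_inverseI[of _ "\<lambda>u. u - 1\<^sub>m n"]) (simp add: Vset_carrier one_plus_minus_one)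
  show "(\<lambda>X :: 'a mat. 1\<^sub>m n + X) ` Vset n S = Uset n S" by (auto simp: Uset_def)
qed

lemma one_plus_mult_one_plus:
  fixes X Y :: "'a::field mat"
  assumes "X \<in> carrier_mat n n" "Y \<in> carrier_mat n n" "X * Y = 0\<^sub>m n n"
  shows "(1\<^sub>m n + X) * (1\<^sub>m n + Y) = 1\<^sub>m n + (X + Y)"
  using assms
  by (simp add: add_mult_distrib_mat[of _ n n _ _ n] mult_add_distrib_mat[of _ n n _ n])
     (intro eq_matI, auto simp: algebra_simps)

lemma (in additive_character) chi_char_add:
  assumes "S \<subseteq> {..<n} \<times> {..<n}" "X \<in> carrier_mat n n" "Y \<in> carrier_mat n n"
  shows "chi_char \<theta> S B (X + Y) = chi_char \<theta> S B X * chi_char \<theta> S B Y"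
proof -
  have "(\<Sum>ij\<in>S. B $$ ij * (X + Y) $$ ij) = (\<Sum>ij\<in>S. B $$ ij * X $$ ij + B $$ ij * Y $$ ij)"
    using assms by (intro sum.cong refl) (auto simp: algebra_simps)
  then show ?thesis by (simp add: chi_char_def \<theta>_add sum.distrib)
qed

section \<open>The elements \<open>e_B\<close> and the action of \<open>U_K\<close>\<close>

context verge_module
begin

abbreviation "L \<equiv> Lset n s"
abbreviation "K \<equiv> Kset n s"

lemma J_square: "J \<subseteq> {..<n} \<times> {..<n}"
  using Jset_Phi by (auto simp: Phi_def)

lemma VJ_mult_zero:
  fixes X Y :: "'a mat"
  assumes X: "X \<in> Vset n J" and Y: "Y \<in> carrier_mat n n"
    and 0: "\<And>k j. k < n \<Longrightarrow> j < n \<Longrightarrow> k \<notin> S2 \<Longrightarrow> Y $$ (k, j) = 0"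
  shows "X * Y = 0\<^sub>m n n"
proof (rule eq_matI)
  fix i j assume "i < dim_row (0\<^sub>m n n :: 'a mat)" "j < dim_col (0\<^sub>m n n :: 'a mat)"
  then have ij: "i < n" "j < n" by auto
  have "(X * Y) $$ (i, j) = (\<Sum>k<n. X $$ (i, k) * Y $$ (k, j))"
    using X Y ij by (intro mult_entry) (auto simp: Vset_carrier)
  also have "\<dots> = 0"
  proof (rule sum.neutral, rule ballI)
    fix k assume "k \<in> {..<n}"
    then show "X $$ (i, k) * Y $$ (k, j) = 0"
      using 0[of k j] VsetD[OF X, of i k] ij by (cases "k \<in> S2") (auto simp: Jset_iff)
  qed
  finally show "(X * Y) $$ (i, j) = 0\<^sub>m n n $$ (i, j)" using ij by simp
qed (use X Y in \<open>auto simp: Vset_iff\<close>)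

text \<open>Columns of \<open>J\<close> avoid \<open>S2\<close> and rows of \<open>J\<close> lie in
  it. Consequently \<open>1\<^sub>m n + X\<close> multiplies like \<open>X\<close> adds.\<close>

lemma VJ_mult_VJ:
  fixes X Y :: "'a mat"
  assumes X: "X \<in> Vset n J" and Y: "Y \<in> Vset n J"
  shows "X * Y = 0\<^sub>m n n"
  by (rule VJ_mult_zero[OF X Vset_carrier[OF Y]]) (use VsetD[OF Y] in \<open>auto simp: Jset_iff\<close>)

text \<open>A position of \<open>L\<close> stays within \<open>S2\<close> or within its complement,
  so composing it with a position of \<open>J\<close> gives a position of \<open>J\<close>
  again.\<close>

lemma UL_mult_VJ:
  fixes l X :: "'a mat"
  assumes l: "l \<in> Uset n L" and X: "X \<in> Vset n J"
  shows "l * X \<in> Vset n J" "X * l \<in> Vset n J"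
proof -
  note lD = UsetD[OF Lset_Phi l] and Xc = Vset_carrier[OF X]
  have L: "l $$ (i, k) = 0 \<or> i = k \<or> (i, k) \<in> L" if "i < n" "k < n" for i k using lD(3) that by blast
  have "(i, j) \<in> J" if ij: "i < n" "j < n" "(l * X) $$ (i, j) \<noteq> 0" for i j
  proof -
    have "(\<Sum>k<n. l $$ (i, k) * X $$ (k, j)) \<noteq> 0" using ij mult_entry[OF lD(1) Xc ij(1,2)] by simp
    then obtain k where "k < n" "l $$ (i, k) * X $$ (k, j) \<noteq> 0" by (meson lessThan_iff sum.neutral)
    then have "(k, j) \<in> J" "i = k \<or> (i, k) \<in> L" using VsetD[OF X, of k j] L[of i k] ij by auto
    then show ?thesis by (auto simp: Jset_iff Lset_iff Phi_def)
  qed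
  then show "l * X \<in> Vset n J" unfolding Vset_iff using lD(1) Xc by auto
  have "(i, j) \<in> J" if ij: "i < n" "j < n" "(X * l) $$ (i, j) \<noteq> 0" for i j
  proof -
    have "(\<Sum>k<n. X $$ (i, k) * l $$ (k, j)) \<noteq> 0" using ij mult_entry[OF Xc lD(1) ij(1,2)] by simp
    then obtain k where "k < n" "X $$ (i, k) * l $$ (k, j) \<noteq> 0" by (meson lessThan_iff sum.neutral)
    then have "(i, k) \<in> J" "k = j \<or> (k, j) \<in> L" using VsetD[OF X, of i k] L[of k j] ij by auto
    then show ?thesis by (auto simp: Jset_iff Lset_iff Phi_def)
  qed
  then show "X * l \<in> Vset n J" unfolding Vset_iff using lD(1) Xc by auto
qed

text \<open>A multiple of \<open>e_elt\<close>, summed over \<open>V_J\<close> instead of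
  \<open>U_J\<close>, so that the characters of the additive group can be compared directly.\<close>

definition E :: "'a mat \<Rightarrow> 'a mat \<Rightarrow> complex" where
  "E B = (\<Sum>X\<in>Vset n J. cscale (cnj (chi_char \<theta> J B X)) (gl_mult n b (delta (1\<^sub>m n + X))))"

lemma E_Uset: "E B = (\<Sum>u\<in>Uset n J. cscale (cnj (chi_char \<theta> J B (u - 1\<^sub>m n))) (gl_mult n b (delta u)))"
  unfolding E_def
  by (subst sum.reindex_bij_betw[OF bij_betw_one_plus, symmetric])
     (auto intro!: sum.cong simp: one_plus_minus_one Vset_carrier)

lemma e_elt_eq: "e_elt \<theta> n s B = cscale (1 / of_nat CARD('a) ^ card J) (E B)"
  by (simp add: e_elt_def E_Uset length_rows b_def)

lemma one_plus_VJ_carrier: "X \<in> Vset n J \<Longrightarrow> 1\<^sub>m n + X \<in> carrier (GL n)"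
  by (rule Uset_GL[OF Jset_Phi one_plus_Uset])

lemma b_delta_L_mult:
  assumes l: "l \<in> Uset n L" and g: "g \<in> carrier (GL n)"
  shows "gl_mult n b (delta (l * g)) = gl_mult n b (delta g)"
proof -
  have lU: "l \<in> U" using l Uset_mono[OF Lset_Phi] by blast
  have "gl_mult n b (delta l) = b"
    by (rule b_delta[OF lU], rule UsetD(3)[OF Lset_Phi l]) (auto simp: Jset_iff Lset_iff Phi_def)
  then show ?thesis
    using conv_assoc[of b "delta l" "delta g"] conv_delta_delta[of l g] g U_carrier[OF lU]
    by (simp add: GL_simps(1))
qed

text \<open>\<open>(1\<^sub>m n + X) * l\<close> equals \<open>l\<close> times
  \<open>1\<^sub>m n\<close> plus the conjugate of \<open>X\<close> by \<open>l\<close>, and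
  \<open>b\<close> absorbs the factor \<open>l\<close> on its right. Reindexing by the conjugate
  moves the conjugation into the character.\<close>

lemma E_delta_L:
  assumes l: "l \<in> Uset n L"
  shows "gl_mult n (E B) (delta l) = (\<Sum>X\<in>Vset n J.
    cscale (cnj (chi_char \<theta> J B (l * X * gl_inv n l))) (gl_mult n b (delta (1\<^sub>m n + X))))"
proof -
  define k where "k = gl_inv n l"
  have k: "k \<in> Uset n L" and kl: "k * l = 1\<^sub>m n" and lk: "l * k = 1\<^sub>m n"
    using Uset_inv[OF Lset_Phi trans_Lset l] by (simp_all add: k_def)
  have lc: "l \<in> carrier_mat n n" and kc: "k \<in> carrier_mat n n"
    using UsetD(1)[OF Lset_Phi] l k by auto
  have lU: "l \<in> U" using l Uset_mono[OF Lset_Phi] by blast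
  have conj: "l * X * k \<in> Vset n J" "k * X * l \<in> Vset n J" if "X \<in> Vset n J" for X
    using that UL_mult_VJ l k by auto
  have cancel: "g * (f * X * h) * e = X" if "g * f = 1\<^sub>m n" "h * e = 1\<^sub>m n"
    and c: "g \<in> carrier_mat n n" "f \<in> carrier_mat n n" "h \<in> carrier_mat n n" "e \<in> carrier_mat n n" "X \<in> carrier_mat n n"
    for f g h e X :: "'a mat"
  proof -
    have "g * (f * X * h) * e = (g * f) * X * (h * e)"
      using c by (simp add: assoc_mult_mat[of _ n n _ n _ n])
    then show ?thesis using that by simp
  qed
  have "gl_mult n (E B) (delta l)
      = (\<Sum>X\<in>Vset n J. cscale (cnj (chi_char \<theta> J B X)) (gl_mult n b (delta ((1\<^sub>m n + X) * l))))"
    unfolding E_def conv_sum_left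
  proof (rule sum.cong[OF refl])
    fix X :: "'a mat" assume X: "X \<in> Vset n J"
    show "gl_mult n (cscale (cnj (chi_char \<theta> J B X)) (gl_mult n b (delta (1\<^sub>m n + X)))) (delta l)
        = cscale (cnj (chi_char \<theta> J B X)) (gl_mult n b (delta ((1\<^sub>m n + X) * l)))"
      using one_plus_VJ_carrier[OF X] U_carrier[OF lU]
      by (simp add: conv_cscale_left conv_assoc conv_delta_delta GL_simps(1))
  qed
  also have "\<dots> = (\<Sum>X\<in>Vset n J. cscale (cnj (chi_char \<theta> J B (l * X * k))) (gl_mult n b (delta (1\<^sub>m n + X))))"
  proof (rule sum.reindex_bij_witness[of _ "\<lambda>X. l * X * k" "\<lambda>X. k * X * l"])
    fix X :: "'a mat" assume X: "X \<in> Vset n J"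
    note Xc = Vset_carrier[OF X]
    show "l * (k * X * l) * k = X" "k * (l * X * k) * l = X"
      using cancel[OF lk lk lc kc lc kc Xc] cancel[OF kl kl kc lc kc lc Xc] by auto
    show "k * X * l \<in> Vset n J" "l * X * k \<in> Vset n J" using conj X by auto
    have "(1\<^sub>m n + X) * l = l + X * l"
      using Xc lc by (simp add: add_mult_distrib_mat[of _ n n _ _ n])
    also have "\<dots> = l * (1\<^sub>m n + k * X * l)"
    proof -
      have "l * (k * X * l) = (l * k) * X * l"
        using Xc lc kc by (simp add: assoc_mult_mat[of _ n n _ n _ n])
      then show ?thesis using Xc lc kc lk by (simp add: mult_add_distrib_mat[of _ n n _ n])
    qed
    finally have eq: "(1\<^sub>m n + X) * l = l * (1\<^sub>m n + k * X * l)" .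
    show "cscale (cnj (chi_char \<theta> J B (l * (k * X * l) * k))) (gl_mult n b (delta (1\<^sub>m n + k * X * l)))
        = cscale (cnj (chi_char \<theta> J B X)) (gl_mult n b (delta ((1\<^sub>m n + X) * l)))"
      unfolding eq b_delta_L_mult[OF l one_plus_VJ_carrier[OF conj(2)[OF X]]] cancel[OF lk lk lc kc lc kc Xc] ..
  qed
  finally show ?thesis by (simp add: k_def)
qed

text \<open>The exponent is linear in \<open>X\<close>; \<open>c u v\<close> is the coefficient of
  the entry at \<open>(u, v)\<close>, and the new label is the transpose of \<open>l\<close> times
  \<open>B\<close> times the transpose of \<open>k\<close>, cut off outside
  \<open>J\<close>.\<close>

lemma chi_char_conjugate:
  assumes l: "l \<in> carrier_mat n n" and k: "k \<in> carrier_mat n n" and B: "B \<in> Vset n J"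
  shows "\<exists>B'\<in>Vset n J. \<forall>X\<in>Vset n J. chi_char \<theta> J B (l * X * k) = chi_char \<theta> J B' X"
proof -
  define c where "c u v = (\<Sum>i<n. \<Sum>j<n. B $$ (i, j) * l $$ (i, u) * k $$ (v, j))" for u v
  define B' where "B' = mat n n (\<lambda>(u, v). if (u, v) \<in> J then c u v else 0)"
  have B': "B' \<in> Vset n J" by (auto simp: Vset_iff B'_def)
  have "(\<Sum>ij\<in>J. B $$ ij * (l * X * k) $$ ij) = (\<Sum>ij\<in>J. B' $$ ij * X $$ ij)" if X: "X \<in> Vset n J" for X
  proof -
    note Xc = Vset_carrier[OF X]
    have lXk: "(l * X * k) $$ (i, j) = (\<Sum>u<n. \<Sum>v<n. l $$ (i, u) * X $$ (u, v) * k $$ (v, j))"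
      if "i < n" "j < n" for i j
    proof -
      have "(l * X * k) $$ (i, j) = (\<Sum>v<n. (\<Sum>u<n. l $$ (i, u) * X $$ (u, v)) * k $$ (v, j))"
        using that l k Xc mult_entry[of "l * X" n k i j] mult_entry[of l n X i]
        by (simp del: index_mult_mat)
      also have "\<dots> = (\<Sum>u<n. \<Sum>v<n. l $$ (i, u) * X $$ (u, v) * k $$ (v, j))"
        unfolding sum_distrib_right by (rule sum.swap)
      finally show ?thesis .
    qed
    have "(\<Sum>ij\<in>J. B $$ ij * (l * X * k) $$ ij)
        = (\<Sum>i<n. \<Sum>j<n. \<Sum>u<n. \<Sum>v<n. B $$ (i, j) * (l $$ (i, u) * X $$ (u, v) * k $$ (v, j)))"
      unfolding sum_Vset[OF J_square B] by (intro sum.cong refl) (simp add: lXk sum_distrib_left del: index_mult_mat)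
    also have "\<dots> = (\<Sum>u<n. \<Sum>v<n. X $$ (u, v) * c u v)"
      unfolding c_def sum_distrib_left by (subst sum_swap_pairs) (intro sum.cong refl, simp add: mult_ac)
    also have "\<dots> = (\<Sum>uv\<in>J. X $$ uv * (case uv of (u, v) \<Rightarrow> c u v))"
      unfolding sum_Vset[OF J_square X] by simp
    also have "\<dots> = (\<Sum>uv\<in>J. B' $$ uv * X $$ uv)"
      using J_square by (intro sum.cong refl) (auto simp: B'_def)
    finally show ?thesis .
  qed
  then show ?thesis using B' by (auto simp: chi_char_def)
qed

lemma K_eq: "K = L \<union> J"
  by (auto simp: Kset_def)

text \<open>Factor \<open>g\<close> along \<open>K = L \<union> J\<close>. The part in
  \<open>U_L\<close> changes the label, and the part in \<open>U_J\<close> translates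
  \<open>X\<close> and so only contributes a scalar.\<close>

lemma E_delta_K:
  assumes g: "g \<in> Uset n K" and B: "B \<in> Vset n J"
  shows "\<exists>c. \<exists>B'\<in>Vset n J. gl_mult n (E B) (delta g) = cscale c (E B')"
proof -
  have "g \<in> (\<lambda>(l, w). l * w) ` (Uset n L \<times> Uset n J)"
    using g trans_Kset unfolding K_eq
    by (subst Uset_factor[OF Lset_Phi trans_Lset Jset_Phi trans_Jset]) auto
  then obtain l w where lw: "l \<in> Uset n L" "w \<in> Uset n J" "g = l * w" by auto
  then obtain Y where Y: "Y \<in> Vset n J" "w = 1\<^sub>m n + Y" by (auto simp: Uset_def)
  have lU: "l \<in> U" using lw Uset_mono[OF Lset_Phi] by blast
  have wU: "w \<in> U" using lw Uset_mono[OF Jset_Phi] by blast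
  obtain B' where B': "B' \<in> Vset n J" "\<And>X. X \<in> Vset n J \<Longrightarrow> chi_char \<theta> J B (l * X * gl_inv n l) = chi_char \<theta> J B' X"
    using chi_char_conjugate[OF UsetD(1)[OF Lset_Phi lw(1)] UsetD(1)[OF Lset_Phi Uset_inv(1)[OF Lset_Phi trans_Lset lw(1)]] B]
    by blast
  have "gl_mult n (E B) (delta l) = E B'"
    by (subst E_delta_L[OF lw(1)], unfold E_def) (intro sum.cong refl, simp add: B')
  moreover have "gl_mult n (E B') (delta w) = cscale (chi_char \<theta> J B' Y) (E B')"
  proof -
    have "gl_mult n (E B') (delta w)
        = (\<Sum>X\<in>Vset n J. cscale (cnj (chi_char \<theta> J B' X)) (gl_mult n b (delta (1\<^sub>m n + (X + Y)))))"
      unfolding E_def conv_sum_left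
    proof (rule sum.cong[OF refl])
      fix X :: "'a mat" assume X: "X \<in> Vset n J"
      have "(1\<^sub>m n + X) * w = 1\<^sub>m n + (X + Y)"
        unfolding Y(2) by (rule one_plus_mult_one_plus) (use X Y VJ_mult_VJ in \<open>auto simp: Vset_carrier\<close>)
      then show "gl_mult n (cscale (cnj (chi_char \<theta> J B' X)) (gl_mult n b (delta (1\<^sub>m n + X)))) (delta w)
          = cscale (cnj (chi_char \<theta> J B' X)) (gl_mult n b (delta (1\<^sub>m n + (X + Y))))"
        using one_plus_VJ_carrier[OF X] U_carrier[OF wU]
        by (simp add: conv_cscale_left conv_assoc conv_delta_delta GL_simps(1))
    qed
    also have "\<dots> = (\<Sum>X\<in>Vset n J. cscale (cnj (chi_char \<theta> J B' (X + - Y))) (gl_mult n b (delta (1\<^sub>m n + X))))"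
    proof (rule sum.reindex_bij_witness[of _ "\<lambda>X. X + - Y" "\<lambda>X. X + Y"])
      fix X :: "'a mat" assume X: "X \<in> Vset n J"
      show "X + - Y \<in> Vset n J" "X + Y \<in> Vset n J" using Vset_add[OF X Y(1)] Vset_add[OF X Vset_uminus[OF Y(1)]] by auto
      have "X + Y + - Y = X" "X + - Y + Y = X"
        using Vset_carrier[OF X] Vset_carrier[OF Y(1)] by (auto intro!: eq_matI)
      then show "X + Y + - Y = X" "X + - Y + Y = X"
        "cscale (cnj (chi_char \<theta> J B' (X + Y + - Y))) (gl_mult n b (delta (1\<^sub>m n + (X + Y))))
          = cscale (cnj (chi_char \<theta> J B' X)) (gl_mult n b (delta (1\<^sub>m n + (X + Y))))"
        by simp_all
    qed
    also have "\<dots> = cscale (chi_char \<theta> J B' Y) (E B')"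
      unfolding E_def cscale_sum
    proof (rule sum.cong[OF refl])
      fix X :: "'a mat" assume X: "X \<in> Vset n J"
      have "(\<Sum>ij\<in>J. B' $$ ij * (- Y) $$ ij) = - (\<Sum>ij\<in>J. B' $$ ij * Y $$ ij)"
        unfolding sum_negf[symmetric] using J_square Vset_carrier[OF Y(1)] by (intro sum.cong refl) auto
      then have "cnj (chi_char \<theta> J B' (- Y)) = chi_char \<theta> J B' Y" by (simp add: chi_char_def \<theta>_cnj)
      then have "cnj (chi_char \<theta> J B' (X + - Y)) = chi_char \<theta> J B' Y * cnj (chi_char \<theta> J B' X)"
        using chi_char_add[OF J_square Vset_carrier[OF X] Vset_carrier[OF Vset_uminus[OF Y(1)]], of B']
        by (simp add: mult.commute)
      then show "cscale (cnj (chi_char \<theta> J B' (X + - Y))) (gl_mult n b (delta (1\<^sub>m n + X)))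
          = cscale (chi_char \<theta> J B' Y) (cscale (cnj (chi_char \<theta> J B' X)) (gl_mult n b (delta (1\<^sub>m n + X))))"
        by simp
    qed
    finally show ?thesis .
  qed
  moreover have "gl_mult n (E B) (delta g) = gl_mult n (gl_mult n (E B) (delta l)) (delta w)"
    using U_carrier[OF lU] U_carrier[OF wU] lw(3) by (simp add: conv_assoc conv_delta_delta GL_simps(1))
  ultimately show ?thesis using B'(1) by auto
qed

section \<open>Comparison of \<open>e_A\<close> with \<open>y\<close>\<close>

abbreviation "e_A \<equiv> e_elt \<theta> n s A"
abbreviation "orbit_span \<equiv> cspan (e_orbit \<theta> n s A)"
abbreviation "J0 \<equiv> J \<inter> Rhat n p"
abbreviation "J1 \<equiv> J - Rhat n p"

text \<open>Two positions of \<open>J\<close> never compose, so closure is vacuous; both pieces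
  \<open>J0\<close> and \<open>J1\<close> of \<open>J\<close> therefore define groups.\<close>

lemma trans_J_subset: "S \<subseteq> J \<Longrightarrow> trans S"
  by (rule transI) (auto simp: Jset_iff subset_iff)

text \<open>If \<open>(i, k)\<close> were in \<open>J\<close>, the middle index would be inside or
  outside \<open>S2\<close>, putting \<open>(j, k)\<close> or \<open>(i, j)\<close> into
  \<open>J\<close>.\<close>

lemma trans_Rhat_minus_J: "trans (Rhat n p - J)"
proof (rule transI)
  fix i j k assume "(i, j) \<in> Rhat n p - J" "(j, k) \<in> Rhat n p - J"
  then show "(i, k) \<in> Rhat n p - J"
    using transD[OF trans_Rhat, of i j k] Rhat_Phi by (auto simp: Jset_iff)
qed

lemma chi_char_A: "chi_char \<theta> J A X = \<theta> (\<Sum>ij\<in>p. A $$ ij * X $$ ij)"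
proof -
  have "(\<Sum>ij\<in>J. A $$ ij * X $$ ij) = (\<Sum>ij\<in>p. A $$ ij * X $$ ij)"
    using p_J J_square finite_Phi finite_subset[OF Jset_Phi]
    by (intro sum.mono_neutral_right) (auto simp: A_zero)
  then show ?thesis by (simp add: chi_char_def)
qed

lemma sum_p_minus_one:
  assumes "u \<in> carrier_mat n n"
  shows "(\<Sum>ij\<in>p. A $$ ij * (u - 1\<^sub>m n) $$ ij) = (\<Sum>ij\<in>p. A $$ ij * u $$ ij)"
proof (rule sum.cong[OF refl])
  fix ij assume "ij \<in> p"
  moreover obtain i j where "ij = (i, j)" by (cases ij)
  ultimately show "A $$ ij * (u - 1\<^sub>m n) $$ ij = A $$ ij * u $$ ij"
    using assms p_less[of i j] by simp
qed

lemma E_A_eq: "E A = (\<Sum>u\<in>Uset n J. cscale (cnj (\<theta> (\<Sum>ij\<in>p. A $$ ij * u $$ ij))) (gl_mult n b (delta u)))"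
  unfolding E_Uset
  by (intro sum.cong refl) (simp add: chi_char_A sum_p_minus_one UsetD(1)[OF Jset_Phi])

definition y0 :: "'a mat \<Rightarrow> complex" where
  "y0 = (\<Sum>t\<in>Uset n J0. cscale (cnj (psi t)) (gl_mult n b (delta t)))"

text \<open>\<open>H\<close> is the product of the groups for \<open>Rhat n p - J\<close> and
  \<open>J0\<close>. On the first one \<open>psi\<close> is trivial and \<open>b\<close> is fixed,
  so averaging over it only contributes a factor.\<close>

lemma y_eq: "\<exists>c. c \<noteq> 0 \<and> y = cscale c y0"
proof -
  let ?D = "Uset n (Rhat n p - J) :: 'a mat set" and ?H0 = "Uset n J0 :: 'a mat set"
  have DP: "Rhat n p - J \<subseteq> Phi n" and J0P: "J0 \<subseteq> Phi n" using Rhat_Phi Jset_Phi by auto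
  have un: "(Rhat n p - J) \<union> J0 = Rhat n p" by auto
  have bij: "bij_betw (\<lambda>(l, t). l * t) (?D \<times> ?H0) H"
    using Uset_factor_bij[OF DP trans_Rhat_minus_J J0P trans_J_subset, where ?'a = 'a] trans_Rhat
    unfolding un by auto
  have DH: "l \<in> H" if "l \<in> ?D" for l using that Uset_mono[of "Rhat n p - J" "Rhat n p" n] by auto
  have H0H: "t \<in> H" if "t \<in> ?H0" for t using that Uset_mono[of J0 "Rhat n p" n] by auto
  have D0: "l $$ (i, j) = 0" if "l \<in> ?D" "(i, j) \<in> J" for l i j
    using that Jset_Phi by (intro UsetD(3)[OF DP that(1)]) (auto simp: Phi_def)
  have "y = (\<Sum>h\<in>H. cscale (cnj (psi h) / of_nat (card H)) (gl_mult n b (delta h)))"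
    unfolding y_def conv_eps by (intro sum.cong refl) (simp add: psi_cnj)
  also have "\<dots> = (\<Sum>(l, t)\<in>?D \<times> ?H0. cscale (cnj (psi (l * t)) / of_nat (card H)) (gl_mult n b (delta (l * t))))"
    by (subst sum.reindex_bij_betw[OF bij, symmetric]) (simp add: split_def)
  also have "\<dots> = (\<Sum>(l, t)\<in>?D \<times> ?H0. cscale (1 / of_nat (card H)) (cscale (cnj (psi t)) (gl_mult n b (delta t))))"
  proof (rule sum.cong[OF refl], clarify)
    fix l t assume l: "l \<in> ?D" and t: "t \<in> ?H0"
    have "psi l = 1" using DH[OF l] D0[OF l] p_J by (intro psi_one_if) auto
    then have "psi (l * t) = psi t" using psi_mult[OF DH[OF l] H0H[OF t]] by simp
    moreover have "gl_mult n b (delta l) = b" using DH[OF l] H_U D0[OF l] by (intro b_delta) auto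
    then have "gl_mult n b (delta (l * t)) = gl_mult n b (delta t)"
      using conv_assoc[of b "delta l" "delta t"] conv_delta_delta[of l t] H_carrier[OF DH[OF l]] H_carrier[OF H0H[OF t]]
      by (simp add: GL_simps(1))
    ultimately show "cscale (cnj (psi (l * t)) / of_nat (card H)) (gl_mult n b (delta (l * t)))
        = cscale (1 / of_nat (card H)) (cscale (cnj (psi t)) (gl_mult n b (delta t)))"
      by simp
  qed
  also have "\<dots> = (\<Sum>l\<in>?D. cscale (1 / of_nat (card H)) y0)"
    by (subst sum.cartesian_product[symmetric]) (simp add: y0_def cscale_sum)
  also have "\<dots> = cscale (\<Sum>l\<in>?D. 1 / of_nat (card H)) y0"
    by (rule cscale_sum_left[symmetric])
  finally have eq: "y = cscale (of_nat (card ?D) / of_nat (card H)) y0" by simp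
  have "(1\<^sub>m n :: 'a mat) \<in> ?D" by (rule one_Uset[OF DP])
  then have "card ?D \<noteq> 0" using finite_Uset[of n "Rhat n p - J", where ?'a = 'a] by auto
  then have "of_nat (card ?D) / of_nat (card H) \<noteq> (0::complex)" using card_H_nonzero by simp
  with eq show ?thesis by blast
qed

lemma y0_nonzero: "y0 \<noteq> 0"
  using y_eq y_nonzero by auto

lemma y0_in_cyc_y: "y0 \<in> cyc y"
proof -
  obtain c where "c \<noteq> 0" "y = cscale c y0" using y_eq by blast
  then have "y0 = cscale (1 / c) y" by simp
  then show ?thesis using right_stable_cscale[OF right_stable_cyc mem_cyc[OF y_vanishing_off]] by simp
qed

text \<open>Split \<open>U_J\<close> into the groups for \<open>J0\<close> and \<open>J1\<close>.
  The second factor does not affect the entries at \<open>p\<close>: these lie in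
  \<open>Rhat\<close>, and matrices of \<open>V_J\<close> multiply to zero. So \<open>E A\<close> is
  the sum of the translates of \<open>y0\<close> by the second group.\<close>

lemma E_A_in_cyc_y: "E A \<in> cyc y"
proof -
  let ?H0 = "Uset n J0 :: 'a mat set" and ?H1 = "Uset n J1 :: 'a mat set"
  have P0: "J0 \<subseteq> Phi n" and P1: "J1 \<subseteq> Phi n" using Jset_Phi by auto
  have un: "J0 \<union> J1 = J" by auto
  have bij: "bij_betw (\<lambda>(t, z). t * z) (?H0 \<times> ?H1) (Uset n J)"
    using Uset_factor_bij[OF P0 trans_J_subset P1 trans_J_subset, where ?'a = 'a] trans_Jset
    unfolding un by auto
  have tU: "t \<in> U" if "t \<in> ?H0" for t using that Uset_mono[OF P0] by blast
  have zU: "z \<in> U" if "z \<in> ?H1" for z using that Uset_mono[OF P1] by blast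
  have "E A = (\<Sum>(t, z)\<in>?H0 \<times> ?H1. cscale (cnj (\<theta> (\<Sum>ij\<in>p. A $$ ij * (t * z) $$ ij))) (gl_mult n b (delta (t * z))))"
    unfolding E_A_eq by (subst sum.reindex_bij_betw[OF bij, symmetric]) (simp add: split_def)
  also have "\<dots> = (\<Sum>(t, z)\<in>?H0 \<times> ?H1. gl_mult n (cscale (cnj (psi t)) (gl_mult n b (delta t))) (delta z))"
  proof (rule sum.cong[OF refl], clarify)
    fix t z assume t: "t \<in> ?H0" and z: "z \<in> ?H1"
    have "(t * z) $$ (i, j) = t $$ (i, j)" if ij: "(i, j) \<in> p" for i j
    proof -
      note b = p_less[OF ij]
      have "(t * z) $$ (i, j) = t $$ (i, j) + z $$ (i, j)"
      proof (rule mult_entry_p[OF tU[OF t] zU[OF z] ij])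
        fix k assume k: "j < k" "k < i"
        show "t $$ (i, k) * z $$ (k, j) = 0"
        proof (cases "k \<in> S2")
          case True
          then have "t $$ (i, k) = 0" using k b by (intro UsetD(3)[OF P0 t]) (auto simp: Jset_iff)
          then show ?thesis by simp
        next
          case False
          then have "z $$ (k, j) = 0" using k b by (intro UsetD(3)[OF P1 z]) (auto simp: Jset_iff)
          then show ?thesis by simp
        qed
      qed
      moreover have "z $$ (i, j) = 0" using b ij p_Rhat by (intro UsetD(3)[OF P1 z]) auto
      ultimately show ?thesis by simp
    qed
    then have "(\<Sum>ij\<in>p. A $$ ij * (t * z) $$ ij) = (\<Sum>ij\<in>p. A $$ ij * t $$ ij)"
      by (intro sum.cong refl) (auto simp del: index_mult_mat)
    moreover have "t \<in> H" using t Uset_mono[of J0 "Rhat n p" n] by auto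
    ultimately show "cscale (cnj (\<theta> (\<Sum>ij\<in>p. A $$ ij * (t * z) $$ ij))) (gl_mult n b (delta (t * z)))
        = gl_mult n (cscale (cnj (psi t)) (gl_mult n b (delta t))) (delta z)"
      using U_carrier[OF tU[OF t]] U_carrier[OF zU[OF z]]
      by (simp add: psi_def conv_cscale_left conv_assoc conv_delta_delta GL_simps(1))
  qed
  also have "\<dots> = (\<Sum>z\<in>?H1. gl_mult n y0 (delta z))"
    by (subst sum.cartesian_product[symmetric], subst sum.swap) (simp add: y0_def conv_sum_left)
  finally have eq: "E A = (\<Sum>z\<in>?H1. gl_mult n y0 (delta z))" .
  have "gl_mult n y0 (delta z) \<in> cyc y" if "z \<in> ?H1" for z
    using right_stable_cyc[of y] y0_in_cyc_y delta_U[OF zU[OF that]] unfolding right_stable_def by blast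
  then show ?thesis unfolding eq by (rule right_stable_sum[OF right_stable_cyc])
qed

text \<open>For \<open>(i, j)\<close> in \<open>p\<close>, a position \<open>(i, c)\<close> of
  \<open>T\<close> is the partner of \<open>(c, j)\<close>: acting with a root element at
  \<open>(i, c)\<close> tests the entry of \<open>X\<close> at \<open>(c, j)\<close>.\<close>

definition T :: "(nat \<times> nat) set" where
  "T = {(i, c). c \<in> S2 \<and> c < i \<and> (\<exists>j. (i, j) \<in> p \<and> j < c)}"

lemma T_L: "T \<subseteq> L"
  using p_S2 p_less by (auto simp: T_def Lset_iff Phi_def)

lemma T_square: "T \<subseteq> {..<n} \<times> {..<n}"
  using T_L Lset_Phi by (auto simp: Phi_def)

abbreviation "card_VT \<equiv> of_nat (card (Vset n T :: 'a mat set)) :: complex"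

text \<open>A row \<open>c\<close> of \<open>J\<close> is in \<open>S2\<close> and hence no column
  of \<open>p\<close>, so the second alternative in \<open>Rhat_iff\<close> never applies. A
  position \<open>(c, j)\<close> of \<open>J\<close> is therefore missing from \<open>Rhat\<close>
  exactly if \<open>(i, j)\<close> is in \<open>p\<close> for some \<open>i > c\<close>.\<close>

lemma VJ0_iff:
  assumes X: "X \<in> Vset n J"
  shows "X \<in> Vset n J0 \<longleftrightarrow> (\<forall>i j c. (i, j) \<in> p \<longrightarrow> (i, c) \<in> T \<longrightarrow> X $$ (c, j) = 0)"
proof
  assume X0: "X \<in> Vset n J0"
  show "\<forall>i j c. (i, j) \<in> p \<longrightarrow> (i, c) \<in> T \<longrightarrow> X $$ (c, j) = 0"
  proof (intro allI impI)
    fix i j c assume ij: "(i, j) \<in> p" and c: "(i, c) \<in> T"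
    then have "(c, j) \<notin> Rhat n p"
      using p_S2 by (fastforce simp: Rhat_iff T_def)
    then show "X $$ (c, j) = 0" using VsetD[OF X0, of c j] p_less[OF ij] c by (auto simp: T_def)
  qed
next
  assume 0: "\<forall>i j c. (i, j) \<in> p \<longrightarrow> (i, c) \<in> T \<longrightarrow> X $$ (c, j) = 0"
  have "(c, j) \<in> Rhat n p" if cj: "c < n" "j < n" "X $$ (c, j) \<noteq> 0" for c j
  proof (rule ccontr)
    assume "(c, j) \<notin> Rhat n p"
    moreover have J: "(c, j) \<in> J" using VsetD[OF X, of c j] cj by blast
    ultimately obtain i where i: "(i, j) \<in> p" "c < i" by (auto simp: Rhat_iff Jset_iff Phi_def not_le)
    then have "(i, c) \<in> T" using J by (auto simp: T_def Jset_iff Phi_def)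
    then show False using 0 i cj by blast
  qed
  then show "X \<in> Vset n J0" using X by (auto simp: Vset_iff)
qed

text \<open>Acting with \<open>1\<^sub>m n + Z\<close> multiplies the coefficient at
  \<open>X\<close> by the conjugate of a character of \<open>Z\<close> labelled by
  \<open>C X\<close>. Summing over \<open>Z\<close> removes every \<open>X\<close> for which this
  label is nonzero on \<open>T\<close>; by \<open>VJ0_iff\<close> precisely the \<open>X\<close> in
  \<open>V_J0\<close> survive.\<close>

lemma E_A_sum_T:
  "(\<Sum>Z\<in>Vset n T. gl_mult n (E A) (delta (1\<^sub>m n + Z))) = cscale (card_VT) y0"
proof -
  \<comment> \<open>\<open>C X\<close> is \<open>A\<close> times the transpose of \<open>X\<close>,
    which collects the coefficients of \<open>Z\<close> when \<open>A\<close> is paired with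
    \<open>Z * X\<close>.\<close>
  define C where "C X = mat n n (\<lambda>(i, c). \<Sum>j<n. A $$ (i, j) * X $$ (c, j))" for X :: "'a mat"
  have chi: "chi_char \<theta> J A ((1\<^sub>m n + Z) * X * gl_inv n (1\<^sub>m n + Z)) = chi_char \<theta> J A X * chi_char \<theta> T (C X) Z"
    if Z: "Z \<in> Vset n T" and X: "X \<in> Vset n J" for X Z
  proof -
    let ?l = "1\<^sub>m n + Z"
    have l: "?l \<in> Uset n L" using one_plus_Uset[OF Z] Uset_mono[OF T_L] by blast
    note li = Uset_inv[OF Lset_Phi trans_Lset l] and Zc = Vset_carrier[OF Z] and Xc = Vset_carrier[OF X]
    have lc: "?l \<in> carrier_mat n n" and kc: "gl_inv n ?l \<in> carrier_mat n n"
      using UsetD(1)[OF Lset_Phi] l li(1) by auto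
    \<comment> \<open>Since the rows of \<open>T\<close> lie in \<open>S2\<close>, conjugating
      \<open>X\<close> by \<open>1\<^sub>m n + Z\<close> reduces to left multiplication.\<close>
    have "X * Z = 0\<^sub>m n n"
      by (rule VJ_mult_zero[OF X Zc]) (use VsetD[OF Z] p_S2 in \<open>auto simp: T_def\<close>)
    then have "X * ?l = X" using Xc Zc by (simp add: mult_add_distrib_mat[of _ n n _ n])
    then have "X * gl_inv n ?l = X * ?l * gl_inv n ?l" by simp
    also have "\<dots> = X" using Xc lc kc li(3) by (simp add: assoc_mult_mat[of _ n n _ n _ n])
    finally have "?l * X * gl_inv n ?l = ?l * X"
      using Xc lc kc by (simp add: assoc_mult_mat[of _ n n _ n _ n])
    also have "\<dots> = X + Z * X" using Xc Zc by (simp add: add_mult_distrib_mat[of _ n n _ _ n])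
    finally have "chi_char \<theta> J A (?l * X * gl_inv n ?l) = chi_char \<theta> J A X * chi_char \<theta> J A (Z * X)"
      using chi_char_add[OF J_square Xc, of "Z * X"] Zc Xc by simp
    moreover have "(\<Sum>ij\<in>J. A $$ ij * (Z * X) $$ ij) = (\<Sum>ic\<in>T. Z $$ ic * C X $$ ic)"
    proof -
      have "(\<Sum>ij\<in>J. A $$ ij * (Z * X) $$ ij) = (\<Sum>i<n. \<Sum>j<n. \<Sum>c<n. A $$ (i, j) * (Z $$ (i, c) * X $$ (c, j)))"
        unfolding sum_Vset[OF J_square A_J] using Zc Xc
        by (intro sum.cong refl) (simp add: mult_entry[of _ n] sum_distrib_left del: index_mult_mat)
      also have "\<dots> = (\<Sum>i<n. \<Sum>c<n. Z $$ (i, c) * C X $$ (i, c))"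
      proof (rule sum.cong[OF refl])
        fix i assume i: "i \<in> {..<n}"
        show "(\<Sum>j<n. \<Sum>c<n. A $$ (i, j) * (Z $$ (i, c) * X $$ (c, j))) = (\<Sum>c<n. Z $$ (i, c) * C X $$ (i, c))"
          by (subst sum.swap) (use i in \<open>auto simp: C_def sum_distrib_left mult_ac intro!: sum.cong\<close>)
      qed
      also have "\<dots> = (\<Sum>ic\<in>T. Z $$ ic * C X $$ ic)" by (rule sum_Vset[OF T_square Z, symmetric])
      finally show ?thesis .
    qed
    ultimately show ?thesis by (simp add: chi_char_def mult.commute)
  qed
  have CX: "(\<Sum>Z\<in>Vset n T. chi_char \<theta> T (C X) Z) = (if X \<in> Vset n J0 then card_VT else 0)"
    if X: "X \<in> Vset n J" for X
  proof -
    have entry: "C X $$ (i, c) = A $$ (i, j) * X $$ (c, j)" if ij: "(i, j) \<in> p" and c: "c < n" for i j c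
    proof -
      have "(\<Sum>m<n. A $$ (i, m) * X $$ (c, m)) = A $$ (i, j) * X $$ (c, j)"
      proof (rule sum_one_term)
        fix m assume "m < n" "m \<noteq> j"
        then have "A $$ (i, m) = 0" using p_row[OF ij] p_less[OF ij] by (intro A_zero) auto
        then show "A $$ (i, m) * X $$ (c, m) = 0" by simp
      qed (use p_less[OF ij] in auto)
      then show ?thesis using p_less[OF ij] c by (simp add: C_def)
    qed
    show ?thesis
    proof (cases "X \<in> Vset n J0")
      case True
      have "C X $$ ic = 0" if ic: "ic \<in> T" for ic
      proof -
        obtain i c where ic': "ic = (i, c)" by (cases ic)
        then have "c < n" using ic T_square by auto
        moreover obtain j where "(i, j) \<in> p" using ic ic' by (auto simp: T_def)
        ultimately show ?thesis using entry True ic ic' VJ0_iff[OF X] by auto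
      qed
      then have "chi_char \<theta> T (C X) Z = 1" for Z by (simp add: chi_char_def \<theta>_0)
      then show ?thesis using True by simp
    next
      case False
      then obtain i j c where c: "(i, j) \<in> p" "(i, c) \<in> T" "X $$ (c, j) \<noteq> 0" using VJ0_iff[OF X] by blast
      then have "C X $$ (i, c) \<noteq> 0" using entry[OF c(1)] T_square by (auto simp: p_iff)
      then show ?thesis using False chi_char_sum_eq_0[OF T_square c(2)] by simp
    qed
  qed
  have J0J: "Vset n J0 \<subseteq> (Vset n J :: 'a mat set)" by (auto simp: Vset_def)
  have l: "1\<^sub>m n + Z \<in> Uset n L" if "Z \<in> Vset n T" for Z :: "'a mat"
    using one_plus_Uset[OF that] Uset_mono[OF T_L] by blast
  have "(\<Sum>Z\<in>Vset n T. gl_mult n (E A) (delta (1\<^sub>m n + Z)))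
      = (\<Sum>Z\<in>Vset n T. \<Sum>X\<in>Vset n J. cscale (cnj (chi_char \<theta> J A X) * cnj (chi_char \<theta> T (C X) Z)) (gl_mult n b (delta (1\<^sub>m n + X))))"
    by (intro sum.cong refl, subst E_delta_L[OF l]) (auto intro!: sum.cong simp: chi)
  also have "\<dots> = (\<Sum>X\<in>Vset n J. cscale (cnj (chi_char \<theta> J A X) * cnj (\<Sum>Z\<in>Vset n T. chi_char \<theta> T (C X) Z)) (gl_mult n b (delta (1\<^sub>m n + X))))"
    by (subst sum.swap) (simp add: sum_distrib_left cscale_sum_left)
  also have "\<dots> = (\<Sum>X\<in>Vset n J0. cscale (cnj (chi_char \<theta> J A X) * card_VT) (gl_mult n b (delta (1\<^sub>m n + X))))"
    using J0J by (intro sum.mono_neutral_cong_right finite_Vset) (auto simp: CX subset_iff simp del: cnj_sum)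
  also have "\<dots> = cscale (card_VT) (\<Sum>X\<in>Vset n J0. cscale (cnj (psi (1\<^sub>m n + X))) (gl_mult n b (delta (1\<^sub>m n + X))))"
    unfolding cscale_sum
  proof (rule sum.cong[OF refl])
    fix X :: "'a mat" assume X: "X \<in> Vset n J0"
    have "1\<^sub>m n + X \<in> H" using one_plus_Uset[OF X] Uset_mono[of J0 "Rhat n p" n] by auto
    moreover have "(\<Sum>ij\<in>p. A $$ ij * (1\<^sub>m n + X) $$ ij) = (\<Sum>ij\<in>p. A $$ ij * X $$ ij)"
      using sum_p_minus_one[of "1\<^sub>m n + X"] Vset_carrier[OF X] by (simp add: one_plus_minus_one)
    ultimately have "chi_char \<theta> J A X = psi (1\<^sub>m n + X)" by (simp add: chi_char_A psi_def)
    then show "cscale (cnj (chi_char \<theta> J A X) * card_VT) (gl_mult n b (delta (1\<^sub>m n + X)))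
        = cscale (card_VT) (cscale (cnj (psi (1\<^sub>m n + X))) (gl_mult n b (delta (1\<^sub>m n + X))))"
      by (simp add: mult.commute)
  qed
  also have "(\<Sum>X\<in>Vset n J0. cscale (cnj (psi (1\<^sub>m n + X))) (gl_mult n b (delta (1\<^sub>m n + X)))) = y0"
    unfolding y0_def by (rule sum.reindex_bij_betw[OF bij_betw_one_plus])
  finally show ?thesis .
qed

lemma card_VT_nonzero: "card (Vset n T :: 'a mat set) \<noteq> 0"
proof -
  have "(0\<^sub>m n n :: 'a mat) \<in> Vset n T" by (auto simp: Vset_iff)
  then show ?thesis using finite_Vset[of n T, where ?'a = 'a] by auto
qed

lemma E_A_nonzero: "E A \<noteq> 0"
proof
  assume "E A = 0"
  then have "cscale (card_VT) y0 = 0" using E_A_sum_T by simp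
  then show False using card_VT_nonzero y0_nonzero by (simp add: cscale_eq_0_iff)
qed

lemma K_U: "Uset n K \<subseteq> U"
  by (rule Uset_mono[OF Kset_Phi])

text \<open>A position of \<open>Phi n\<close> outside \<open>K\<close> has its column in
  \<open>S2\<close>; such a column contains no position of \<open>p\<close>, so the position is in
  \<open>Rhat\<close>.\<close>

lemma U_eq_H_K:
  assumes "u \<in> U"
  shows "\<exists>h\<in>H. \<exists>k\<in>Uset n K. u = h * k"
proof -
  have "Rhat n p \<union> K = Phi n"
    using Rhat_Phi Kset_Phi p_S2 by (auto simp: Rhat_iff Kset_iff Phi_def)
  then have "(\<lambda>(h, k). h * k) ` (H \<times> Uset n K) = U"
    using Uset_factor[OF Rhat_Phi trans_Rhat Kset_Phi trans_Kset, where ?'a = 'a] trans_Phi by simp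
  then have "u \<in> (\<lambda>(h, k). h * k) ` (H \<times> Uset n K)" using assms by simp
  then show ?thesis by auto
qed

lemma e_elt_delta_K:
  assumes "g \<in> Uset n K"
  shows "gl_mult n e_A (delta g) \<in> orbit_span"
proof -
  interpret v: vector_space "cscale :: complex \<Rightarrow> ('a mat \<Rightarrow> complex) \<Rightarrow> _" by (rule vector_space_cscale)
  obtain c B where B: "B \<in> Vset n J" "gl_mult n (E A) (delta g) = cscale c (E B)"
    using E_delta_K[OF assms A_J] by blast
  then have eq: "gl_mult n e_A (delta g) = cscale c (e_elt \<theta> n s B)"
    by (simp add: e_elt_eq conv_cscale_left mult.commute)
  then have "e_elt \<theta> n s B \<in> e_orbit \<theta> n s A" using assms B unfolding e_orbit_def by blast
  then show ?thesis unfolding eq cspan_def by (intro v.span_scale v.span_base)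
qed

lemma E_A_scale: "E A = cscale (of_nat CARD('a) ^ card J) e_A"
  by (simp add: e_elt_eq)

text \<open>By \<open>E_A_sum_T\<close>, \<open>y\<close> is a combination of translates of
  \<open>e_A\<close> under \<open>U_T\<close>. This group lies in \<open>U_K\<close>, so translating
  further by \<open>k\<close> stays in the span of the orbit.\<close>

lemma y_delta_K:
  assumes k: "k \<in> Uset n K"
  shows "gl_mult n y (delta k) \<in> orbit_span"
proof -
  interpret v: vector_space "cscale :: complex \<Rightarrow> ('a mat \<Rightarrow> complex) \<Rightarrow> _" by (rule vector_space_cscale)
  obtain c where c: "y = cscale c y0" using y_eq by blast
  let ?N = "card_VT :: complex"
  have "y0 = cscale (1 / ?N) (\<Sum>Z\<in>Vset n T. gl_mult n (E A) (delta (1\<^sub>m n + Z)))"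
    unfolding E_A_sum_T using card_VT_nonzero by simp
  then have y: "gl_mult n y (delta k) = cscale (c / ?N * of_nat CARD('a) ^ card J)
      (\<Sum>Z\<in>Vset n T. gl_mult n (gl_mult n e_A (delta (1\<^sub>m n + Z))) (delta k))"
    unfolding c E_A_scale by (simp add: conv_cscale_left conv_sum_left cscale_sum)
  have "gl_mult n (gl_mult n e_A (delta (1\<^sub>m n + Z))) (delta k) \<in> orbit_span"
    if Z: "Z \<in> Vset n T" for Z
  proof -
    have lK: "1\<^sub>m n + Z \<in> Uset n K"
      using one_plus_Uset[OF Z] Uset_mono[of T K n] T_L by (auto simp: Kset_def)
    then have "(1\<^sub>m n + Z) * k \<in> Uset n K" using Uset_mult[OF Kset_Phi trans_Kset] k by blast
    moreover have "gl_mult n (delta (1\<^sub>m n + Z)) (delta k) = delta ((1\<^sub>m n + Z) * k)"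
      using conv_delta_delta[of "1\<^sub>m n + Z" k] lK k K_U U_carrier by (simp add: GL_simps(1) subset_iff)
    ultimately show ?thesis using e_elt_delta_K by (simp add: conv_assoc)
  qed
  then show ?thesis unfolding y cspan_def by (intro v.span_scale v.span_sum)
qed

lemma cyc_e_elt: "cyc e_A = cyc y"
proof (rule cyc_eqI)
  show "e_A \<in> cyc y"
    unfolding e_elt_eq by (rule right_stable_cscale[OF right_stable_cyc E_A_in_cyc_y])
  obtain c where c: "y = cscale c y0" using y_eq by blast
  have ev: "e_A \<in> vanishing_off (carrier (GL n))"
    using \<open>e_A \<in> cyc y\<close> right_stable_cyc[of y] by (auto simp: right_stable_def)
  have E: "E A \<in> cyc e_A"
    unfolding E_A_scale by (rule right_stable_cscale[OF right_stable_cyc mem_cyc[OF ev]])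
  have "1\<^sub>m n + Z \<in> U" if "Z \<in> Vset n T" for Z :: "'a mat"
    using one_plus_Uset[OF that] Uset_mono[of T "Phi n" n] T_L Lset_Phi by blast
  then have "(\<Sum>Z\<in>Vset n T. gl_mult n (E A) (delta (1\<^sub>m n + Z))) \<in> cyc e_A"
    using right_stable_cyc[of "e_A"] E delta_U
    by (intro right_stable_sum[OF right_stable_cyc]) (auto simp: right_stable_def)
  then have "cscale (1 / card_VT) (cscale (card_VT) y0) \<in> cyc e_A"
    unfolding E_A_sum_T by (rule right_stable_cscale[OF right_stable_cyc])
  then have "y0 \<in> cyc e_A" using card_VT_nonzero by simp
  then show "y \<in> cyc e_A" unfolding c by (rule right_stable_cscale[OF right_stable_cyc])
qed

text \<open>For \<open>u = h * k\<close> with \<open>h\<close> in \<open>H\<close> and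
  \<open>k\<close> in \<open>U_K\<close>, the factor \<open>h\<close> acts on \<open>y\<close> by
  \<open>psi h\<close>, so the \<open>U_K\<close> translates of \<open>y\<close> suffice. In
  particular the span of the \<open>U_K\<close> orbit is stable under all of
  \<open>U\<close>.\<close>

lemma cspan_e_orbit: "orbit_span = cyc e_A"
proof
  interpret v: vector_space "cscale :: complex \<Rightarrow> ('a mat \<Rightarrow> complex) \<Rightarrow> _" by (rule vector_space_cscale)
  show "cyc e_A \<subseteq> orbit_span"
    unfolding cyc_e_elt
  proof
    fix z assume "z \<in> cyc y"
    then obtain x where x: "x \<in> vanishing_off U" "z = gl_mult n y x" by (auto simp: cyc_def)
    have "gl_mult n y (delta u) \<in> orbit_span" if u: "u \<in> U" for u
    proof -
      obtain h k where hk: "h \<in> H" "k \<in> Uset n K" "u = h * k" using U_eq_H_K[OF u] by blast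
      have "gl_mult n y (delta u) = gl_mult n (gl_mult n y (delta h)) (delta k)"
        using hk H_carrier[OF hk(1)] U_carrier K_U by (auto simp: conv_assoc conv_delta_delta GL_simps(1) subset_iff)
      also have "\<dots> = cscale (psi h) (gl_mult n y (delta k))"
        unfolding y_def by (simp add: conv_assoc[of b eps "delta h"] eps_conv_delta[OF hk(1)] conv_cscale_left conv_cscale_right)
      finally show ?thesis using y_delta_K[OF hk(2)] unfolding cspan_def by (simp add: v.span_scale)
    qed
    then show "z \<in> orbit_span"
      unfolding x(2) conv_expand[OF U.subset x(1)] cspan_def by (intro v.span_sum v.span_scale)
  qed
  show "orbit_span \<subseteq> cyc e_A"
    unfolding cspan_def
  proof (rule v.span_minimal)
    show "e_orbit \<theta> n s A \<subseteq> cyc e_A"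
    proof
      fix z assume "z \<in> e_orbit \<theta> n s A"
      then obtain g c where g: "g \<in> Uset n K" "gl_mult n e_A (delta g) = cscale c z"
        by (auto simp: e_orbit_def)
      have gU: "g \<in> U" using g K_U by blast
      \<comment> \<open>As for \<open>lidem_orbit\<close>, the scalar in \<open>e_orbit\<close> is
        arbitrary, and 0 is excluded by translating back.\<close>
      have "c \<noteq> 0"
      proof
        assume "c = 0"
        then have "gl_mult n (gl_mult n e_A (delta g)) (delta (gl_inv n g)) = 0" using g by simp
        moreover have "e_A \<in> vanishing_off (carrier (GL n))"
          using right_stable_cyc[of y] E_A_in_cyc_y unfolding e_elt_eq
          by (intro vanishing_off_cscale) (auto simp: right_stable_def)
        ultimately have "e_A = 0"
          using U_carrier[OF gU] by (simp add: conv_assoc conv_delta_delta conv_delta_one_right)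
        then show False using E_A_nonzero E_A_scale by simp
      qed
      then have "z = cscale (1 / c) (gl_mult n e_A (delta g))" using g by simp
      moreover have "gl_mult n e_A (delta g) \<in> cyc e_A"
        using delta_U[OF gU] by (auto simp: cyc_def)
      ultimately show "z \<in> cyc e_A" using right_stable_cscale[OF right_stable_cyc] by simp
    qed
    show "v.subspace (cyc e_A)"
      using right_stable_cyc[of "e_A"] right_stable_cscale[OF right_stable_cyc]
      by (intro v.subspaceI) (auto simp: right_stable_def)
  qed
qed

end

section \<open>The constituent and its realisations\<close>

context hook_disconnected
begin

lemma carrier_Ugroup: "carrier (Ugroup n :: 'a mat monoid) = U"
  by (simp add: Ugroup_def)

lemma cyclic_right_eq_cyc: "cyclic_right n x = cyc x"
  by (simp add: cyclic_right_def cyc_def carrier_Ugroup)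

lemma CU_eq: "CU n = group_algebra GU"
  by (simp add: Ugroup_def)

lemma Ind_eps_eq: "Ind_eps \<theta> n A = Ind"
  by (simp add: Ind_eps_def Ugroup_def eps_idem_eq)

lemma is_constituent_lidem_eps:
  "is_constituent \<theta> n A (cyclic_right n (gl_mult n (lidem \<theta> n A) (eps_idem \<theta> n A)))"
  unfolding is_constituent_def CU_eq Ind_eps_eq cyclic_right_eq_cyc eps_idem_eq
    cyc_a_eq_lidem_orbit[symmetric]
proof (intro conjI allI impI constituent cyc_conv_a_eps_isomorphic_Ind; elim conjE)
  fix N assume "submodule N (group_algebra GU) (gl_module n (cyc a))"
    and "right_module_isomorphic (group_algebra GU) (gl_module n N) Ind"
  then show "N = cyc (gl_mult n a eps)"
    by (simp add: submodule_conv_module_iff[OF right_stable_cyc] constituent_unique)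
qed

end

context verge_module
begin

lemma e_orbit_irreducible:
  "irreducible_right_module (CU n) (gl_module n (cspan (e_orbit \<theta> n s A)))"
  unfolding cspan_e_orbit cyc_e_elt CU_eq
  by (rule cyc_irreducible[OF y_vanishing_off y_eps y_nonzero])

lemma e_orbit_isomorphic_constituent:
  "right_module_isomorphic (CU n) (gl_module n (cspan (e_orbit \<theta> n s A)))
     (gl_module n (cyclic_right n (gl_mult n (lidem \<theta> n A) (eps_idem \<theta> n A))))"
  unfolding cspan_e_orbit cyc_e_elt CU_eq cyclic_right_eq_cyc eps_idem_eq
  by (rule right_module_isomorphic_trans[OF cyc_isomorphic_eps_ideal[OF y_vanishing_off y_eps y_nonzero]
        right_module_isomorphic_sym[OF cyc_isomorphic_eps_ideal]])
     (auto simp: conv_vanishing_off conv_a_eps_eps conv_a_eps_nonzero)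

end

section \<open>Verges, tableaux and the final assembly\<close>

text \<open>Hook disconnectedness is built into \<open>J\<close>: its rows lie in the second row of
  the tableau and its columns in the first.\<close>

lemma verge_main_condition:
  assumes A: "A \<in> Vset n (Jset n s)" and "verge A"
  shows "main_condition_set n (msupp A)" "completely_hook_disconnected (msupp A)"
proof -
  have dim: "dim_row A = n" "dim_col A = n" and supp: "msupp A \<subseteq> Jset n s"
    using A by (auto simp: Vset_def)
  have row: "j = j'" if "(i, j) \<in> msupp A" "(i, j') \<in> msupp A" for i j j'
  proof -
    have "card {j. j < n \<and> A $$ (i, j) \<noteq> 0} \<le> 1"
      using that \<open>verge A\<close> dim by (auto simp: verge_def msupp_def)
    then show ?thesis using that dim by (auto simp: msupp_def card_le_Suc0_iff_eq)
  qed
  have col: "i = i'" if "(i, j) \<in> msupp A" "(i', j) \<in> msupp A" for i i' j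
  proof -
    have "card {i. i < n \<and> A $$ (i, j) \<noteq> 0} \<le> 1"
      using that \<open>verge A\<close> dim by (auto simp: verge_def msupp_def)
    then show ?thesis using that dim by (auto simp: msupp_def card_le_Suc0_iff_eq)
  qed
  show "main_condition_set n (msupp A)"
    using supp row col by (auto simp: main_condition_set_def inj_on_def Jset_def)
  show "completely_hook_disconnected (msupp A)"
    unfolding completely_hook_disconnected_def
  proof (rule equals0I)
    fix i assume "i \<in> fst ` msupp A \<inter> snd ` msupp A"
    then obtain j k where "(i, j) \<in> msupp A" "(k, i) \<in> msupp A" by auto
    then show False using supp by (auto simp: Jset_def)
  qed
qed

lemma row_standard_unique:
  assumes "row_standard n m s"
  shows "s = (sorted_list_of_set ({0..<n} - set (snd s)), sorted_list_of_set (set (snd s)))"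
proof -
  interpret two_part_tableau n m s by unfold_locales (rule assms)
  have "sorted (fst s)" "distinct (fst s)" "sorted (snd s)" "distinct (snd s)"
    using assms by (auto simp: row_standard_def strict_sorted_iff)
  moreover have "set (fst s) = {0..<n} - set (snd s)"
    using set_row_word distinct_row_word by auto
  ultimately have "fst s = sorted_list_of_set ({0..<n} - set (snd s))" "snd s = sorted_list_of_set (set (snd s))"
    by (metis sorted_list_of_set.idem_if_sorted_distinct)+
  then show ?thesis by (metis prod.collapse)
qed

lemma ex1_row_standard:
  assumes "I \<subseteq> {0..<n}"
  shows "\<exists>!s. row_standard n (card I) s \<and> set (snd s) = I"
proof (rule ex1I)
  have "finite I" using assms finite_subset by blast
  then show "row_standard n (card I) (sorted_list_of_set ({0..<n} - I), sorted_list_of_set I) \<and>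
      set (snd (sorted_list_of_set ({0..<n} - I), sorted_list_of_set I)) = I"
    using assms by (auto simp: row_standard_def card_Diff_subset strict_sorted_iff)
next
  fix s assume "row_standard n (card I) s \<and> set (snd s) = I"
  then show "s = (sorted_list_of_set ({0..<n} - I), sorted_list_of_set I)"
    using row_standard_unique[of n "card I" s] by simp
qed

theorem theorem8p17:
  fixes \<theta> :: "'a::{field,finite} \<Rightarrow> complex" and n :: nat
  assumes "nontrivial_additive_character \<theta>"
  shows
    "(\<forall>m s. \<forall>A :: 'a mat.
        1 \<le> m \<and> m \<le> n - 1 \<and> row_standard n m s \<and> A \<in> Vset n (Jset n s) \<and> verge A \<longrightarrow>
        cspan (e_orbit \<theta> n s A) = cyclic_right n (e_elt \<theta> n s A) \<and>
        irreducible_right_module (CU n) (gl_module n (cspan (e_orbit \<theta> n s A))) \<and>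
        cyclic_right n (lidem \<theta> n A) = cspan (lidem_orbit \<theta> n A) \<and>
        is_constituent \<theta> n A (cyclic_right n (gl_mult n (lidem \<theta> n A) (eps_idem \<theta> n A))) \<and>
        right_module_isomorphic (CU n)
          (gl_module n (cspan (e_orbit \<theta> n s A)))
          (gl_module n (cyclic_right n (gl_mult n (lidem \<theta> n A) (eps_idem \<theta> n A)))) \<and>
        right_module_isomorphic (CU n)
          (gl_module n (cyclic_right n (gl_mult n (lidem \<theta> n A) (eps_idem \<theta> n A))))
          (Ind_eps \<theta> n A))
     \<and>
     (\<forall>p. \<forall>A :: 'a mat.
        main_condition_set n p \<and> completely_hook_disconnected p \<and>
        A \<in> carrier_mat n n \<and> msupp A = p \<longrightarrow>
        is_constituent \<theta> n A (cyclic_right n (gl_mult n (lidem \<theta> n A) (eps_idem \<theta> n A))) \<and>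
        (\<exists>!s. row_standard n (card p) s \<and> set (snd s) = fst ` p) \<and>
        (\<forall>s. row_standard n (card p) s \<and> set (snd s) = fst ` p \<longrightarrow>
          A \<in> Vset n (Jset n s) \<and>
          right_module_isomorphic (CU n)
            (gl_module n (cyclic_right n (gl_mult n (lidem \<theta> n A) (eps_idem \<theta> n A))))
            (gl_module n (cspan (e_orbit \<theta> n s A)))))"
proof (intro conjI allI impI; elim conjE)
  fix m s and A :: "'a mat"
  assume rs: "row_standard n m s" and A: "A \<in> Vset n (Jset n s)" and v: "verge A"
  interpret verge_module \<theta> n A m s
    using assms A rs verge_main_condition[OF A v] by unfold_locales (auto simp: Vset_iff)
  show "cspan (e_orbit \<theta> n s A) = cyclic_right n (e_elt \<theta> n s A)"
    by (simp add: cspan_e_orbit cyclic_right_eq_cyc)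
  show "irreducible_right_module (CU n) (gl_module n (cspan (e_orbit \<theta> n s A)))"
    by (rule e_orbit_irreducible)
  show "cyclic_right n (lidem \<theta> n A) = cspan (lidem_orbit \<theta> n A)"
    by (simp add: cyc_a_eq_lidem_orbit cyclic_right_eq_cyc)
  show const: "is_constituent \<theta> n A (cyclic_right n (gl_mult n (lidem \<theta> n A) (eps_idem \<theta> n A)))"
    by (rule is_constituent_lidem_eps)
  show "right_module_isomorphic (CU n) (gl_module n (cspan (e_orbit \<theta> n s A)))
      (gl_module n (cyclic_right n (gl_mult n (lidem \<theta> n A) (eps_idem \<theta> n A))))"
    by (rule e_orbit_isomorphic_constituent)
  show "right_module_isomorphic (CU n)
      (gl_module n (cyclic_right n (gl_mult n (lidem \<theta> n A) (eps_idem \<theta> n A)))) (Ind_eps \<theta> n A)"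
    using const by (simp add: is_constituent_def)
next
  fix p and A :: "'a mat"
  assume p: "main_condition_set n p" "completely_hook_disconnected p" and A: "A \<in> carrier_mat n n" "msupp A = p"
  interpret hook_disconnected \<theta> n A
    using assms p A by unfold_locales auto
  show "is_constituent \<theta> n A (cyclic_right n (gl_mult n (lidem \<theta> n A) (eps_idem \<theta> n A)))"
    by (rule is_constituent_lidem_eps)
  have card: "card (fst ` p) = card p"
    using p by (intro card_image) (simp add: main_condition_set_def)
  have "fst ` p \<subseteq> {0..<n}" using p by (auto simp: main_condition_set_def Phi_def)
  from ex1_row_standard[OF this] show "\<exists>!s. row_standard n (card p) s \<and> set (snd s) = fst ` p"
    by (simp add: card)
  fix s assume s: "row_standard n (card p) s" "set (snd s) = fst ` p"
  show AJ: "A \<in> Vset n (Jset n s)"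
  proof -
    have "(i, j) \<in> Jset n s" if ij: "(i, j) \<in> p" for i j
    proof -
      have "i \<in> fst ` p" "j \<in> snd ` p" using ij by force+
      moreover have "(i, j) \<in> Phi n" using ij p(1) by (auto simp: main_condition_set_def)
      ultimately show ?thesis using p(2) s(2) by (auto simp: Jset_def completely_hook_disconnected_def)
    qed
    then show ?thesis using A by (auto simp: Vset_def)
  qed
  interpret verge_module \<theta> n A "card p" s
    using s AJ by unfold_locales
  show "right_module_isomorphic (CU n)
      (gl_module n (cyclic_right n (gl_mult n (lidem \<theta> n A) (eps_idem \<theta> n A))))
      (gl_module n (cspan (e_orbit \<theta> n s A)))"
    by (rule right_module_isomorphic_sym[OF e_orbit_isomorphic_constituent])
qed

end
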